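(* Let $\Sigma^2$ be an oriented $2$-manifold, $(M^3,g)$ an oriented Riemannian $3$-manifold, $f:\Sigma^2\to(M^3,g)$ a frontal, and $p$ a cuspidal edge of $f$. Then the Gaussian curvature $K$ of $f$ is rationally bounded (resp. rationally continuous) at $p$ if and only if $\kappa_\nu(p)=0$ (resp. $\kappa_\nu(p)=\kappa_\nu'(p)=0$).
   Context: All manifolds and maps are $C^\infty$. Write $\langle\cdot,\cdot\rangle=g$, $|\cdot|$ for the norm and $\nabla$ for the Levi-Civita connection of $(M^3,g)$. A singular point of $f$ is a point where $f$ is not an immersion; other points are regular. $f$ is a frontal if around each point there is a unit vector field $\nu$ along $f$ with $\nu\perp df(a)$ for all tangent vectors $a$; a unit normal $\nu$ is fixed near $p$. A singular point $p$ is a cuspidal edge if the map germ of $f$ at $p$ is right-left equivalent (equivalent under diffeomorphism germs of source and target, in local coordinates) to $(u,v)\mapsto(u,v^2,v^3)$ at the origin. Near a cuspidal edge the singular set is a regular curve $\gamma$ in $\Sigma^2$ (the singular curve, $\gamma(0)=p$) and $\hat\gamma:=f\circ\gamma$ is a regular curve. Limiting normal curvature: $\kappa_\nu(\gamma(t))=\langle\nabla_{\hat\gamma'}\hat\gamma',\nu(\gamma(t))\rangle/|\hat\gamma'(t)|^2$; $\kappa'_\nu(p)$ is the derivative at $p$ of $\kappa_\nu$ along $\gamma$ with respect to the arclength parameter of $\hat\gamma$. Gaussian curvature: $K$ is the Gaussian curvature of $f^*g$ on the set of regular points. Rational boundedness and continuity: on $\mathbb R\times S^1$ ($S^1=\mathbb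 R/2\pi\mathbb Z$) let $(r,\theta)\sim(-r,\theta+\pi)$, let $\mathcal M$ be the quotient and $\pi$ the projection, and let $\Phi:\mathcal M\to\mathbb R^2$ be the map with $\Phi(\pi(r,\theta))=(r\cos\theta,r\sin\theta)$. Transplanting by a local coordinate system centered at $p$ gives the blow up $\Phi:\hat\Sigma^2_p\to\Sigma^2$ at $p$ (independent of the coordinates). Let $W$ be a neighborhood of $p$ and $\mathcal O$ an open dense subset of $W$. A $C^\infty$ function $\varphi:\mathcal O\to\mathbb R$ is rationally bounded at $p$ if there is a $C^\infty$ function $\rho:\Phi^{-1}(W)\to\mathbb R$ such that (a) $\Phi^{-1}(\mathcal O\setminus\{p\})=\Phi^{-1}(W\setminus\{p\})\cap\rho^{-1}(\mathbb R\setminus\{0\})$; (b) $\rho^{-1}(0)\cap\Phi^{-1}(p)$ is a finite set; (c) there is a $C^\infty$ function $\psi:\Phi^{-1}(W)\to\mathbb R$ with $\psi(q)=\rho(q)\,\varphi(\Phi(q))$ for $q\in\Phi^{-1}(\mathcal O)$. It is rationally continuous at $p$ if moreover there is a constant $c$ with $\psi(q)=c\,\rho(q)$ for all $q\in\Phi^{-1}(p)$. For $\varphi=K$, one takes $W$ a sufficiently small neighborhood of $p$ and $\mathcal O$ the set of regular points of $f$ in $W$. *)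

theory Defs
  imports "HOL-Analysis.Analysis"
begin

section \<open>Smooth maps between Euclidean spaces\<close>

text \<open>Only used on open sets \<open>S\<close>, where it says that all iterated partial derivatives exist and
  are continuous.\<close>

primrec Ck_on ::
  "nat \<Rightarrow> 'a::euclidean_space set \<Rightarrow> ('a \<Rightarrow> 'b::real_normed_vector) \<Rightarrow> bool" where
  "Ck_on 0 S F \<longleftrightarrow> continuous_on S F"
| "Ck_on (Suc k) S F \<longleftrightarrow> (\<forall>x\<in>S. F differentiable (at x)) \<and>
     (\<forall>b\<in>Basis. Ck_on k S (\<lambda>x. frechet_derivative F (at x) b))"

definition smooth_on :: "'a::euclidean_space set \<Rightarrow> ('a \<Rightarrow> 'b::real_normed_vector) \<Rightarrow> bool" where
  "smooth_on S F \<longleftrightarrow> (\<forall>k. Ck_on k S F)"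


section \<open>Riemannian geometry in a coordinate domain\<close>

text \<open>Here a metric is a matrix-valued function \<open>h\<close> of the coordinates.\<close>

definition partial :: "'n::finite \<Rightarrow> (real^'n \<Rightarrow> real) \<Rightarrow> real^'n \<Rightarrow> real" where
  "partial i F x = frechet_derivative F (at x) (axis i 1)"

text \<open>\<open>christoffel h k i j\<close> is the symbol with upper index \<open>k\<close> and lower indices \<open>i\<close>, \<open>j\<close>.\<close>

definition christoffel ::
  "(real^'n \<Rightarrow> real^'n^'n) \<Rightarrow> 'n::finite \<Rightarrow> 'n \<Rightarrow> 'n \<Rightarrow> real^'n \<Rightarrow> real" where
  "christoffel h k i j x = (1 / 2) * (\<Sum>l\<in>UNIV. matrix_inv (h x) $ k $ l *
     (partial i (\<lambda>y. h y $ j $ l) x + partial j (\<lambda>y. h y $ i $ l) x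
        - partial l (\<lambda>y. h y $ i $ j) x))"

text \<open>\<open>riemann h l i j k\<close> is the \<open>l\<close>-th component of
  \<open>R(\<partial>\<^sub>i,\<partial>\<^sub>j)\<partial>\<^sub>k = \<nabla>\<^sub>i\<nabla>\<^sub>j\<partial>\<^sub>k - \<nabla>\<^sub>j\<nabla>\<^sub>i\<partial>\<^sub>k\<close>.\<close>

definition riemann ::
  "(real^'n \<Rightarrow> real^'n^'n) \<Rightarrow> 'n::finite \<Rightarrow> 'n \<Rightarrow> 'n \<Rightarrow> 'n \<Rightarrow> real^'n \<Rightarrow> real" where
  "riemann h l i j k x =
     partial i (christoffel h l j k) x - partial j (christoffel h l i k) x
     + (\<Sum>m\<in>UNIV. christoffel h m j k x * christoffel h l i m x
                 - christoffel h m i k x * christoffel h l j m x)"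

text \<open>\<open>K = h(R(\<partial>\<^sub>1,\<partial>\<^sub>2)\<partial>\<^sub>2,\<partial>\<^sub>1) / det h\<close>.\<close>

definition gauss_curvature_coord :: "(real^2 \<Rightarrow> real^2^2) \<Rightarrow> real^2 \<Rightarrow> real" where
  "gauss_curvature_coord h x =
     (\<Sum>l\<in>UNIV. riemann h l 1 2 2 x * h x $ l $ 1) / det (h x)"

definition velocity :: "(real \<Rightarrow> real^'n::finite) \<Rightarrow> real \<Rightarrow> real^'n" where
  "velocity \<sigma> t = vector_derivative \<sigma> (at t)"

text \<open>Covariant derivative of the velocity of \<open>\<sigma>\<close> along \<open>\<sigma>\<close>.\<close>

definition covariant_acceleration ::
  "(real^'n \<Rightarrow> real^'n^'n) \<Rightarrow> (real \<Rightarrow> real^'n::finite) \<Rightarrow> real \<Rightarrow> real^'n" where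
  "covariant_acceleration h \<sigma> t = velocity (velocity \<sigma>) t +
     (\<chi> k. \<Sum>i\<in>UNIV. \<Sum>j\<in>UNIV.
        christoffel h k i j (\<sigma> t) * velocity \<sigma> t $ i * velocity \<sigma> t $ j)"


section \<open>Manifolds\<close>

text \<open>A manifold is a Hausdorff, second countable type with an atlas. A chart is a pair of its
  domain and its coordinate map; values of the map outside the domain are irrelevant.\<close>

type_synonym ('p, 'n) chart = "'p set \<times> ('p \<Rightarrow> real^'n)"

abbreviation cdom :: "('p, 'n) chart \<Rightarrow> 'p set" where "cdom c \<equiv> fst c"
abbreviation coord :: "('p, 'n) chart \<Rightarrow> 'p \<Rightarrow> real^'n" where "coord c \<equiv> snd c"
abbreviation cinv :: "('p, 'n) chart \<Rightarrow> real^'n \<Rightarrow> 'p" where "cinv c \<equiv> inv_into (cdom c) (coord c)"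

definition is_chart :: "('p::topological_space, 'n::finite) chart \<Rightarrow> bool" where
  "is_chart c \<longleftrightarrow> open (cdom c) \<and> open (coord c ` cdom c) \<and>
     homeomorphism (cdom c) (coord c ` cdom c) (coord c) (cinv c)"

definition transition :: "('p, 'n) chart \<Rightarrow> ('p, 'n) chart \<Rightarrow> real^'n \<Rightarrow> real^'n" where
  "transition c d = coord d \<circ> cinv c"

definition transition_jacobian ::
  "('p, 'n::finite) chart \<Rightarrow> ('p, 'n) chart \<Rightarrow> 'p \<Rightarrow> real^'n^'n" where
  "transition_jacobian c d y = jacobian (transition c d) (at (coord c y))"

definition smooth_transition ::
  "('p, 'n::finite) chart \<Rightarrow> ('p, 'n) chart \<Rightarrow> bool" where
  "smooth_transition c d \<longleftrightarrow> smooth_on (coord c ` (cdom c \<inter> cdom d)) (transition c d)"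

definition oriented_atlas ::
  "('p::{t2_space,second_countable_topology}, 'n::finite) chart set \<Rightarrow> bool" where
  "oriented_atlas A \<longleftrightarrow> (\<forall>c\<in>A. is_chart c) \<and> (\<Union>c\<in>A. cdom c) = UNIV \<and>
     (\<forall>c\<in>A. \<forall>d\<in>A. smooth_transition c d \<and>
        (\<forall>y\<in>cdom c \<inter> cdom d. det (transition_jacobian c d y) > 0))"

text \<open>Local coordinate systems centered at \<open>p\<close>: members of the maximal (not necessarily oriented)
  atlas containing \<open>A\<close>.\<close>

definition coords_centered_at ::
  "('p::topological_space, 'n::finite) chart set \<Rightarrow> 'p \<Rightarrow> ('p, 'n) chart \<Rightarrow> bool" where
  "coords_centered_at A p c \<longleftrightarrow> is_chart c \<and>
     (\<forall>d\<in>A. smooth_transition c d \<and> smooth_transition d c) \<and>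
     p \<in> cdom c \<and> coord c p = 0"

definition chart_at :: "('p, 'n) chart set \<Rightarrow> 'p \<Rightarrow> ('p, 'n) chart" where
  "chart_at A x = (SOME c. c \<in> A \<and> x \<in> cdom c)"

definition smooth_fun_on ::
  "('p, 'n::finite) chart set \<Rightarrow> 'p set \<Rightarrow> ('p \<Rightarrow> real) \<Rightarrow> bool" where
  "smooth_fun_on A S \<phi> \<longleftrightarrow> (\<forall>c\<in>A. smooth_on (coord c ` (cdom c \<inter> S)) (\<phi> \<circ> cinv c))"

definition local_rep ::
  "('p, 'n) chart \<Rightarrow> ('q, 'k) chart \<Rightarrow> ('p \<Rightarrow> 'q) \<Rightarrow> real^'n \<Rightarrow> real^'k" where
  "local_rep c d f = coord d \<circ> f \<circ> cinv c"

definition smooth_map ::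
  "('p::topological_space, 'n::finite) chart set \<Rightarrow> ('q::topological_space, 'k::finite) chart set
     \<Rightarrow> ('p \<Rightarrow> 'q) \<Rightarrow> bool" where
  "smooth_map A B f \<longleftrightarrow> continuous_on UNIV f \<and>
     (\<forall>c\<in>A. \<forall>d\<in>B. smooth_on (coord c ` (cdom c \<inter> f -` cdom d)) (local_rep c d f))"

text \<open>The matrix of the differential of \<open>f\<close> at \<open>x\<close> with respect to the charts \<open>c\<close> and \<open>d\<close>.\<close>

definition differential ::
  "('p, 'n::finite) chart \<Rightarrow> ('q, 'k::finite) chart \<Rightarrow> ('p \<Rightarrow> 'q) \<Rightarrow> 'p \<Rightarrow> real^'n^'k" where
  "differential c d f x = jacobian (local_rep c d f) (at (coord c x))"

definition regular_points ::
  "('p, 'n::finite) chart set \<Rightarrow> ('q, 'k::finite) chart set \<Rightarrow> ('p \<Rightarrow> 'q) \<Rightarrow> 'p set" where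
  "regular_points A B f = {x. \<forall>c\<in>A. \<forall>d\<in>B. x \<in> cdom c \<longrightarrow> f x \<in> cdom d \<longrightarrow>
     inj (\<lambda>a. differential c d f x *v a)}"

definition singular_points ::
  "('p, 'n::finite) chart set \<Rightarrow> ('q, 'k::finite) chart set \<Rightarrow> ('p \<Rightarrow> 'q) \<Rightarrow> 'p set" where
  "singular_points A B f = - regular_points A B f"


section \<open>Metrics, frontals and cuspidal edges\<close>

text \<open>A metric assigns to each chart of the atlas its component matrix as a function of the
  coordinates, subject to the transformation law of a covariant 2-tensor.\<close>

type_synonym ('p, 'n) metric_family = "('p, 'n) chart \<Rightarrow> real^'n \<Rightarrow> real^'n^'n"

definition riemannian_metric ::
  "('p, 'n::finite) chart set \<Rightarrow> ('p, 'n) metric_family \<Rightarrow> bool" where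
  "riemannian_metric B g \<longleftrightarrow>
     (\<forall>d\<in>B. smooth_on (coord d ` cdom d) (g d) \<and>
        (\<forall>z\<in>coord d ` cdom d. transpose (g d z) = g d z \<and>
           (\<forall>v. v \<noteq> 0 \<longrightarrow> v \<bullet> (g d z *v v) > 0))) \<and>
     (\<forall>d\<in>B. \<forall>e\<in>B. \<forall>y\<in>cdom d \<inter> cdom e.
        g d (coord d y) =
          transpose (transition_jacobian d e y) ** g e (coord e y) ** transition_jacobian d e y)"

text \<open>Inner product at \<open>y\<close> of tangent vectors with components \<open>v\<close> and \<open>w\<close> in the chart \<open>d\<close>.\<close>

definition inner_at ::
  "('p, 'n::finite) metric_family \<Rightarrow> ('p, 'n) chart \<Rightarrow> 'p \<Rightarrow> real^'n \<Rightarrow> real^'n \<Rightarrow> real" where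
  "inner_at g d y v w = v \<bullet> (g d (coord d y) *v w)"

definition pullback_metric ::
  "('q, 'k::finite) chart set \<Rightarrow> ('q, 'k) metric_family \<Rightarrow> ('p \<Rightarrow> 'q)
     \<Rightarrow> ('p, 'n::finite) metric_family" where
  "pullback_metric B g f c z =
     (let x = cinv c z; d = chart_at B (f x); J = differential c d f x
      in transpose J ** g d (coord d (f x)) ** J)"

definition gauss_curvature ::
  "('p, 2) chart set \<Rightarrow> ('p, 2) metric_family \<Rightarrow> 'p \<Rightarrow> real" where
  "gauss_curvature A h x =
     (let c = chart_at A x in gauss_curvature_coord (h c) (coord c x))"

text \<open>A vector field along \<open>f\<close> sends a point \<open>x\<close> and a chart \<open>d\<close> around \<open>f x\<close> to the components in
  \<open>d\<close> of a tangent vector at \<open>f x\<close>.\<close>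

definition smooth_field_along ::
  "('p, 'n::finite) chart set \<Rightarrow> ('q, 'k::finite) chart set \<Rightarrow> ('p \<Rightarrow> 'q) \<Rightarrow> 'p set
     \<Rightarrow> ('p \<Rightarrow> ('q, 'k) chart \<Rightarrow> real^'k) \<Rightarrow> bool" where
  "smooth_field_along A B f V \<nu> \<longleftrightarrow>
     (\<forall>x\<in>V. \<forall>d\<in>B. \<forall>e\<in>B. f x \<in> cdom d \<longrightarrow> f x \<in> cdom e \<longrightarrow>
        \<nu> x e = transition_jacobian d e (f x) *v \<nu> x d) \<and>
     (\<forall>c\<in>A. \<forall>d\<in>B. smooth_on (coord c ` (cdom c \<inter> V \<inter> f -` cdom d)) (\<lambda>z. \<nu> (cinv c z) d))"

definition unit_normal_on ::
  "('p, 'n::finite) chart set \<Rightarrow> ('q, 'k::finite) chart set \<Rightarrow> ('q, 'k) metric_family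
     \<Rightarrow> ('p \<Rightarrow> 'q) \<Rightarrow> 'p set \<Rightarrow> ('p \<Rightarrow> ('q, 'k) chart \<Rightarrow> real^'k) \<Rightarrow> bool" where
  "unit_normal_on A B g f V \<nu> \<longleftrightarrow> smooth_field_along A B f V \<nu> \<and>
     (\<forall>x\<in>V. \<forall>c\<in>A. \<forall>d\<in>B. x \<in> cdom c \<longrightarrow> f x \<in> cdom d \<longrightarrow>
        inner_at g d (f x) (\<nu> x d) (\<nu> x d) = 1 \<and>
        (\<forall>a. inner_at g d (f x) (\<nu> x d) (differential c d f x *v a) = 0))"

definition frontal ::
  "('p::topological_space, 2) chart set \<Rightarrow> ('q::topological_space, 3) chart set
     \<Rightarrow> ('q, 3) metric_family \<Rightarrow> ('p \<Rightarrow> 'q) \<Rightarrow> bool" where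
  "frontal A B g f \<longleftrightarrow> smooth_map A B f \<and>
     (\<forall>x. \<exists>V \<nu>. open V \<and> x \<in> V \<and> unit_normal_on A B g f V \<nu>)"

definition cuspidal_edge ::
  "('p::topological_space, 2) chart set \<Rightarrow> ('q::topological_space, 3) chart set
     \<Rightarrow> ('p \<Rightarrow> 'q) \<Rightarrow> 'p \<Rightarrow> bool" where
  "cuspidal_edge A B f p \<longleftrightarrow>
     (\<exists>c d. coords_centered_at A p c \<and> coords_centered_at B (f p) d \<and> f ` cdom c \<subseteq> cdom d \<and>
        (\<forall>x\<in>cdom c. coord d (f x) =
           vector [coord c x $ 1, (coord c x $ 2)\<^sup>2, (coord c x $ 2) ^ 3]))"

text \<open>\<open>\<gamma>\<close> on \<open>{-\<epsilon><..<\<epsilon>}\<close> is a regular parametrization of the singular set of \<open>f\<close> near \<open>p\<close>.\<close>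

definition singular_curve ::
  "('p::topological_space, 2) chart set \<Rightarrow> ('q::topological_space, 3) chart set
     \<Rightarrow> ('p \<Rightarrow> 'q) \<Rightarrow> 'p \<Rightarrow> real \<Rightarrow> (real \<Rightarrow> 'p) \<Rightarrow> bool" where
  "singular_curve A B f p \<epsilon> \<gamma> \<longleftrightarrow> 0 < \<epsilon> \<and> \<gamma> 0 = p \<and>
     continuous_on {-\<epsilon><..<\<epsilon>} \<gamma> \<and> inj_on \<gamma> {-\<epsilon><..<\<epsilon>} \<and>
     (\<forall>c\<in>A. smooth_on {t\<in>{-\<epsilon><..<\<epsilon>}. \<gamma> t \<in> cdom c} (coord c \<circ> \<gamma>) \<and>
        (\<forall>t\<in>{-\<epsilon><..<\<epsilon>}. \<gamma> t \<in> cdom c \<longrightarrow> velocity (coord c \<circ> \<gamma>) t \<noteq> 0)) \<and>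
     (\<exists>N. open N \<and> p \<in> N \<and> \<gamma> ` {-\<epsilon><..<\<epsilon>} = N \<inter> singular_points A B f)"


section \<open>Limiting normal curvature\<close>

definition curve_speed ::
  "('q, 3) chart set \<Rightarrow> ('q, 3) metric_family \<Rightarrow> (real \<Rightarrow> 'q) \<Rightarrow> real \<Rightarrow> real" where
  "curve_speed B g \<beta> t =
     (let d = chart_at B (\<beta> t); v = velocity (coord d \<circ> \<beta>) t in sqrt (inner_at g d (\<beta> t) v v))"

definition limiting_normal_curvature ::
  "('q, 3) chart set \<Rightarrow> ('q, 3) metric_family \<Rightarrow> ('p \<Rightarrow> 'q)
     \<Rightarrow> ('p \<Rightarrow> ('q, 3) chart \<Rightarrow> real^3) \<Rightarrow> (real \<Rightarrow> 'p) \<Rightarrow> real \<Rightarrow> real" where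
  "limiting_normal_curvature B g f \<nu> \<gamma> t =
     (let \<beta> = f \<circ> \<gamma>; d = chart_at B (\<beta> t)
      in inner_at g d (\<beta> t) (covariant_acceleration (g d) (coord d \<circ> \<beta>) t) (\<nu> (\<gamma> t) d)
           / (curve_speed B g \<beta> t)\<^sup>2)"

text \<open>Signed arclength measured from parameter \<open>0\<close>.\<close>

definition arclength ::
  "('q, 3) chart set \<Rightarrow> ('q, 3) metric_family \<Rightarrow> (real \<Rightarrow> 'q) \<Rightarrow> real \<Rightarrow> real" where
  "arclength B g \<beta> t =
     (if 0 \<le> t then integral {0..t} (curve_speed B g \<beta>)
      else - integral {t..0} (curve_speed B g \<beta>))"

definition limiting_normal_curvature_deriv ::
  "('q, 3) chart set \<Rightarrow> ('q, 3) metric_family \<Rightarrow> ('p \<Rightarrow> 'q)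
     \<Rightarrow> ('p \<Rightarrow> ('q, 3) chart \<Rightarrow> real^3) \<Rightarrow> real \<Rightarrow> (real \<Rightarrow> 'p) \<Rightarrow> real" where
  "limiting_normal_curvature_deriv B g f \<nu> \<epsilon> \<gamma> =
     deriv (\<lambda>s. limiting_normal_curvature B g f \<nu> \<gamma>
              (inv_into {-\<epsilon><..<\<epsilon>} (arclength B g (f \<circ> \<gamma>)) s)) 0"


section \<open>Blow up, rational boundedness and rational continuity\<close>

text \<open>The relation on \<open>\<real> \<times> \<real>\<close> whose quotient is \<open>\<M>\<close>; its case of even \<open>k\<close> is the
  passage from \<open>\<real> \<times> \<real>\<close> to \<open>\<real> \<times> S\<^sup>1\<close>.\<close>

definition moebius_rel :: "real \<times> real \<Rightarrow> real \<times> real \<Rightarrow> bool" where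
  "moebius_rel z w \<longleftrightarrow>
     (\<exists>k::int. fst w = (- 1) powi k * fst z \<and> snd w = snd z + of_int k * pi)"

lemma equivp_moebius_rel: "equivp moebius_rel"
proof (rule equivpI)
  show "reflp moebius_rel"
    by (rule reflpI) (auto simp: moebius_rel_def intro: exI[of _ 0])
  show "symp moebius_rel"
  proof (rule sympI)
    fix z w assume "moebius_rel z w"
    then obtain k :: int where k: "fst w = (- 1) powi k * fst z" "snd w = snd z + of_int k * pi"
      by (auto simp: moebius_rel_def)
    have "(- 1 :: real) powi (- k) * (- 1) powi k = 1"
      by (simp flip: power_int_add)
    then have "fst z = (- 1) powi (- k) * fst w"
      unfolding k(1) by (simp only: mult.assoc[symmetric] mult_1_left)
    moreover have "snd z = snd w + of_int (- k) * pi"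
      using k by (simp add: algebra_simps)
    ultimately show "moebius_rel w z"
      unfolding moebius_rel_def by blast
  qed
  show "transp moebius_rel"
  proof (rule transpI)
    fix x y z assume "moebius_rel x y" "moebius_rel y z"
    then obtain k l :: int where k: "fst y = (- 1) powi k * fst x" "snd y = snd x + of_int k * pi"
      and l: "fst z = (- 1) powi l * fst y" "snd z = snd y + of_int l * pi"
      by (auto simp: moebius_rel_def)
    have "fst z = (- 1) powi (l + k) * fst x"
      unfolding l(1) k(1) by (simp add: power_int_add mult.assoc)
    moreover have "snd z = snd x + of_int (l + k) * pi"
      using k l by (simp add: algebra_simps)
    ultimately show "moebius_rel x z"
      unfolding moebius_rel_def by blast
  qed
qed

quotient_type moebius = "real \<times> real" / moebius_rel
  morphisms rep_moebius proj_moebius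
  by (rule equivp_moebius_rel)

lemma sin_cos_add_int_pi:
  "cos (t + of_int k * pi) = (- 1) powi k * cos t" "sin (t + of_int k * pi) = (- 1) powi k * sin t"
proof -
  have c: "cos (of_int k * pi) = (- 1) powi k"
    using cos_npi_int[of k] by (auto simp: mult.commute power_int_minus_left)
  have s: "sin (of_int k * pi) = 0"
    using sin_npi_int[of k] by (simp add: mult.commute)
  show "cos (t + of_int k * pi) = (- 1) powi k * cos t"
    "sin (t + of_int k * pi) = (- 1) powi k * sin t"
    using c s by (simp_all add: cos_add sin_add)
qed

lift_definition blow_down :: "moebius \<Rightarrow> real^2"
  is "\<lambda>(r, \<theta>). vector [r * cos \<theta>, r * sin \<theta>]"
proof -
  fix z w :: "real \<times> real" assume "moebius_rel z w"
  then obtain k :: int where k: "fst w = (- 1) powi k * fst z" "snd w = snd z + of_int k * pi"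
    by (auto simp: moebius_rel_def)
  have "(- 1 :: real) powi k * (- 1) powi k = 1"
    by (cases "even k") auto
  then have kk: "((- 1) powi k * a) * ((- 1) powi k * b) = a * b" for a b :: real
    by (metis (no_types, opaque_lifting) mult.assoc mult.left_commute mult_1_left)
  then show "(case z of (r, \<theta>) \<Rightarrow> vector [r * cos \<theta>, r * sin \<theta>]) =
      ((case w of (r, \<theta>) \<Rightarrow> vector [r * cos \<theta>, r * sin \<theta>]) :: real^2)"
    by (simp only: case_prod_unfold k sin_cos_add_int_pi kk)
qed

text \<open>The projection \<open>\<real> \<times> \<real> \<rightarrow> \<M>\<close> is a local diffeomorphism, so smoothness on an
  open subset of \<open>\<M>\<close> is smoothness of the lift.\<close>

definition smooth_on_moebius :: "moebius set \<Rightarrow> (moebius \<Rightarrow> real) \<Rightarrow> bool" where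
  "smooth_on_moebius S \<rho> \<longleftrightarrow> smooth_on (proj_moebius -` S) (\<rho> \<circ> proj_moebius)"

text \<open>Preimage under the blow up at \<open>p\<close>, transplanted by coordinates \<open>c\<close> centered at \<open>p\<close>; used
  for \<open>S \<subseteq> cdom c\<close>. On it the blow up map itself is \<open>cinv c \<circ> blow_down\<close>.\<close>

definition blow_up_preimage :: "('p, 2) chart \<Rightarrow> 'p set \<Rightarrow> moebius set" where
  "blow_up_preimage c S = {q. blow_down q \<in> coord c ` S}"

text \<open>The three conditions on the pair \<open>\<rho>\<close>, \<open>\<psi>\<close>.\<close>

definition rational_pair ::
  "('p, 2) chart \<Rightarrow> 'p \<Rightarrow> 'p set \<Rightarrow> 'p set \<Rightarrow> ('p \<Rightarrow> real)
     \<Rightarrow> (moebius \<Rightarrow> real) \<Rightarrow> (moebius \<Rightarrow> real) \<Rightarrow> bool" where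
  "rational_pair c p W \<O> \<phi> \<rho> \<psi> \<longleftrightarrow>
     smooth_on_moebius (blow_up_preimage c W) \<rho> \<and>
     blow_up_preimage c (\<O> - {p}) = blow_up_preimage c (W - {p}) \<inter> {q. \<rho> q \<noteq> 0} \<and>
     finite ({q. \<rho> q = 0} \<inter> blow_up_preimage c {p}) \<and>
     smooth_on_moebius (blow_up_preimage c W) \<psi> \<and>
     (\<forall>q\<in>blow_up_preimage c \<O>. \<psi> q = \<rho> q * \<phi> (cinv c (blow_down q)))"

definition open_dense_in :: "'p::topological_space set \<Rightarrow> 'p set \<Rightarrow> bool" where
  "open_dense_in W \<O> \<longleftrightarrow> open \<O> \<and> \<O> \<subseteq> W \<and> W \<subseteq> closure \<O>"

definition rationally_bounded ::
  "('p::topological_space, 2) chart set \<Rightarrow> ('p, 2) chart \<Rightarrow> 'p \<Rightarrow> 'p set \<Rightarrow> 'p set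
     \<Rightarrow> ('p \<Rightarrow> real) \<Rightarrow> bool" where
  "rationally_bounded A c p W \<O> \<phi> \<longleftrightarrow> open_dense_in W \<O> \<and> smooth_fun_on A \<O> \<phi> \<and>
     (\<exists>\<rho> \<psi>. rational_pair c p W \<O> \<phi> \<rho> \<psi>)"

definition rationally_continuous ::
  "('p::topological_space, 2) chart set \<Rightarrow> ('p, 2) chart \<Rightarrow> 'p \<Rightarrow> 'p set \<Rightarrow> 'p set
     \<Rightarrow> ('p \<Rightarrow> real) \<Rightarrow> bool" where
  "rationally_continuous A c p W \<O> \<phi> \<longleftrightarrow> open_dense_in W \<O> \<and> smooth_fun_on A \<O> \<phi> \<and>
     (\<exists>\<rho> \<psi>. rational_pair c p W \<O> \<phi> \<rho> \<psi> \<and>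
        (\<exists>k. \<forall>q\<in>blow_up_preimage c {p}. \<psi> q = k * \<rho> q))"

end

theory Submission
  imports Defs
begin

text \<open>In the coordinates of the normal form, \<open>f\<^sub>v = v H\<close> with \<open>H\<close> smooth and independent of \<open>f\<^sub>u\<close>. In the
  Gauss equation both the ambient curvature term and the square of the mixed second fundamental form then carry
  the factor \<open>v\<^sup>2\<close> of the determinant of the induced metric, while the product of the two diagonal terms
  carries only \<open>v\<close>. Hence \<open>v K\<close> is smooth, and on \<open>v = 0\<close> it is the limiting normal curvature times a
  nonvanishing function.

  So \<open>K = \<Psi> / v\<close> in any coordinates centered at \<open>p\<close>, where \<open>v\<close> has nonzero derivative at the origin. In
  polar coordinates \<open>v = r s\<close>, and if \<open>\<Psi>(0) = 0\<close> then \<open>\<Psi> = r t\<close> by Hadamard's lemma, so that the pair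
  \<open>\<rho> = s\<^sup>2\<close>, \<open>\<psi> = s t\<close> witnesses rational boundedness; conversely the limit of \<open>\<psi> v = \<rho> \<Psi>\<close> along a generic ray gives
  \<open>\<Psi>(0) = 0\<close>. Rational continuity says in addition that \<open>t\<close> is proportional to \<open>s\<close> on \<open>r = 0\<close>, that is,
  \<open>d\<Psi> = k dv\<close> at the origin, which means that the derivative of the limiting normal curvature along
  the singular curve vanishes.\<close>

section \<open>Smooth maps\<close>

text \<open>Two obstacles shape the argument. The metric has components only in the charts of
  \<open>B\<close>, and the curvature is evaluated in a chart of \<open>A\<close> picked by
  \<open>chart_at\<close>, whereas the normal form holds in charts \<open>c0\<close>,
  \<open>d0\<close> that belong merely to the maximal atlases. The surface is therefore represented
  by \<open>F\<close>, from \<open>c0\<close> to an atlas chart \<open>d\<close>, and the cusp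
  enters through the transition map \<tau> from \<open>d0\<close> to \<open>d\<close>. The Gauss
  equation is derived in the picked chart and carried over to \<open>c0\<close>, where both sides
  gain the same squared Jacobian determinant. Moreover, the Gauss equation needs a positive definite
  induced metric, which is lost on the edge. So \<open>gauss_num\<close> is built from the ambient
  connection alone and makes sense there as well. The factor between v K and the limiting normal
  curvature does not vanish on the edge because the cubic coordinate of the cusp makes the
  derivative of \<open>H\<close> across the edge transversal to the limiting tangent plane. In
  rational continuity the constant k absorbs the derivative of \<Psi> across the edge; only the
  derivative along the edge is constrained.\<close>

abbreviation DD :: "'a::real_normed_vector \<Rightarrow> ('a \<Rightarrow> 'b::real_normed_vector) \<Rightarrow> 'a \<Rightarrow> 'b" where
  "DD b F \<equiv> (\<lambda>x. frechet_derivative F (at x) b)"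

lemma DD_eqI: "(F has_derivative F') (at x) \<Longrightarrow> DD b F x = F' b"
  using frechet_derivative_at by metis

lemma DD_works: "F differentiable (at x) \<Longrightarrow> (F has_derivative (\<lambda>b. DD b F x)) (at x)"
  by (simp add: frechet_derivative_works)

text \<open>\<open>frechet_derivative\<close> is a choice from the set of all derivatives, and that
  set depends only on the germ; equality thus persists at points where neither function is
  differentiable.\<close>

lemma DD_cong:
  assumes "open S" "x \<in> S" "\<And>y. y \<in> S \<Longrightarrow> F y = G y"
  shows "DD b F x = DD b G x"
proof -
  have "(F has_derivative F') (at x) \<longleftrightarrow> (G has_derivative F') (at x)" for F'
    using has_derivative_transform_within_open[OF _ assms(1,2)] assms(3) by metis
  then show ?thesis
    unfolding frechet_derivative_def by presburger
qed

lemma DD_scaleR: "F differentiable (at x) \<Longrightarrow> DD (r *\<^sub>R b) F x = r *\<^sub>R DD b F x"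
  using linear_frechet_derivative linear_scale by blast

lemma DD_plus: "F differentiable (at x) \<Longrightarrow> DD (b + b') F x = DD b F x + DD b' F x"
  using linear_frechet_derivative linear_add by blast

lemma DD_zero: "F differentiable (at x) \<Longrightarrow> DD 0 F x = 0"
  using linear_frechet_derivative linear_0 by blast

lemma DD_add:
  "F differentiable (at x) \<Longrightarrow> G differentiable (at x) \<Longrightarrow> DD b (\<lambda>y. F y + G y) x = DD b F x + DD b G x"
  using DD_eqI[OF has_derivative_add[OF DD_works DD_works]] by blast

lemma DD_bounded_linear:
  "bounded_linear L \<Longrightarrow> F differentiable (at x) \<Longrightarrow> DD b (\<lambda>y. L (F y)) x = L (DD b F x)"
  using DD_eqI[OF bounded_linear.has_derivative[OF _ DD_works]] by blast

lemma (in bounded_bilinear) DD_bilinear: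
  "F differentiable (at x) \<Longrightarrow> G differentiable (at x) \<Longrightarrow>
    DD b (\<lambda>y. prod (F y) (G y)) x = prod (F x) (DD b G x) + prod (DD b F x) (G x)"
  using DD_eqI[OF FDERIV[OF DD_works DD_works]] by blast

lemma DD_compose:
  assumes "F differentiable (at x)" "G differentiable (at (F x))"
  shows "DD b (\<lambda>y. G (F y)) x = DD (DD b F x) G (F x)"
  by (rule DD_eqI) (rule has_derivative_compose[OF DD_works[OF assms(1)] DD_works[OF assms(2)]])

lemma DD_basis_sum:
  fixes F :: "'a::euclidean_space \<Rightarrow> 'b::real_normed_vector"
  assumes "F differentiable (at x)"
  shows "DD b F x = (\<Sum>i\<in>Basis. (b \<bullet> i) *\<^sub>R DD i F x)"
proof -
  have l: "linear (\<lambda>b. DD b F x)"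
    using linear_frechet_derivative[OF assms] .
  have "DD b F x = DD (\<Sum>i\<in>Basis. (b \<bullet> i) *\<^sub>R i) F x"
    by (simp add: euclidean_representation)
  also have "\<dots> = (\<Sum>i\<in>Basis. (b \<bullet> i) *\<^sub>R DD i F x)"
    using l by (simp add: linear_sum linear_scale)
  finally show ?thesis .
qed

section \<open>Closure properties of C^k and smooth maps\<close>

lemma Ck_on_subset: "Ck_on k S F \<Longrightarrow> T \<subseteq> S \<Longrightarrow> Ck_on k T F"
  by (induction k arbitrary: F) (auto intro: continuous_on_subset)

lemma Ck_on_differentiable: "Ck_on (Suc k) S F \<Longrightarrow> x \<in> S \<Longrightarrow> F differentiable (at x)"
  by simp

lemma Ck_on_SucD: "Ck_on (Suc k) S F \<Longrightarrow> Ck_on k S F"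
proof (induction k arbitrary: F)
  case 0
  then show ?case
    by (auto intro!: continuous_at_imp_continuous_on differentiable_imp_continuous_within)
qed auto

lemma Ck_on_cong:
  assumes "open S" "\<And>y. y \<in> S \<Longrightarrow> F y = G y" "Ck_on k S F"
  shows "Ck_on k S G"
  using assms(2,3)
proof (induction k arbitrary: F G)
  case 0
  then show ?case by (auto cong: continuous_on_cong)
next
  case (Suc k)
  have "G differentiable (at x)" if "x \<in> S" for x
  proof -
    have "(F has_derivative (\<lambda>b. DD b F x)) (at x)"
      using Suc.prems that by (auto intro: DD_works)
    then have "(G has_derivative (\<lambda>b. DD b F x)) (at x)"
      using has_derivative_transform_within_open[OF _ assms(1) that] Suc.prems(1) by blast
    then show ?thesis by (rule differentiableI)
  qed
  moreover have "Ck_on k S (DD b G)" if "b \<in> Basis" for b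
    using Suc.IH[of "DD b F" "DD b G"] DD_cong[OF assms(1), of _ F G] Suc.prems that by auto
  ultimately show ?case by simp
qed

text \<open>\<open>Ck_on\<close> asks for derivatives on full neighbourhoods, so it can be checked
  near each point. This glues local formulas obtained in different charts.\<close>

lemma Ck_on_local:
  assumes "\<And>x. x \<in> S \<Longrightarrow> \<exists>T. open T \<and> x \<in> T \<and> Ck_on k T F"
  shows "Ck_on k S F"
  using assms
proof (induction k arbitrary: F)
  case 0
  show ?case unfolding Ck_on.simps
  proof (intro continuous_at_imp_continuous_on ballI)
    fix x assume "x \<in> S"
    then obtain T where "open T" "x \<in> T" "continuous_on T F" using 0 by auto
    then show "isCont F x" by (simp add: continuous_on_eq_continuous_at)
  qed
next
  case (Suc k)
  have "F differentiable (at x)" if "x \<in> S" for x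
    using Suc.prems[OF that] by auto
  moreover have "Ck_on k S (DD b F)" if "b \<in> Basis" for b
  proof (rule Suc.IH)
    fix x assume "x \<in> S"
    then obtain T where "open T" "x \<in> T" "Ck_on (Suc k) T F" using Suc.prems by blast
    then show "\<exists>T. open T \<and> x \<in> T \<and> Ck_on k T (DD b F)" using that by auto
  qed
  ultimately show ?case by simp
qed

lemma Ck_on_const: "Ck_on k S (\<lambda>x. a)"
  by (induction k arbitrary: a) auto

lemma Ck_on_bounded_linear:
  assumes "bounded_linear L" "open S" "Ck_on k S F"
  shows "Ck_on k S (\<lambda>x. L (F x))"
  using assms(3)
proof (induction k arbitrary: F)
  case 0
  then show ?case by (simp add: bounded_linear.continuous_on[OF assms(1)])
next
  case (Suc k)
  have "Ck_on k S (DD b (\<lambda>x. L (F x)))" if "b \<in> Basis" for b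
    by (rule Ck_on_cong[OF assms(2) _ Suc.IH[of "DD b F"]])
      (use Suc.prems that in \<open>auto simp: DD_bounded_linear[OF assms(1)]\<close>)
  moreover have "(\<lambda>x. L (F x)) differentiable (at x)" if "x \<in> S" for x
    using bounded_linear.has_derivative[OF assms(1) DD_works[of F x]] Suc.prems that
    by (auto intro: differentiableI)
  ultimately show ?case by simp
qed

lemma Ck_on_id: "Ck_on k S (\<lambda>x. x)"
proof (cases k)
  case (Suc n)
  have "Ck_on n S (DD b (\<lambda>x. x))" for b :: 'a
    unfolding frechet_derivative_ident by (rule Ck_on_const)
  then show ?thesis unfolding Suc Ck_on.simps by (simp only: differentiable_ident) blast
qed (simp add: continuous_on_id)

lemma Ck_on_add:
  assumes "open S" "Ck_on k S F" "Ck_on k S G"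
  shows "Ck_on k S (\<lambda>x. F x + G x)"
  using assms(2,3)
proof (induction k arbitrary: F G)
  case 0
  then show ?case by (auto intro: continuous_on_add)
next
  case (Suc k)
  have "Ck_on k S (DD b (\<lambda>x. F x + G x))" if "b \<in> Basis" for b
    by (rule Ck_on_cong[OF assms(1) _ Suc.IH[of "DD b F" "DD b G"]])
      (use Suc.prems that in \<open>auto simp: DD_add\<close>)
  then show ?case using Suc.prems by auto
qed

text \<open>The Leibniz rule leaves one factor of each summand undifferentiated, whence the lowering
  of its order by \<open>Ck_on_SucD\<close>. Scalar, inner and matrix-vector products are all
  instances.\<close>

lemma (in bounded_bilinear) Ck_on_bilinear:
  assumes "open S" "Ck_on k S F" "Ck_on k S G"
  shows "Ck_on k S (\<lambda>x. prod (F x) (G x))"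
  using assms(2,3)
proof (induction k arbitrary: F G)
  case 0
  then show ?case by (auto intro: continuous_on)
next
  case (Suc k)
  have "Ck_on k S (DD b (\<lambda>x. prod (F x) (G x)))" if "b \<in> Basis" for b
    by (rule Ck_on_cong[OF assms(1) _ Ck_on_add[OF assms(1) Suc.IH[of F "DD b G"] Suc.IH[of "DD b F" G]]])
      (use Suc.prems Ck_on_SucD[OF Suc.prems(1)] Ck_on_SucD[OF Suc.prems(2)] that in \<open>auto simp: DD_bilinear\<close>)
  moreover have "(\<lambda>x. prod (F x) (G x)) differentiable (at x)" if "x \<in> S" for x
    using FDERIV[OF DD_works[of F x] DD_works[of G x]] Suc.prems that by (auto intro: differentiableI)
  ultimately show ?case by simp
qed

lemma Ck_on_sum:
  assumes "open S" "\<And>i. i \<in> I \<Longrightarrow> Ck_on k S (F i)"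
  shows "Ck_on k S (\<lambda>x. \<Sum>i\<in>I. F i x)"
  using assms(2) by (induction I rule: infinite_finite_induct) (auto intro: Ck_on_const Ck_on_add[OF assms(1)])

text \<open>Only \<open>G\<close> varies in the induction: by the chain rule a derivative of the
  composite is a sum of components of \<open>DD b F\<close> times functions \<open>DD i G\<close>
  composed with the same \<open>F\<close>.\<close>

lemma Ck_on_compose:
  fixes F :: "'a::euclidean_space \<Rightarrow> 'b::euclidean_space" and G :: "'b \<Rightarrow> 'c::real_normed_vector"
  assumes "open S" "Ck_on k S F" "Ck_on k T G" "\<And>x. x \<in> S \<Longrightarrow> F x \<in> T"
  shows "Ck_on k S (\<lambda>x. G (F x))"
  using assms(2,3)
proof (induction k arbitrary: G)
  case 0
  then show ?case using assms(4) by (auto intro: continuous_on_compose2)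
next
  case (Suc k)
  have "Ck_on k S (DD b (\<lambda>x. G (F x)))" if b: "b \<in> Basis" for b
  proof (rule Ck_on_cong[OF assms(1)])
    show "(\<Sum>i\<in>Basis. (DD b F x \<bullet> i) *\<^sub>R DD i G (F x)) = DD b (\<lambda>x. G (F x)) x" if "x \<in> S" for x
      using Suc.prems that assms(4) by (simp add: DD_compose DD_basis_sum[of G])
    show "Ck_on k S (\<lambda>x. \<Sum>i\<in>Basis. (DD b F x \<bullet> i) *\<^sub>R DD i G (F x))"
    proof (intro Ck_on_sum[OF assms(1)] bounded_bilinear.Ck_on_bilinear[OF bounded_bilinear_scaleR assms(1)]
          Ck_on_bounded_linear[OF bounded_linear_inner_left assms(1)])
      show "Ck_on k S (DD b F)" using Suc.prems b by simp
      show "Ck_on k S (\<lambda>x. DD i G (F x))" if "i \<in> Basis" for i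
        by (rule Suc.IH[OF Ck_on_SucD[OF Suc.prems(1)]]) (use Suc.prems that in simp)
    qed
  qed
  moreover have "(\<lambda>x. G (F x)) differentiable (at x)" if "x \<in> S" for x
    using has_derivative_compose[OF DD_works[of F x] DD_works[of G "F x"]] Suc.prems that assms(4)
    by (auto intro: differentiableI)
  ultimately show ?case by simp
qed

text \<open>Up to sign the derivative is the product of the function with itself, so the induction
  closes.\<close>

lemma Ck_on_inverse: "Ck_on k {x. x \<noteq> 0} (inverse :: real \<Rightarrow> real)"
proof (induction k)
  case 0
  then show ?case by (auto intro!: continuous_intros)
next
  case (Suc k)
  have o: "open {x::real. x \<noteq> 0}" by (simp add: open_Collect_neq)
  have D: "(inverse has_derivative (\<lambda>h. - (inverse x * h * inverse x))) (at x)" if "x \<noteq> 0" for x :: real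
    using has_derivative_inverse'[OF that] by simp
  have "Ck_on k {x. x \<noteq> 0} (DD b (inverse :: real \<Rightarrow> real))" if "b \<in> Basis" for b
  proof (rule Ck_on_cong[OF o])
    show "(- 1) *\<^sub>R (inverse x * inverse x) = DD b inverse x" if "x \<in> {x. x \<noteq> 0}" for x :: real
      using that \<open>b \<in> Basis\<close> DD_eqI[OF D] by simp
    show "Ck_on k {x. x \<noteq> 0} (\<lambda>x::real. (- 1) *\<^sub>R (inverse x * inverse x))"
      by (intro Ck_on_bounded_linear[OF bounded_linear_scaleR_right] o
          bounded_bilinear.Ck_on_bilinear[OF bounded_bilinear_mult] Suc)
  qed
  then show ?case using D by (auto simp: differentiable_def)
qed

lemma smooth_on_subset: "smooth_on S F \<Longrightarrow> T \<subseteq> S \<Longrightarrow> smooth_on T F"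
  unfolding smooth_on_def using Ck_on_subset by blast

lemma smooth_on_cong: "open S \<Longrightarrow> (\<And>y. y \<in> S \<Longrightarrow> F y = G y) \<Longrightarrow> smooth_on S F \<Longrightarrow> smooth_on S G"
  unfolding smooth_on_def using Ck_on_cong by blast

lemma smooth_on_local:
  "(\<And>x. x \<in> S \<Longrightarrow> \<exists>T. open T \<and> x \<in> T \<and> smooth_on T F) \<Longrightarrow> smooth_on S F"
  unfolding smooth_on_def by (meson Ck_on_local)

lemma smooth_on_differentiable: "smooth_on S F \<Longrightarrow> x \<in> S \<Longrightarrow> F differentiable (at x)"
  unfolding smooth_on_def using Ck_on_differentiable by blast

lemma smooth_on_continuous: "smooth_on S F \<Longrightarrow> continuous_on S F"
  unfolding smooth_on_def using Ck_on.simps(1) by blast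

lemma smooth_on_const: "smooth_on S (\<lambda>x. a)"
  unfolding smooth_on_def by (simp add: Ck_on_const)

lemma smooth_on_id: "smooth_on S (\<lambda>x. x)"
  unfolding smooth_on_def by (simp add: Ck_on_id)

lemma smooth_on_bounded_linear:
  "bounded_linear L \<Longrightarrow> open S \<Longrightarrow> smooth_on S F \<Longrightarrow> smooth_on S (\<lambda>x. L (F x))"
  unfolding smooth_on_def by (simp add: Ck_on_bounded_linear)

lemma smooth_on_add: "open S \<Longrightarrow> smooth_on S F \<Longrightarrow> smooth_on S G \<Longrightarrow> smooth_on S (\<lambda>x. F x + G x)"
  unfolding smooth_on_def by (simp add: Ck_on_add)

lemma smooth_on_sum:
  "open S \<Longrightarrow> (\<And>i. i \<in> I \<Longrightarrow> smooth_on S (F i)) \<Longrightarrow> smooth_on S (\<lambda>x. \<Sum>i\<in>I. F i x)"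
  unfolding smooth_on_def by (simp add: Ck_on_sum)

lemma smooth_on_scaleR:
  "open S \<Longrightarrow> smooth_on S F \<Longrightarrow> smooth_on S G \<Longrightarrow> smooth_on S (\<lambda>x. F x *\<^sub>R G x)"
  unfolding smooth_on_def by (simp add: bounded_bilinear.Ck_on_bilinear[OF bounded_bilinear_scaleR])

lemma smooth_on_mult:
  fixes F G :: "'a::euclidean_space \<Rightarrow> real"
  shows "open S \<Longrightarrow> smooth_on S F \<Longrightarrow> smooth_on S G \<Longrightarrow> smooth_on S (\<lambda>x. F x * G x)"
  unfolding smooth_on_def by (simp add: bounded_bilinear.Ck_on_bilinear[OF bounded_bilinear_mult])

lemma smooth_on_compose:
  fixes F :: "'a::euclidean_space \<Rightarrow> 'b::euclidean_space" and G :: "'b \<Rightarrow> 'c::real_normed_vector"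
  shows "open S \<Longrightarrow> smooth_on S F \<Longrightarrow> smooth_on T G \<Longrightarrow> (\<And>x. x \<in> S \<Longrightarrow> F x \<in> T) \<Longrightarrow>
    smooth_on S (\<lambda>x. G (F x))"
  unfolding smooth_on_def using Ck_on_compose[of S _ F T G] by blast

lemma smooth_on_uminus: "open S \<Longrightarrow> smooth_on S F \<Longrightarrow> smooth_on S (\<lambda>x. - F x)"
  by (rule smooth_on_bounded_linear[OF bounded_linear_minus[OF bounded_linear_ident]])

lemma smooth_on_diff: "open S \<Longrightarrow> smooth_on S F \<Longrightarrow> smooth_on S G \<Longrightarrow> smooth_on S (\<lambda>x. F x - G x)"
  using smooth_on_add[OF _ _ smooth_on_uminus] by fastforce

lemma smooth_on_power:
  fixes F :: "'a::euclidean_space \<Rightarrow> real"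
  shows "open S \<Longrightarrow> smooth_on S F \<Longrightarrow> smooth_on S (\<lambda>x. F x ^ n)"
  by (induction n) (auto intro: smooth_on_const smooth_on_mult)

lemma smooth_on_prod:
  fixes F :: "'i \<Rightarrow> 'a::euclidean_space \<Rightarrow> real"
  shows "open S \<Longrightarrow> (\<And>i. i \<in> I \<Longrightarrow> smooth_on S (F i)) \<Longrightarrow> smooth_on S (\<lambda>x. \<Prod>i\<in>I. F i x)"
  by (induction I rule: infinite_finite_induct) (auto intro: smooth_on_const smooth_on_mult)

lemma smooth_on_divide:
  fixes F G :: "'a::euclidean_space \<Rightarrow> real"
  assumes "open S" "smooth_on S F" "smooth_on S G" "\<And>x. x \<in> S \<Longrightarrow> G x \<noteq> 0"
  shows "smooth_on S (\<lambda>x. F x / G x)"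
proof -
  have i: "smooth_on {x. x \<noteq> 0} (inverse :: real \<Rightarrow> real)"
    unfolding smooth_on_def by (simp add: Ck_on_inverse)
  have "smooth_on S (\<lambda>x. inverse (G x))"
    by (rule smooth_on_compose[OF assms(1,3) i]) (simp add: assms(4))
  then show ?thesis
    unfolding divide_inverse by (intro smooth_on_mult assms)
qed

lemma smooth_on_DD:
  assumes "open S" "smooth_on S F"
  shows "smooth_on S (DD b F)"
proof (rule smooth_on_cong[OF assms(1)])
  show "(\<Sum>i\<in>Basis. (b \<bullet> i) *\<^sub>R DD i F x) = DD b F x" if "x \<in> S" for x
    by (rule DD_basis_sum[OF smooth_on_differentiable[OF assms(2) that], symmetric])
  have "smooth_on S (DD i F)" if "i \<in> Basis" for i
    using assms(2) that unfolding smooth_on_def by (metis Ck_on.simps(2))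
  then show "smooth_on S (\<lambda>x. \<Sum>i\<in>Basis. (b \<bullet> i) *\<^sub>R DD i F x)"
    by (intro smooth_on_sum smooth_on_scaleR smooth_on_const assms(1)) auto
qed

lemma smooth_on_vec_nth: "open S \<Longrightarrow> smooth_on S F \<Longrightarrow> smooth_on S (\<lambda>x. F x $ i)"
  by (rule smooth_on_bounded_linear[OF bounded_linear_vec_nth])

lemma smooth_on_vec:
  fixes F :: "'a::euclidean_space \<Rightarrow> real^'n"
  assumes "open S" "\<And>i. smooth_on S (\<lambda>x. F x $ i)"
  shows "smooth_on S F"
proof -
  have "(\<lambda>x. \<Sum>i\<in>UNIV. F x $ i *\<^sub>R axis i 1) = F"
    using basis_expansion[of "F _"] by (auto simp: scalar_mult_eq_scaleR)
  moreover have "smooth_on S (\<lambda>x. \<Sum>i\<in>UNIV. F x $ i *\<^sub>R (axis i 1 :: real^'n))"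
    by (intro smooth_on_sum smooth_on_scaleR smooth_on_const assms)
  ultimately show ?thesis by simp
qed

lemma smooth_on_inner:
  "open S \<Longrightarrow> smooth_on S F \<Longrightarrow> smooth_on S G \<Longrightarrow> smooth_on S (\<lambda>x. F x \<bullet> G x)"
  unfolding smooth_on_def by (simp add: bounded_bilinear.Ck_on_bilinear[OF bounded_bilinear_inner])

lemma bounded_bilinear_matrix_vector_mult:
  "bounded_bilinear (\<lambda>(M::real^'n^'m) (v::real^'n). M *v v)"
  by (simp add: bilinear_conv_bounded_bilinear[symmetric] bilinear_def linear_iff
      matrix_vector_right_distrib matrix_vector_mult_add_rdistrib vec.scale_left_distrib
      scaleR_matrix_vector_assoc matrix_vector_mult_scaleR)

lemma smooth_on_matrix_vector_mult:
  fixes M :: "'a::euclidean_space \<Rightarrow> real^'n^'m" and v :: "'a \<Rightarrow> real^'n"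
  shows "open S \<Longrightarrow> smooth_on S M \<Longrightarrow> smooth_on S v \<Longrightarrow> smooth_on S (\<lambda>x. M x *v v x)"
  unfolding smooth_on_def by (simp add: bounded_bilinear.Ck_on_bilinear[OF bounded_bilinear_matrix_vector_mult])

lemma smooth_on_row:
  fixes M :: "'a::euclidean_space \<Rightarrow> real^'n^'m"
  assumes "open S" "\<And>i j. smooth_on S (\<lambda>x. M x $ i $ j)"
  shows "smooth_on S M"
proof -
  have "(\<lambda>x. \<Sum>i\<in>UNIV. \<Sum>j\<in>UNIV. M x $ i $ j *\<^sub>R axis i (axis j 1)) = M"
  proof
    fix x
    show "(\<Sum>i\<in>UNIV. \<Sum>j\<in>UNIV. M x $ i $ j *\<^sub>R axis i (axis j 1)) = M x"
    proof (intro vec_eq_iff[THEN iffD2] allI)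
      fix a b
      have "(\<Sum>i\<in>UNIV. \<Sum>j\<in>UNIV. M x $ i $ j *\<^sub>R axis i (axis j 1)) $ a $ b =
          (\<Sum>i\<in>UNIV. \<Sum>j\<in>UNIV. if i = a then if j = b then M x $ i $ j else 0 else 0)"
        by (auto simp: axis_def intro!: sum.cong)
      also have "\<dots> = (\<Sum>i\<in>UNIV. if i = a then M x $ i $ b else 0)"
        by (intro sum.cong refl) (auto simp: sum.delta)
      finally show "(\<Sum>i\<in>UNIV. \<Sum>j\<in>UNIV. M x $ i $ j *\<^sub>R axis i (axis j 1)) $ a $ b = M x $ a $ b"
        by (simp add: sum.delta)
    qed
  qed
  moreover have "smooth_on S (\<lambda>x. \<Sum>i\<in>UNIV. \<Sum>j\<in>UNIV. M x $ i $ j *\<^sub>R (axis i (axis j 1) :: real^'n^'m))"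
    by (intro smooth_on_sum smooth_on_scaleR smooth_on_const assms)
  ultimately show ?thesis by simp
qed

lemma smooth_on_det:
  fixes M :: "'a::euclidean_space \<Rightarrow> real^'n^'n"
  assumes "open S" "\<And>i j. smooth_on S (\<lambda>x. M x $ i $ j)"
  shows "smooth_on S (\<lambda>x. det (M x))"
  unfolding det_def by (intro smooth_on_sum smooth_on_mult smooth_on_const smooth_on_prod assms)

lemma matrix_mul_matrix_inv:
  fixes M :: "real^'n^'n"
  assumes "det M \<noteq> 0"
  shows "M ** matrix_inv M = mat 1" "matrix_inv M ** M = mat 1"
proof -
  have "\<exists>A'. M ** A' = mat 1 \<and> A' ** M = mat 1"
    using assms invertible_det_nz unfolding invertible_def by blast
  then have "M ** matrix_inv M = mat 1 \<and> matrix_inv M ** M = mat 1"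
    unfolding matrix_inv_def by (rule someI_ex)
  then show "M ** matrix_inv M = mat 1" "matrix_inv M ** M = mat 1" by auto
qed

text \<open>\<open>matrix_inv\<close> is defined by choice; Cramer's rule turns its entries into
  quotients of polynomials in the entries of \<open>M\<close>, from which smoothness can be read
  off.\<close>

lemma matrix_inv_cramer:
  fixes M :: "real^'n^'n"
  assumes "det M \<noteq> 0"
  shows "matrix_inv M $ k $ l = det (\<chi> i j. if j = k then axis l 1 $ i else M $ i $ j) / det M"
proof -
  have "M *v (matrix_inv M *v axis l 1) = axis l 1"
    using assms by (simp add: matrix_vector_mul_assoc matrix_mul_matrix_inv)
  then have "matrix_inv M *v axis l 1 = (\<chi> k. det (\<chi> i j. if j = k then axis l 1 $ i else M $ i $ j) / det M)"
    using cramer[OF assms] by blast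
  then show ?thesis
    by (simp add: matrix_vector_mult_basis column_def vec_eq_iff)
qed

lemma smooth_on_matrix_inv:
  fixes M :: "'a::euclidean_space \<Rightarrow> real^'n^'n"
  assumes "open S" "smooth_on S M" "\<And>x. x \<in> S \<Longrightarrow> det (M x) \<noteq> 0"
  shows "smooth_on S (\<lambda>x. matrix_inv (M x) $ k $ l)"
proof (rule smooth_on_cong[OF assms(1)])
  show "det (\<chi> i j. if j = k then axis l 1 $ i else M x $ i $ j) / det (M x) = matrix_inv (M x) $ k $ l"
    if "x \<in> S" for x
    using matrix_inv_cramer[OF assms(3)[OF that]] by simp
  have c: "smooth_on S (\<lambda>x. M x $ i $ j)" for i j
    by (intro smooth_on_vec_nth assms)
  have "smooth_on S (\<lambda>x. (\<chi> i j. if j = k then axis l 1 $ i else M x $ i $ j) $ i $ j)" for i j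
    by (cases "j = k") (auto intro: c smooth_on_const)
  then show "smooth_on S (\<lambda>x. det (\<chi> i j. if j = k then axis l 1 $ i else M x $ i $ j) / det (M x))"
    by (intro smooth_on_divide smooth_on_det assms c)
qed

section \<open>Symmetry of second derivatives\<close>

text \<open>The second difference is symmetric in \<open>a\<close> and \<open>b\<close>, the
  iterated derivative is not visibly so. Comparing both orders for small \<open>h\<close> yields the
  symmetry of mixed derivatives.\<close>

lemma second_difference_mvt:
  fixes F :: "'a::euclidean_space \<Rightarrow> real"
  assumes "open S" "smooth_on S F" "cball x r \<subseteq> S" "0 < h" "h * (norm a + norm b) \<le> r"
  shows "\<exists>y\<in>cball x (h * (norm a + norm b)).
    F (x + h *\<^sub>R a + h *\<^sub>R b) - F (x + h *\<^sub>R a) - F (x + h *\<^sub>R b) + F x = h * h * DD b (DD a F) y"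
proof -
  have inS: "x + s *\<^sub>R a + t *\<^sub>R b \<in> S \<and> x + s *\<^sub>R a + t *\<^sub>R b \<in> cball x (h * (norm a + norm b))"
    if "0 \<le> s" "s \<le> h" "0 \<le> t" "t \<le> h" for s t
  proof -
    have "norm (s *\<^sub>R a + t *\<^sub>R b) \<le> s * norm a + t * norm b"
      using norm_triangle_ineq[of "s *\<^sub>R a" "t *\<^sub>R b"] that by simp
    also have "\<dots> \<le> h * (norm a + norm b)"
      using that by (simp add: distrib_left add_mono mult_right_mono)
    finally have "dist x (x + s *\<^sub>R a + t *\<^sub>R b) \<le> h * (norm a + norm b)"
      by (simp add: dist_norm add.assoc norm_minus_commute add.commute[of "t *\<^sub>R b"])
    then show ?thesis using assms by (auto simp: mem_cball)
  qed
  have d1: "((\<lambda>s. F (x + s *\<^sub>R a + t *\<^sub>R b)) has_real_derivative DD a F (x + s *\<^sub>R a + t *\<^sub>R b)) (at s)"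
    if "0 \<le> s" "s \<le> h" "0 \<le> t" "t \<le> h" for s t
  proof -
    have F: "F differentiable (at (x + s *\<^sub>R a + t *\<^sub>R b))"
      using smooth_on_differentiable[OF assms(2)] inS[OF that] by blast
    have "((\<lambda>s. F (x + s *\<^sub>R a + t *\<^sub>R b)) has_derivative (\<lambda>h. DD (h *\<^sub>R a) F (x + s *\<^sub>R a + t *\<^sub>R b))) (at s)"
      by (rule has_derivative_compose[where f = "\<lambda>s. x + s *\<^sub>R a + t *\<^sub>R b", OF _ DD_works[OF F]])
        (auto intro!: derivative_eq_intros)
    then show ?thesis
      by (simp add: DD_scaleR[OF F] has_field_derivative_def mult_commute_abs)
  qed
  have sDa: "smooth_on S (DD a F)" by (rule smooth_on_DD[OF assms(1,2)])
  have d2: "((\<lambda>t. DD a F (x + s *\<^sub>R a + t *\<^sub>R b)) has_real_derivative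
      DD b (DD a F) (x + s *\<^sub>R a + t *\<^sub>R b)) (at t)"
    if "0 \<le> s" "s \<le> h" "0 \<le> t" "t \<le> h" for s t
  proof -
    have F: "(DD a F) differentiable (at (x + s *\<^sub>R a + t *\<^sub>R b))"
      using smooth_on_differentiable[OF sDa] inS[OF that] by blast
    have "((\<lambda>t. DD a F (x + s *\<^sub>R a + t *\<^sub>R b)) has_derivative (\<lambda>h. DD (h *\<^sub>R b) (DD a F) (x + s *\<^sub>R a + t *\<^sub>R b))) (at t)"
      by (rule has_derivative_compose[where f = "\<lambda>t. x + s *\<^sub>R a + t *\<^sub>R b", OF _ DD_works[OF F]])
        (auto intro!: derivative_eq_intros)
    then show ?thesis
      by (simp add: DD_scaleR[OF F] has_field_derivative_def mult_commute_abs)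
  qed
  \<comment> \<open>The increment along \<open>b\<close> as a function of the step along
    \<open>a\<close>. Its total change is the second difference, so the mean value theorem applies
    first in direction \<open>a\<close> and then in direction \<open>b\<close>.\<close>
  let ?f = "\<lambda>s. F (x + s *\<^sub>R a + h *\<^sub>R b) - F (x + s *\<^sub>R a + 0 *\<^sub>R b)"
  have "\<exists>\<xi>. 0 < \<xi> \<and> \<xi> < h \<and> ?f h - ?f 0 = (h - 0) *
      (DD a F (x + \<xi> *\<^sub>R a + h *\<^sub>R b) - DD a F (x + \<xi> *\<^sub>R a + 0 *\<^sub>R b))"
    by (rule MVT2[OF assms(4)]) (intro DERIV_diff d1; use assms in simp)
  then obtain \<xi> where \<xi>: "0 < \<xi>" "\<xi> < h" "?f h - ?f 0 =
      h * (DD a F (x + \<xi> *\<^sub>R a + h *\<^sub>R b) - DD a F (x + \<xi> *\<^sub>R a + 0 *\<^sub>R b))" by auto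
  have "\<exists>\<eta>. 0 < \<eta> \<and> \<eta> < h \<and> DD a F (x + \<xi> *\<^sub>R a + h *\<^sub>R b) - DD a F (x + \<xi> *\<^sub>R a + 0 *\<^sub>R b) =
      (h - 0) * DD b (DD a F) (x + \<xi> *\<^sub>R a + \<eta> *\<^sub>R b)"
    by (rule MVT2[OF assms(4)]) (intro d2; use \<xi> in simp)
  then obtain \<eta> where \<eta>: "0 < \<eta>" "\<eta> < h"
    "DD a F (x + \<xi> *\<^sub>R a + h *\<^sub>R b) - DD a F (x + \<xi> *\<^sub>R a + 0 *\<^sub>R b) =
      h * DD b (DD a F) (x + \<xi> *\<^sub>R a + \<eta> *\<^sub>R b)" by auto
  have "x + \<xi> *\<^sub>R a + \<eta> *\<^sub>R b \<in> cball x (h * (norm a + norm b))"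
    using inS[of \<xi> \<eta>] \<xi> \<eta> by simp
  moreover have "F (x + h *\<^sub>R a + h *\<^sub>R b) - F (x + h *\<^sub>R a) - F (x + h *\<^sub>R b) + F x
      = h * h * DD b (DD a F) (x + \<xi> *\<^sub>R a + \<eta> *\<^sub>R b)"
    using \<xi>(3) unfolding \<eta>(3) by simp
  ultimately show ?thesis by blast
qed

lemma DD_commute_real:
  fixes F :: "'a::euclidean_space \<Rightarrow> real"
  assumes "open S" "smooth_on S F" "x \<in> S"
  shows "DD b (DD a F) x = DD a (DD b F) x"
proof -
  define P where "P = DD b (DD a F)"
  define Q where "Q = DD a (DD b F)"
  have cont: "isCont P x" "isCont Q x"
    using assms smooth_on_continuous[OF smooth_on_DD[OF _ smooth_on_DD]] unfolding P_def Q_def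
    by (metis continuous_on_eq_continuous_at)+
  obtain r where r: "r > 0" "cball x r \<subseteq> S" using assms(1,3) open_contains_cball by blast
  have "\<bar>P x - Q x\<bar> \<le> e" if "e > 0" for e
  proof -
    obtain d1 where d1: "d1 > 0" "\<And>y. dist y x < d1 \<Longrightarrow> dist (P y) (P x) < e / 2"
      using cont(1) \<open>e > 0\<close> unfolding continuous_at_eps_delta by (metis half_gt_zero)
    obtain d2 where d2: "d2 > 0" "\<And>y. dist y x < d2 \<Longrightarrow> dist (Q y) (Q x) < e / 2"
      using cont(2) \<open>e > 0\<close> unfolding continuous_at_eps_delta by (metis half_gt_zero)
    \<comment> \<open>The summand 1 keeps \<open>m\<close> positive if both directions vanish. The
      resulting \<open>h\<close> puts both mean value points inside \<open>S\<close> and within both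
      continuity radii.\<close>
    define m where "m = norm a + norm b + 1"
    have m: "m > 0" "norm a + norm b < m" by (auto simp: m_def add_nonneg_pos)
    define h where "h = min r (min d1 d2) / m"
    have h: "h > 0" using r d1 d2 m by (simp add: h_def)
    have "h * (norm a + norm b) < h * m" using h m by simp
    also have "h * m = min r (min d1 d2)" using m by (simp add: h_def)
    finally have hm: "h * (norm a + norm b) < min r (min d1 d2)" .
    obtain y where y: "y \<in> cball x (h * (norm a + norm b))"
      "F (x + h *\<^sub>R a + h *\<^sub>R b) - F (x + h *\<^sub>R a) - F (x + h *\<^sub>R b) + F x = h * h * P y"
      using second_difference_mvt[OF assms(1,2) r(2) h, of a b] hm unfolding P_def by auto
    obtain z where z: "z \<in> cball x (h * (norm b + norm a))"
      "F (x + h *\<^sub>R b + h *\<^sub>R a) - F (x + h *\<^sub>R b) - F (x + h *\<^sub>R a) + F x = h * h * Q z"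
      using second_difference_mvt[OF assms(1,2) r(2) h, of b a] hm unfolding Q_def by (auto simp: add.commute)
    have "h * h * P y = h * h * Q z" using y(2) z(2) by (simp add: algebra_simps)
    then have "P y = Q z" using h by simp
    moreover have "dist y x < d1" "dist z x < d2"
      using y(1) z(1) hm by (auto simp: dist_commute add.commute)
    ultimately show ?thesis using d1(2)[of y] d2(2)[of z] unfolding dist_real_def by linarith
  qed
  then have "\<bar>P x - Q x\<bar> \<le> 0" by (rule field_le_epsilon) simp
  then show ?thesis unfolding P_def Q_def by simp
qed

lemma DD_commute:
  fixes F :: "'a::euclidean_space \<Rightarrow> 'b::euclidean_space"
  assumes "open S" "smooth_on S F" "x \<in> S"
  shows "DD b (DD a F) x = DD a (DD b F) x"
proof (rule euclidean_eqI)
  fix i :: 'b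
  have c: "DD u (DD v (\<lambda>x. F x \<bullet> i)) x = DD u (DD v F) x \<bullet> i" for u v
  proof -
    have "DD u (DD v (\<lambda>x. F x \<bullet> i)) x = DD u (\<lambda>x. DD v F x \<bullet> i) x"
      by (rule DD_cong[OF assms(1,3)])
        (intro DD_bounded_linear[OF bounded_linear_inner_left] smooth_on_differentiable[OF assms(2)])
    also have "\<dots> = DD u (DD v F) x \<bullet> i"
      by (intro DD_bounded_linear[OF bounded_linear_inner_left]
          smooth_on_differentiable[OF smooth_on_DD[OF assms(1,2)]] assms(3))
    finally show ?thesis .
  qed
  show "DD b (DD a F) x \<bullet> i = DD a (DD b F) x \<bullet> i"
    unfolding c[symmetric]
    by (rule DD_commute_real[OF assms(1) _ assms(3)])
      (rule smooth_on_bounded_linear[OF bounded_linear_inner_left assms(1,2)])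
qed

section \<open>Levi-Civita calculus in a coordinate domain\<close>

definition gform :: "(real^'n \<Rightarrow> real^'n^'n) \<Rightarrow> real^'n \<Rightarrow> real^'n \<Rightarrow> real^'n \<Rightarrow> real" where
  "gform g x v w = v \<bullet> (g x *v w)"

definition christ :: "(real^'n \<Rightarrow> real^'n^'n) \<Rightarrow> real^'n::finite \<Rightarrow> real^'n \<Rightarrow> real^'n \<Rightarrow> real^'n" where
  "christ g x v w = (\<chi> k. \<Sum>i\<in>UNIV. \<Sum>j\<in>UNIV. christoffel g k i j x * v $ i * w $ j)"

text \<open>The connection induced on tangent vectors of the target along \<open>F\<close>. Fields
  along \<open>F\<close> need not come from fields on the target, which matters because
  \<open>F\<close> will fail to be an immersion.\<close>

definition covd :: "(real^'n \<Rightarrow> real^'n^'n) \<Rightarrow> ('a::euclidean_space \<Rightarrow> real^'n::finite) \<Rightarrow> 'a \<Rightarrow>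
    ('a \<Rightarrow> real^'n) \<Rightarrow> 'a \<Rightarrow> real^'n" where
  "covd g F b V y = DD b V y + christ g (F y) (DD b F y) (V y)"

text \<open>The curvature tensor evaluated on constant coordinate fields; their brackets vanish,
  hence the absence of a bracket term.\<close>

definition curv :: "(real^'n \<Rightarrow> real^'n^'n) \<Rightarrow> real^'n::finite \<Rightarrow> real^'n \<Rightarrow> real^'n \<Rightarrow> real^'n \<Rightarrow> real^'n" where
  "curv g x X Y Z = DD X (\<lambda>x. christ g x Y Z) x - DD Y (\<lambda>x. christ g x X Z) x
     + christ g x X (christ g x Y Z) - christ g x Y (christ g x X Z)"

lemma gform_add_left: "gform g x (u + v) w = gform g x u w + gform g x v w"
  and gform_add_right: "gform g x w (u + v) = gform g x w u + gform g x w v"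
  and gform_scaleR_left: "gform g x (r *\<^sub>R u) w = r * gform g x u w"
  and gform_scaleR_right: "gform g x w (r *\<^sub>R u) = r * gform g x w u"
  and gform_diff_left: "gform g x (u - v) w = gform g x u w - gform g x v w"
  and gform_diff_right: "gform g x w (u - v) = gform g x w u - gform g x w v"
  by (simp_all add: gform_def inner_add inner_diff matrix_vector_right_distrib
      matrix_vector_mult_diff_distrib matrix_vector_mult_scaleR algebra_simps)

lemmas gform_linear = gform_add_left gform_add_right gform_scaleR_left gform_scaleR_right
  gform_diff_left gform_diff_right

lemma christ_add_left: "christ g x (u + v) w = christ g x u w + christ g x v w"
  and christ_add_right: "christ g x w (u + v) = christ g x w u + christ g x w v"
  and christ_scaleR_left: "christ g x (r *\<^sub>R u) w = r *\<^sub>R christ g x u w"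
  and christ_scaleR_right: "christ g x w (r *\<^sub>R u) = r *\<^sub>R christ g x w u"
  by (simp_all add: christ_def vec_eq_iff sum.distrib sum_distrib_left algebra_simps)

lemmas christ_linear = christ_add_left christ_add_right christ_scaleR_left christ_scaleR_right

lemma christ_axis_left: "christ g x (axis i 1) w $ k = (\<Sum>j\<in>UNIV. w $ j * christoffel g k i j x)"
proof -
  have "christ g x (axis i 1) w $ k = (\<Sum>a\<in>UNIV. if a = i then \<Sum>j\<in>UNIV. w $ j * christoffel g k a j x else 0)"
    unfolding christ_def vec_lambda_beta by (rule sum.cong) (auto simp: axis_def mult.commute)
  then show ?thesis by simp
qed

lemma christ_axis: "christ g x (axis i 1) (axis j 1) $ k = christoffel g k i j x"
proof -
  have "christ g x (axis i 1) (axis j 1) $ k = (\<Sum>a\<in>UNIV. if a = j then christoffel g k i a x else 0)"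
    unfolding christ_axis_left by (rule sum.cong) (auto simp: axis_def)
  then show ?thesis by simp
qed

lemma christ_expand:
  "christ g x v w = (\<Sum>i\<in>UNIV. \<Sum>j\<in>UNIV. (v $ i * w $ j) *\<^sub>R christ g x (axis i 1) (axis j 1))"
proof (rule vec_eq_iff[THEN iffD2], rule allI)
  fix k
  show "christ g x v w $ k = (\<Sum>i\<in>UNIV. \<Sum>j\<in>UNIV. (v $ i * w $ j) *\<^sub>R christ g x (axis i 1) (axis j 1)) $ k"
    unfolding sum_component vector_scaleR_component christ_axis
    by (simp add: christ_def mult_ac)
qed

locale coord_metric =
  fixes g :: "real^'n \<Rightarrow> real^'n::finite^'n" and S :: "(real^'n) set"
  assumes open_S: "open S" and smooth_g: "smooth_on S g"
    and transpose_g: "x \<in> S \<Longrightarrow> transpose (g x) = g x"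
    and g_pos: "x \<in> S \<Longrightarrow> v \<noteq> 0 \<Longrightarrow> v \<bullet> (g x *v v) > 0"
begin

lemma gform_sym: "x \<in> S \<Longrightarrow> gform g x v w = gform g x w v"
  by (metis gform_def dot_lmul_matrix inner_commute transpose_matrix_vector transpose_g)

lemma gform_pos: "x \<in> S \<Longrightarrow> v \<noteq> 0 \<Longrightarrow> gform g x v v > 0"
  using g_pos by (simp add: gform_def)

lemma gform_eqI:
  assumes "x \<in> S" "\<And>w. gform g x u w = gform g x v w"
  shows "u = v"
proof (rule ccontr)
  assume "u \<noteq> v"
  then have "gform g x (u - v) (u - v) > 0" using gform_pos[OF assms(1)] by simp
  then show False using assms(2)[of "u - v"] by (simp add: gform_diff_left)
qed

lemma det_g: "x \<in> S \<Longrightarrow> det (g x) \<noteq> 0"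
proof
  assume x: "x \<in> S" and "det (g x) = 0"
  then obtain v where "v \<noteq> 0" "g x *v v = 0"
    using invertible_det_nz invertible_left_inverse matrix_left_invertible_ker by metis
  then show False using g_pos[OF x, of v] by simp
qed

lemma g_diff: "x \<in> S \<Longrightarrow> g differentiable (at x)"
  using smooth_on_differentiable[OF smooth_g] .

lemma partial_g: "x \<in> S \<Longrightarrow> partial i (\<lambda>y. g y $ j $ l) x = DD (axis i 1) g x $ j $ l"
  unfolding partial_def
  by (rule DD_bounded_linear[OF _ g_diff])
    (auto intro: bounded_linear_compose[OF bounded_linear_vec_nth bounded_linear_vec_nth])

lemma gderiv_expand:
  assumes "x \<in> S"
  shows "v \<bullet> (DD u g x *v w) = (\<Sum>i\<in>UNIV. \<Sum>j\<in>UNIV. \<Sum>l\<in>UNIV. u $ i * v $ j * w $ l * DD (axis i 1) g x $ j $ l)"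
proof -
  have "DD u g x = DD (\<Sum>i\<in>UNIV. u $ i *\<^sub>R axis i 1) g x"
    using basis_expansion[of u] by (simp add: scalar_mult_eq_scaleR)
  also have "\<dots> = (\<Sum>i\<in>UNIV. u $ i *\<^sub>R DD (axis i 1) g x)"
    using linear_frechet_derivative[OF g_diff[OF assms]] by (simp add: linear_sum linear_scale)
  finally have u: "DD u g x = (\<Sum>i\<in>UNIV. u $ i *\<^sub>R DD (axis i 1) g x)" .
  have "v \<bullet> (DD u g x *v w) = (\<Sum>j\<in>UNIV. \<Sum>l\<in>UNIV. \<Sum>i\<in>UNIV. u $ i * v $ j * w $ l * DD (axis i 1) g x $ j $ l)"
    unfolding u by (simp add: inner_vec_def matrix_vector_mult_def sum_distrib_left sum_distrib_right mult_ac)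
  also have "\<dots> = (\<Sum>j\<in>UNIV. \<Sum>i\<in>UNIV. \<Sum>l\<in>UNIV. u $ i * v $ j * w $ l * DD (axis i 1) g x $ j $ l)"
    by (intro sum.cong refl sum.swap)
  also have "\<dots> = (\<Sum>i\<in>UNIV. \<Sum>j\<in>UNIV. \<Sum>l\<in>UNIV. u $ i * v $ j * w $ l * DD (axis i 1) g x $ j $ l)"
    by (rule sum.swap)
  finally show ?thesis .
qed

lemma gderiv_sym:
  assumes "x \<in> S"
  shows "v \<bullet> (DD u g x *v w) = w \<bullet> (DD u g x *v v)"
proof -
  have "DD u g x = DD u (\<lambda>x. transpose (g x)) x"
    by (rule DD_cong[OF open_S assms]) (simp add: transpose_g)
  also have "\<dots> = transpose (DD u g x)"
    by (rule DD_bounded_linear[OF _ g_diff[OF assms]])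
      (simp add: linear_conv_bounded_linear[symmetric] linear_iff transpose_def vec_eq_iff)
  finally show ?thesis
    by (metis dot_lmul_matrix inner_commute transpose_matrix_vector)
qed

text \<open>The Koszul formula for constant fields: pairing with \<open>g x\<close> cancels the
  inverse matrix in the Christoffel symbols. Symmetry, metric compatibility and the behaviour under
  pullback then follow without indices.\<close>

lemma gform_christ:
  assumes "x \<in> S"
  shows "gform g x (christ g x v w) z =
    (w \<bullet> (DD v g x *v z) + v \<bullet> (DD w g x *v z) - v \<bullet> (DD z g x *v w)) / 2"
proof -
  define P where "P i j l = DD (axis i 1) g x $ j $ l" for i j l
  \<comment> \<open>Christoffel symbols of the first kind contracted with \<open>v\<close> and
    \<open>w\<close>; the inverse matrix raises the remaining index.\<close>
  define C where "C = (\<chi> l. \<Sum>i\<in>UNIV. \<Sum>j\<in>UNIV. (P i j l + P j i l - P l i j) / 2 * v $ i * w $ j)"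
  have "christ g x v w = matrix_inv (g x) *v C"
  proof (rule vec_eq_iff[THEN iffD2], rule allI)
    fix k
    have "christ g x v w $ k = (\<Sum>i\<in>UNIV. \<Sum>j\<in>UNIV. \<Sum>l\<in>UNIV.
        matrix_inv (g x) $ k $ l * ((P i j l + P j i l - P l i j) / 2 * v $ i * w $ j))"
      by (simp add: christ_def christoffel_def partial_g[OF assms] P_def sum_distrib_left sum_distrib_right mult_ac)
    also have "\<dots> = (\<Sum>i\<in>UNIV. \<Sum>l\<in>UNIV. \<Sum>j\<in>UNIV.
        matrix_inv (g x) $ k $ l * ((P i j l + P j i l - P l i j) / 2 * v $ i * w $ j))"
      by (intro sum.cong refl sum.swap)
    also have "\<dots> = (\<Sum>l\<in>UNIV. \<Sum>i\<in>UNIV. \<Sum>j\<in>UNIV.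
        matrix_inv (g x) $ k $ l * ((P i j l + P j i l - P l i j) / 2 * v $ i * w $ j))"
      by (rule sum.swap)
    also have "\<dots> = (matrix_inv (g x) *v C) $ k"
      by (simp add: C_def matrix_vector_mult_def sum_distrib_left)
    finally show "christ g x v w $ k = (matrix_inv (g x) *v C) $ k" .
  qed
  then have "gform g x (christ g x v w) z = z \<bullet> C"
    by (simp add: gform_sym[OF assms, of _ z])
      (simp add: gform_def matrix_vector_mul_assoc matrix_mul_matrix_inv[OF det_g[OF assms]])
  also have "\<dots> = (\<Sum>l\<in>UNIV. \<Sum>i\<in>UNIV. \<Sum>j\<in>UNIV. (v $ i * w $ j * z $ l * P i j l + v $ i * w $ j * z $ l * P j i l - v $ i * w $ j * z $ l * P l i j) / 2)"
    by (simp add: C_def inner_vec_def sum_distrib_left algebra_simps add_divide_distrib diff_divide_distrib)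
  also have "\<dots> = ((\<Sum>l\<in>UNIV. \<Sum>i\<in>UNIV. \<Sum>j\<in>UNIV. v $ i * w $ j * z $ l * P i j l)
      + (\<Sum>l\<in>UNIV. \<Sum>i\<in>UNIV. \<Sum>j\<in>UNIV. v $ i * w $ j * z $ l * P j i l)
      - (\<Sum>l\<in>UNIV. \<Sum>i\<in>UNIV. \<Sum>j\<in>UNIV. v $ i * w $ j * z $ l * P l i j)) / 2"
    by (simp add: sum.distrib sum_subtractf flip: sum_divide_distrib)
  also have "(\<Sum>l\<in>UNIV. \<Sum>i\<in>UNIV. \<Sum>j\<in>UNIV. v $ i * w $ j * z $ l * P i j l) = w \<bullet> (DD v g x *v z)"
  proof -
    have "(\<Sum>l\<in>UNIV. \<Sum>i\<in>UNIV. \<Sum>j\<in>UNIV. v $ i * w $ j * z $ l * P i j l)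
      = (\<Sum>i\<in>UNIV. \<Sum>l\<in>UNIV. \<Sum>j\<in>UNIV. v $ i * w $ j * z $ l * P i j l)" by (rule sum.swap)
    also have "\<dots> = (\<Sum>i\<in>UNIV. \<Sum>j\<in>UNIV. \<Sum>l\<in>UNIV. v $ i * w $ j * z $ l * P i j l)"
      by (intro sum.cong refl sum.swap)
    finally show ?thesis unfolding gderiv_expand[OF assms] P_def .
  qed
  also have "(\<Sum>l\<in>UNIV. \<Sum>i\<in>UNIV. \<Sum>j\<in>UNIV. v $ i * w $ j * z $ l * P j i l) = v \<bullet> (DD w g x *v z)"
  proof -
    have "(\<Sum>l\<in>UNIV. \<Sum>i\<in>UNIV. \<Sum>j\<in>UNIV. v $ i * w $ j * z $ l * P j i l)
      = (\<Sum>l\<in>UNIV. \<Sum>j\<in>UNIV. \<Sum>i\<in>UNIV. v $ i * w $ j * z $ l * P j i l)" by (intro sum.cong refl sum.swap)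
    also have "\<dots> = (\<Sum>j\<in>UNIV. \<Sum>l\<in>UNIV. \<Sum>i\<in>UNIV. v $ i * w $ j * z $ l * P j i l)"
      by (rule sum.swap)
    also have "\<dots> = (\<Sum>j\<in>UNIV. \<Sum>i\<in>UNIV. \<Sum>l\<in>UNIV. v $ i * w $ j * z $ l * P j i l)"
      by (intro sum.cong refl sum.swap)
    finally show ?thesis unfolding gderiv_expand[OF assms] P_def by (simp add: mult_ac)
  qed
  also have "(\<Sum>l\<in>UNIV. \<Sum>i\<in>UNIV. \<Sum>j\<in>UNIV. v $ i * w $ j * z $ l * P l i j) = v \<bullet> (DD z g x *v w)"
    unfolding gderiv_expand[OF assms] P_def by (simp add: mult_ac)
  finally show ?thesis .
qed

lemma christ_sym: "x \<in> S \<Longrightarrow> christ g x v w = christ g x w v"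
  by (rule gform_eqI) (auto simp: gform_christ gderiv_sym[of x v _ w])

text \<open>Metric compatibility of the connection: in the sum of the two Koszul expressions
  everything cancels in pairs except the derivative along \<open>u\<close>.\<close>

lemma christ_compat:
  assumes "x \<in> S"
  shows "v \<bullet> (DD u g x *v w) = gform g x (christ g x u v) w + gform g x v (christ g x u w)"
  unfolding gform_sym[OF assms, of v] gform_christ[OF assms]
  using gderiv_sym[OF assms, of v u w] gderiv_sym[OF assms, of v w u] gderiv_sym[OF assms, of u v w]
  by (simp add: field_simps)

lemma smooth_christoffel: "smooth_on S (christoffel g k i j)"
  unfolding christoffel_def partial_def
  by (intro smooth_on_mult smooth_on_sum smooth_on_const smooth_on_add smooth_on_diff open_S
      smooth_on_matrix_inv smooth_g det_g smooth_on_DD smooth_on_vec_nth)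

lemma smooth_christ: "smooth_on S (\<lambda>x. christ g x v w)"
  by (rule smooth_on_vec[OF open_S], unfold christ_def vec_lambda_beta)
    (intro smooth_on_sum smooth_on_mult smooth_on_const smooth_christoffel[THEN smooth_on_subset] open_S order.refl)

end

text \<open>The domain is an arbitrary Euclidean space and \<open>F\<close> an arbitrary smooth map,
  so that one calculus serves surfaces across their singular set, curves, coordinate changes and the
  identity.\<close>

locale map_into_metric = coord_metric g S
  for g :: "real^'n \<Rightarrow> real^'n::finite^'n" and S :: "(real^'n) set" +
  fixes F :: "'a::euclidean_space \<Rightarrow> real^'n" and U :: "'a set"
  assumes open_U: "open U" and smooth_F: "smooth_on U F" and F_in: "y \<in> U \<Longrightarrow> F y \<in> S"
begin

lemma F_diff: "y \<in> U \<Longrightarrow> F differentiable (at y)"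
  using smooth_on_differentiable[OF smooth_F] .

lemma smooth_gF: "smooth_on U (\<lambda>y. g (F y))"
  by (rule smooth_on_compose[OF open_U smooth_F smooth_g F_in])

lemma smooth_gform:
  assumes "smooth_on U V" "smooth_on U W"
  shows "smooth_on U (\<lambda>y. gform g (F y) (V y) (W y))"
  unfolding gform_def
  by (intro smooth_on_inner smooth_on_matrix_vector_mult smooth_gF assms open_U)

lemma smooth_christ_map:
  assumes "smooth_on U V" "smooth_on U W"
  shows "smooth_on U (\<lambda>y. christ g (F y) (V y) (W y))"
proof -
  have "smooth_on U (\<lambda>y. christ g (F y) v w)" for v w
    by (rule smooth_on_compose[OF open_U smooth_F smooth_christ F_in])
  then show ?thesis
    by (subst christ_expand) (intro smooth_on_sum smooth_on_scaleR smooth_on_mult smooth_on_vec_nth assms open_U)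
qed

text \<open>A Leibniz rule with three moving slots, the base point and both arguments. Expansion in
  coordinate vectors separates the dependence on the base point from that on the arguments.\<close>

lemma DD_christ_map:
  assumes "smooth_on U V" "smooth_on U W" "y \<in> U"
  shows "DD b (\<lambda>y. christ g (F y) (V y) (W y)) y = DD (DD b F y) (\<lambda>x. christ g x (V y) (W y)) (F y)
    + christ g (F y) (DD b V y) (W y) + christ g (F y) (V y) (DD b W y)"
proof -
  have V: "V differentiable (at y)" and W: "W differentiable (at y)"
    using assms smooth_on_differentiable by auto
  let ?G = "\<lambda>i j x. christ g x (axis i 1) (axis j 1)"
  have G: "?G i j differentiable (at (F y))" for i j
    using smooth_on_differentiable[OF smooth_christ F_in[OF assms(3)]] .
  have 1: "((\<lambda>y. christ g (F y) (V y) (W y)) has_derivative (\<lambda>b. \<Sum>i\<in>UNIV. \<Sum>j\<in>UNIV.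
      (V y $ i * W y $ j) *\<^sub>R DD (DD b F y) (?G i j) (F y)
      + (V y $ i * DD b W y $ j + DD b V y $ i * W y $ j) *\<^sub>R ?G i j (F y))) (at y)"
    unfolding christ_expand[of g _ "V _"]
    by (intro has_derivative_sum has_derivative_scaleR has_derivative_mult DD_works[OF G]
        has_derivative_compose[OF DD_works[OF F_diff[OF assms(3)]] DD_works[OF G]]
        bounded_linear.has_derivative[OF bounded_linear_vec_nth] DD_works V W)
  have 2: "((\<lambda>x. christ g x (V y) (W y)) has_derivative (\<lambda>b. \<Sum>i\<in>UNIV. \<Sum>j\<in>UNIV.
      (V y $ i * W y $ j) *\<^sub>R DD b (?G i j) (F y))) (at (F y))"
    unfolding christ_expand[of g _ "V _"]
    by (intro has_derivative_sum has_derivative_scaleR_right DD_works[OF G])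
  show ?thesis
    unfolding DD_eqI[OF 1] DD_eqI[OF 2]
    unfolding christ_expand[of g _ "V _"] christ_expand[of g _ "DD _ _ _"]
    by (simp add: sum.distrib algebra_simps)
qed

lemma smooth_covd:
  assumes "smooth_on U V"
  shows "smooth_on U (covd g F b V)"
  unfolding covd_def
  by (intro smooth_on_add smooth_christ_map smooth_on_DD assms open_U smooth_F)

lemma DD_gform:
  assumes "smooth_on U V" "smooth_on U W" "y \<in> U"
  shows "DD b (\<lambda>y. gform g (F y) (V y) (W y)) y =
    gform g (F y) (covd g F b V y) (W y) + gform g (F y) (V y) (covd g F b W y)"
proof -
  have V: "V differentiable (at y)" and W: "W differentiable (at y)"
    using assms smooth_on_differentiable by auto
  have gF: "(\<lambda>y. g (F y)) differentiable (at y)"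
    using smooth_on_differentiable[OF smooth_gF assms(3)] .
  have gW: "(\<lambda>y. g (F y) *v W y) differentiable (at y)"
    by (rule smooth_on_differentiable[OF smooth_on_matrix_vector_mult[OF open_U smooth_gF assms(2)] assms(3)])
  have "DD b (\<lambda>y. gform g (F y) (V y) (W y)) y =
      V y \<bullet> (g (F y) *v DD b W y + DD b (\<lambda>y. g (F y)) y *v W y) + DD b V y \<bullet> (g (F y) *v W y)"
    unfolding gform_def bounded_bilinear.DD_bilinear[OF bounded_bilinear_inner V gW]
      bounded_bilinear.DD_bilinear[OF bounded_bilinear_matrix_vector_mult gF W] ..
  also have "DD b (\<lambda>y. g (F y)) y = DD (DD b F y) g (F y)"
    by (rule DD_compose[OF F_diff[OF assms(3)] g_diff[OF F_in[OF assms(3)]]])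
  finally show ?thesis
    unfolding inner_add_right christ_compat[OF F_in[OF assms(3)]] covd_def gform_linear
    by (simp add: gform_def)
qed

lemma covd_torsion_free:
  assumes "y \<in> U"
  shows "covd g F a (DD b F) y = covd g F b (DD a F) y"
  unfolding covd_def DD_commute[OF open_U smooth_F assms, of b a] christ_sym[OF F_in[OF assms], of "DD a F y"] ..

text \<open>The Ricci identity along \<open>F\<close>. The directions \<open>a\<close> and
  \<open>b\<close> are constant, so ordinary derivatives along them commute and no bracket
  arises.\<close>

lemma covd_commutator:
  assumes "smooth_on U V" "y \<in> U"
  shows "covd g F a (covd g F b V) y - covd g F b (covd g F a V) y = curv g (F y) (DD a F y) (DD b F y) (V y)"
proof -
  \<comment> \<open>The terms other than the derivative of \<open>christ\<close> and the doubly
    applied \<open>christ\<close> add up to something symmetric in \<open>a\<close> and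
    \<open>b\<close>; only curvature survives the difference.\<close>
  have *: "covd g F a (covd g F b V) y = DD a (DD b V) y + DD (DD a F y) (\<lambda>x. christ g x (DD b F y) (V y)) (F y)
    + christ g (F y) (DD a (DD b F) y) (V y) + christ g (F y) (DD b F y) (DD a V y)
    + christ g (F y) (DD a F y) (DD b V y) + christ g (F y) (DD a F y) (christ g (F y) (DD b F y) (V y))" for a b
  proof -
    have d: "DD b V differentiable (at y)" "(\<lambda>y. christ g (F y) (DD b F y) (V y)) differentiable (at y)"
      using assms smooth_on_differentiable smooth_on_DD[OF open_U] smooth_christ_map[OF smooth_on_DD[OF open_U smooth_F]]
      by blast+
    have "DD a (covd g F b V) y = DD a (DD b V) y + DD a (\<lambda>y. christ g (F y) (DD b F y) (V y)) y"
      unfolding covd_def by (rule DD_add[OF d])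
    then show ?thesis
      unfolding covd_def[of g F a] DD_christ_map[OF smooth_on_DD[OF open_U smooth_F] assms]
      by (simp add: covd_def christ_linear)
  qed
  show ?thesis
    unfolding * curv_def DD_commute[OF open_U assms, of a b] DD_commute[OF open_U smooth_F assms(2), of a b]
    by simp
qed

text \<open>The Gauss equation before its second derivative terms are rewritten: applied to a map and to
  the identity of its domain, the derivative terms agree.\<close>

lemma gform_curv:
  assumes "y \<in> U"
  shows "gform g (F y) (curv g (F y) (DD a F y) (DD b F y) (DD b F y)) (DD a F y) =
    DD a (\<lambda>y. gform g (F y) (covd g F b (DD b F) y) (DD a F y)) y
    - gform g (F y) (covd g F b (DD b F) y) (covd g F a (DD a F) y)
    - DD b (\<lambda>y. gform g (F y) (covd g F a (DD b F) y) (DD a F y)) y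
    + gform g (F y) (covd g F a (DD b F) y) (covd g F a (DD b F) y)"
proof -
  have s: "smooth_on U (DD u F)" for u by (rule smooth_on_DD[OF open_U smooth_F])
  show ?thesis
    unfolding DD_gform[OF smooth_covd[OF s] s assms] covd_commutator[OF s assms, symmetric]
      gform_diff_left covd_torsion_free[OF assms, of b a] by simp
qed

end

text \<open>The second derivatives of the squared length of the constant field \<open>Z\<close>
  commute, and by metric compatibility their difference is twice the left side.\<close>

lemma (in coord_metric) curv_skew:
  assumes "x \<in> S"
  shows "gform g x (curv g x X Y Z) Z = 0"
proof -
  interpret map_into_metric g S "\<lambda>x. x" S
    by unfold_locales (auto intro: open_S smooth_on_id)
  have s: "smooth_on S (\<lambda>_. Z)" by (rule smooth_on_const)
  have D: "DD b (\<lambda>y. gform g y Z Z) y = 2 * gform g y (covd g (\<lambda>x. x) b (\<lambda>_. Z) y) Z" if "y \<in> S" for y b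
    using DD_gform[OF s s that] gform_sym[OF that, of Z] by simp
  have D2: "DD a (DD b (\<lambda>y. gform g y Z Z)) x =
      2 * (gform g x (covd g (\<lambda>x. x) a (covd g (\<lambda>x. x) b (\<lambda>_. Z)) x) Z
      + gform g x (covd g (\<lambda>x. x) b (\<lambda>_. Z) x) (covd g (\<lambda>x. x) a (\<lambda>_. Z) x))" for a b
  proof -
    have "DD a (DD b (\<lambda>y. gform g y Z Z)) x = DD a (\<lambda>y. 2 * gform g y (covd g (\<lambda>x. x) b (\<lambda>_. Z) y) Z) x"
      by (rule DD_cong[OF open_S assms D])
    also have "\<dots> = 2 * DD a (\<lambda>y. gform g y (covd g (\<lambda>x. x) b (\<lambda>_. Z) y) Z) x"
      by (rule DD_bounded_linear[OF bounded_linear_mult_right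
          smooth_on_differentiable[OF smooth_gform[OF smooth_covd[OF s] s] assms]])
    finally show ?thesis unfolding DD_gform[OF smooth_covd[OF s] s assms] .
  qed
  have "DD X (DD Y (\<lambda>y. gform g y Z Z)) x = DD Y (DD X (\<lambda>y. gform g y Z Z)) x"
    by (rule DD_commute[OF open_S smooth_gform[OF s s] assms])
  then have "gform g x (covd g (\<lambda>x. x) X (covd g (\<lambda>x. x) Y (\<lambda>_. Z)) x
      - covd g (\<lambda>x. x) Y (covd g (\<lambda>x. x) X (\<lambda>_. Z)) x) Z = 0"
    unfolding D2 using gform_sym[OF assms] by (simp add: gform_diff_left)
  then show ?thesis
    unfolding covd_commutator[OF s assms] by simp
qed

section \<open>Pullback metrics and the Gauss equation\<close>

lemma DD_DD_sum:
  fixes F :: "'a::euclidean_space \<Rightarrow> 'b::real_normed_vector"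
  assumes "open U" "smooth_on U F" "y \<in> U"
  shows "DD c (DD v F) y = (\<Sum>i\<in>Basis. (v \<bullet> i) *\<^sub>R DD c (DD i F) y)"
proof -
  have "DD c (DD v F) y = DD c (\<lambda>y. \<Sum>i\<in>Basis. (v \<bullet> i) *\<^sub>R DD i F y) y"
    by (rule DD_cong[OF assms(1,3)]) (rule DD_basis_sum[OF smooth_on_differentiable[OF assms(2)]])
  also have "\<dots> = (\<Sum>i\<in>Basis. (v \<bullet> i) *\<^sub>R DD c (DD i F) y)"
    by (rule DD_eqI) (intro has_derivative_sum has_derivative_scaleR_right DD_works
        smooth_on_differentiable[OF smooth_on_DD[OF assms(1,2)] assms(3)])
  finally show ?thesis .
qed

text \<open>Differentiation of \<open>F\<close> in a direction that itself moves: one term for the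
  motion of the base point, one for that of the direction.\<close>

lemma DD_DD_field:
  fixes F :: "'a::euclidean_space \<Rightarrow> 'b::real_normed_vector" and \<sigma> :: "'c::euclidean_space \<Rightarrow> 'a"
  assumes "open U" "smooth_on U F" "open T" "smooth_on T \<sigma>" "\<And>t. t \<in> T \<Longrightarrow> \<sigma> t \<in> U" "smooth_on T V" "t \<in> T"
  shows "DD b (\<lambda>t. DD (V t) F (\<sigma> t)) t = DD (DD b \<sigma> t) (DD (V t) F) (\<sigma> t) + DD (DD b V t) F (\<sigma> t)"
proof -
  have F: "F differentiable (at (\<sigma> s))" if "s \<in> T" for s
    using smooth_on_differentiable[OF assms(2) assms(5)[OF that]] .
  have \<sigma>: "\<sigma> differentiable (at t)" and V: "V differentiable (at t)"
    using smooth_on_differentiable assms by auto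
  have DF: "DD i F differentiable (at (\<sigma> t))" for i
    using smooth_on_differentiable[OF smooth_on_DD[OF assms(1,2)] assms(5)[OF assms(7)]] .
  have "DD b (\<lambda>t. DD (V t) F (\<sigma> t)) t = DD b (\<lambda>t. \<Sum>i\<in>Basis. (V t \<bullet> i) *\<^sub>R DD i F (\<sigma> t)) t"
    by (rule DD_cong[OF assms(3,7)]) (rule DD_basis_sum[OF F])
  also have "\<dots> = (\<Sum>i\<in>Basis. (V t \<bullet> i) *\<^sub>R DD (DD b \<sigma> t) (DD i F) (\<sigma> t) + (DD b V t \<bullet> i) *\<^sub>R DD i F (\<sigma> t))"
    by (rule DD_eqI) (intro has_derivative_sum has_derivative_scaleR
        has_derivative_compose[OF DD_works[OF \<sigma>] DD_works[OF DF]]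
        bounded_linear.has_derivative[OF bounded_linear_inner_left] DD_works V)
  finally show ?thesis
    unfolding DD_DD_sum[OF assms(1,2) assms(5)[OF assms(7)], where v = "V t"]
      DD_basis_sum[OF F[OF assms(7)], where b = "DD b V t"] sum.distrib .
qed

lemma DD_direction_linear:
  assumes "F differentiable (at y)"
  shows "DD (r *\<^sub>R u + s *\<^sub>R v) F y = r *\<^sub>R DD u F y + s *\<^sub>R DD v F y"
  using DD_plus[OF assms] DD_scaleR[OF assms] by simp

context map_into_metric
begin

text \<open>The last summand is tangential and disappears on pairing with a normal vector; this is
  the tensoriality of the second fundamental form.\<close>

lemma covd_compose:
  fixes \<sigma> :: "'c::euclidean_space \<Rightarrow> 'a"
  assumes "open T" "smooth_on T \<sigma>" "\<And>t. t \<in> T \<Longrightarrow> \<sigma> t \<in> U" "smooth_on T V" "t \<in> T"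
  shows "covd g (\<lambda>t. F (\<sigma> t)) b (\<lambda>t. DD (V t) F (\<sigma> t)) t =
    covd g F (DD b \<sigma> t) (DD (V t) F) (\<sigma> t) + DD (DD b V t) F (\<sigma> t)"
  using DD_DD_field[OF open_U smooth_F assms(1-4,5), of b]
    DD_compose[OF smooth_on_differentiable[OF assms(2,5)] F_diff[OF assms(3)[OF assms(5)]], of b]
  by (simp add: covd_def)

lemma covd_linear_left:
  assumes "y \<in> U"
  shows "covd g F (r *\<^sub>R u + s *\<^sub>R v) (DD w F) y = r *\<^sub>R covd g F u (DD w F) y + s *\<^sub>R covd g F v (DD w F) y"
proof -
  have "DD w F differentiable (at y)"
    using smooth_on_differentiable[OF smooth_on_DD[OF open_U smooth_F] assms] .
  then show ?thesis
    unfolding covd_def DD_direction_linear[OF F_diff[OF assms]]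
    by (simp only: DD_direction_linear christ_linear scaleR_add_right) (simp add: algebra_simps)
qed

lemma covd_linear_right:
  assumes "y \<in> U"
  shows "covd g F w (DD (r *\<^sub>R u + s *\<^sub>R v) F) y = r *\<^sub>R covd g F w (DD u F) y + s *\<^sub>R covd g F w (DD v F) y"
  using covd_linear_left[OF assms] covd_torsion_free[OF assms] by metis

end

lemma curv_flip: "curv g x X Y Z = - curv g x Y X Z"
  by (simp add: curv_def)

context coord_metric
begin

lemma curv_linear_left:
  assumes "x \<in> S"
  shows "curv g x (r *\<^sub>R u + s *\<^sub>R v) Y Z = r *\<^sub>R curv g x u Y Z + s *\<^sub>R curv g x v Y Z"
proof -
  have d: "(\<lambda>x. christ g x v w) differentiable (at x)" for v w
    using smooth_on_differentiable[OF smooth_christ assms] .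
  have e: "DD Y (\<lambda>x. r *\<^sub>R christ g x u Z + s *\<^sub>R christ g x v Z) x =
      r *\<^sub>R DD Y (\<lambda>x. christ g x u Z) x + s *\<^sub>R DD Y (\<lambda>x. christ g x v Z) x"
    by (rule DD_eqI) (intro has_derivative_add has_derivative_scaleR_right DD_works d)
  show ?thesis
    unfolding curv_def christ_linear e DD_direction_linear[OF d]
    by (simp add: algebra_simps)
qed

lemma curv_linear_right:
  assumes "x \<in> S"
  shows "curv g x X Y (r *\<^sub>R u + s *\<^sub>R v) = r *\<^sub>R curv g x X Y u + s *\<^sub>R curv g x X Y v"
proof -
  have d: "(\<lambda>x. christ g x v w) differentiable (at x)" for v w
    using smooth_on_differentiable[OF smooth_christ assms] .
  have e: "DD Y (\<lambda>x. r *\<^sub>R christ g x X u + s *\<^sub>R christ g x X v) x =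
      r *\<^sub>R DD Y (\<lambda>x. christ g x X u) x + s *\<^sub>R DD Y (\<lambda>x. christ g x X v) x" for X Y
    by (rule DD_eqI) (intro has_derivative_add has_derivative_scaleR_right DD_works d)
  show ?thesis
    unfolding curv_def christ_linear e
    by (simp add: algebra_simps)
qed

lemma curv_linear_middle:
  assumes "x \<in> S"
  shows "curv g x X (r *\<^sub>R u + s *\<^sub>R v) Z = r *\<^sub>R curv g x X u Z + s *\<^sub>R curv g x X v Z"
  using curv_linear_left[OF assms, of r u s v X Z] curv_flip[of g x X] by simp

lemma curv_skew_polar:
  assumes "x \<in> S"
  shows "gform g x (curv g x X Y Z) W = - gform g x (curv g x X Y W) Z"
proof -
  have "gform g x (curv g x X Y (1 *\<^sub>R Z + 1 *\<^sub>R W)) (1 *\<^sub>R Z + 1 *\<^sub>R W) = 0"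
    by (rule curv_skew[OF assms])
  then show ?thesis
    unfolding curv_linear_right[OF assms]
    using curv_skew[OF assms, of X Y Z] curv_skew[OF assms, of X Y W] by (simp add: gform_linear)
qed

text \<open>Skew symmetry in the first pair of arguments produces the determinant of the change of
  frame once, skew symmetry in the second pair a second time. The curvature term thus scales like a
  Gram determinant.\<close>

lemma curv_change_frame:
  assumes "x \<in> S"
  shows "gform g x (curv g x (a *\<^sub>R X + b *\<^sub>R Y) (c *\<^sub>R X + d *\<^sub>R Y) (c *\<^sub>R X + d *\<^sub>R Y)) (a *\<^sub>R X + b *\<^sub>R Y) =
    (a * d - b * c)\<^sup>2 * gform g x (curv g x X Y Y) X"
proof -
  have 0: "curv g x X X Z = 0" "curv g x Y Y Z = 0" for Z
    by (simp_all add: curv_def)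
  have f: "curv g x Y X Z = - curv g x X Y Z" for Z by (rule curv_flip)
  have "curv g x (a *\<^sub>R X + b *\<^sub>R Y) (c *\<^sub>R X + d *\<^sub>R Y) Z = (a * d - b * c) *\<^sub>R curv g x X Y Z" for Z
    unfolding curv_linear_left[OF assms] curv_linear_middle[OF assms] 0 f
    by (simp add: algebra_simps)
  then have "gform g x (curv g x (a *\<^sub>R X + b *\<^sub>R Y) (c *\<^sub>R X + d *\<^sub>R Y) (c *\<^sub>R X + d *\<^sub>R Y)) (a *\<^sub>R X + b *\<^sub>R Y)
    = (a * d - b * c) * gform g x (c *\<^sub>R curv g x X Y X + d *\<^sub>R curv g x X Y Y) (a *\<^sub>R X + b *\<^sub>R Y)"
    by (simp only: curv_linear_right[OF assms, symmetric] gform_scaleR_left)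
  also have "\<dots> = (a * d - b * c)\<^sup>2 * gform g x (curv g x X Y Y) X"
    using curv_skew[OF assms, of X Y X] curv_skew[OF assms, of X Y Y] curv_skew_polar[OF assms, of X Y X Y]
    by (simp add: gform_linear power2_eq_square algebra_simps)
  finally show ?thesis .
qed

end

text \<open>Positivity of \<open>h\<close> forces \<open>F\<close> to be an immersion on
  \<open>U\<close>. The dimensions are unrelated, so that both the regular part of the surface and
  the transition maps of the target are instances.\<close>

locale pullback_map = map_into_metric g S F U + h: coord_metric h U
  for g :: "real^'n \<Rightarrow> real^'n::finite^'n" and S and F :: "real^'m::finite \<Rightarrow> real^'n" and U and h +
  assumes h_eq: "y \<in> U \<Longrightarrow> gform h y v w = gform g (F y) (DD v F y) (DD w F y)"
begin

text \<open>The Levi-Civita connection of the induced metric is the tangential part of the ambient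
  one: in the Koszul formula for \<open>h\<close> the derivatives are expanded by metric
  compatibility upstairs, and torsion freeness cancels all but one term.\<close>

lemma pullback_christ:
  assumes "y \<in> U"
  shows "gform h y (christ h y u v) w = gform g (F y) (covd g F u (DD v F) y) (DD w F y)"
proof -
  have s: "smooth_on U (DD u F)" for u by (rule smooth_on_DD[OF open_U smooth_F])
  have D: "a \<bullet> (DD b h y *v c) = gform g (F y) (covd g F b (DD a F) y) (DD c F y)
      + gform g (F y) (DD a F y) (covd g F b (DD c F) y)" for a b c
  proof -
    have "a \<bullet> (DD b h y *v c) = DD b (\<lambda>y. gform h y a c) y"
      unfolding gform_def
      by (rule DD_bounded_linear[symmetric, OF _ h.g_diff[OF assms]])
        (intro bounded_linear_compose[OF bounded_linear_inner_right]
          bounded_bilinear.bounded_linear_left[OF bounded_bilinear_matrix_vector_mult])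
    also have "\<dots> = DD b (\<lambda>y. gform g (F y) (DD a F y) (DD c F y)) y"
      by (rule DD_cong[OF open_U assms h_eq])
    finally show ?thesis unfolding DD_gform[OF s s assms] .
  qed
  show ?thesis
    unfolding h.gform_christ[OF assms] D
    unfolding covd_torsion_free[OF assms, of v u] covd_torsion_free[OF assms, of w u] covd_torsion_free[OF assms, of w v]
      gform_sym[OF F_in[OF assms], of "DD u F y"] gform_sym[OF F_in[OF assms], of "DD v F y"] by simp
qed

text \<open>With a transition map as \<open>F\<close>, this makes the normal component of an
  acceleration independent of the chart.\<close>

lemma gform_covd_pullback:
  fixes \<sigma> :: "'c::euclidean_space \<Rightarrow> real^'m"
  assumes "open T" "smooth_on T \<sigma>" "\<And>t. t \<in> T \<Longrightarrow> \<sigma> t \<in> U" "smooth_on T V" "t \<in> T"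
  shows "gform g (F (\<sigma> t)) (covd g (\<lambda>t. F (\<sigma> t)) b (\<lambda>t. DD (V t) F (\<sigma> t)) t) (DD w F (\<sigma> t)) =
    gform h (\<sigma> t) (covd h \<sigma> b V t) w"
proof -
  have c: "covd g (\<lambda>t. F (\<sigma> t)) b (\<lambda>t. DD (V t) F (\<sigma> t)) t =
      covd g F (DD b \<sigma> t) (DD (V t) F) (\<sigma> t) + DD (DD b V t) F (\<sigma> t)"
    by (rule covd_compose[OF assms])
  note s = assms(3)[OF assms(5)]
  show ?thesis
    unfolding c gform_add_left pullback_christ[OF s, symmetric] h_eq[OF s, symmetric]
    by (simp add: covd_def gform_add_left)
qed

end

lemma axis_expand_2: "(v :: real^2) = v $ 1 *\<^sub>R axis 1 1 + v $ 2 *\<^sub>R axis 2 1"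
  by (simp add: vec_eq_iff axis_def forall_2)

lemma (in coord_metric) riemann_curv:
  assumes "x \<in> S"
  shows "riemann g l i j k x = curv g x (axis i 1) (axis j 1) (axis k 1) $ l"
proof -
  have d: "(\<lambda>x. christ g x v w) differentiable (at x)" for v w
    using smooth_on_differentiable[OF smooth_christ assms] .
  have p: "partial i (christoffel g l j k) x = DD (axis i 1) (\<lambda>x. christ g x (axis j 1) (axis k 1)) x $ l" for i j
  proof -
    have "christoffel g l j k = (\<lambda>x. christ g x (axis j 1) (axis k 1) $ l)" by (simp add: christ_axis)
    then show ?thesis unfolding partial_def by (simp add: DD_bounded_linear[OF bounded_linear_vec_nth d])
  qed
  show ?thesis
    unfolding riemann_def curv_def
    by (simp add: p christ_axis_left[of _ _ _ "christ _ _ _ _"] christ_axis sum_subtractf)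
qed

lemma gauss_curvature_coord_curv:
  fixes h :: "real^2 \<Rightarrow> real^2^2"
  assumes "coord_metric h U" "x \<in> U"
  shows "gauss_curvature_coord h x * det (h x) = gform h x (curv h x (axis 1 1) (axis 2 1) (axis 2 1)) (axis 1 1)"
proof -
  interpret coord_metric h U by fact
  show ?thesis
    using det_g[OF assms(2)]
    by (simp add: gauss_curvature_coord_def riemann_curv[OF assms(2)] gform_def inner_vec_def
        matrix_vector_mult_basis column_def)
qed

text \<open>The right side of the Gauss equation multiplied by the determinant of the induced
  metric. It involves no inverse of that metric and so remains meaningful at singular points of
  \<open>F\<close>.\<close>

definition gauss_num :: "(real^3 \<Rightarrow> real^3^3) \<Rightarrow> (real^2 \<Rightarrow> real^3) \<Rightarrow> real^3 \<Rightarrow> real^2 \<Rightarrow> real^2 \<Rightarrow> real^2 \<Rightarrow> real" where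
  "gauss_num g F n a b y = gform g (F y) (curv g (F y) (DD a F y) (DD b F y) (DD b F y)) (DD a F y)
    + gform g (F y) (covd g F a (DD a F) y) n * gform g (F y) (covd g F b (DD b F) y) n
    - (gform g (F y) (covd g F a (DD b F) y) n)\<^sup>2"

text \<open>\<open>n\<close> is a vector at the single point \<open>F y\<close>: the second
  fundamental form is taken as the normal part of second derivatives of \<open>F\<close>, so no
  derivative of a normal field occurs.\<close>

lemma gauss_equation:
  fixes F :: "real^2 \<Rightarrow> real^3"
  assumes "pullback_map g S F U h" "y \<in> U"
    and n: "gform g (F y) n n = 1" "\<And>v. gform g (F y) (DD v F y) n = 0"
  shows "gauss_curvature_coord h y * det (h y) = gauss_num g F n (axis 1 1) (axis 2 1) y"
proof -
  interpret pullback_map g S F U h by fact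
  interpret i: map_into_metric h U "\<lambda>x. x" U
    by unfold_locales (auto intro: open_U smooth_on_id)
  let ?a = "axis 1 1 :: real^2" and ?b = "axis 2 1 :: real^2"
  define II where "II u v = gform g (F y) (covd g F u (DD v F) y) n" for u v
  note Fy = F_in[OF assms(2)]
  note symg = gform_sym[OF Fy]
  \<comment> \<open>Positivity of \<open>h\<close> makes the two tangent vectors independent and
    \<open>n\<close> is orthogonal to them; an injective endomorphism of three-space is
    onto.\<close>
  have surj: "\<exists>v c. w = DD v F y + c *\<^sub>R n" for w
  proof -
    define T where "T = (\<lambda>x::real^3. DD (x $ 1 *\<^sub>R ?a + x $ 2 *\<^sub>R ?b) F y + x $ 3 *\<^sub>R n)"
    have "linear T"
      unfolding T_def DD_direction_linear[OF F_diff[OF assms(2)]]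
      by (intro linearI) (simp_all add: algebra_simps)
    moreover have "inj T"
    proof (rule linear_injective_0[OF \<open>linear T\<close>, THEN iffD2], intro allI impI)
      fix x assume T0: "T x = 0"
      then have "gform g (F y) (T x) n = 0" by (simp add: gform_def)
      then have x3: "x $ 3 = 0" unfolding T_def by (simp add: gform_linear n)
      have "gform h y (x $ 1 *\<^sub>R ?a + x $ 2 *\<^sub>R ?b) (x $ 1 *\<^sub>R ?a + x $ 2 *\<^sub>R ?b) = 0"
        unfolding h_eq[OF assms(2)] using T0 x3 by (simp add: T_def gform_def)
      then have "x $ 1 *\<^sub>R ?a + x $ 2 *\<^sub>R ?b = 0"
        using h.gform_pos[OF assms(2)] by force
      then have "x $ 1 = 0" "x $ 2 = 0"
        by (auto simp: vec_eq_iff axis_def forall_2)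
      with x3 show "x = 0" by (simp add: vec_eq_iff forall_3)
    qed
    ultimately have "surj T" by (rule linear_injective_imp_surjective) simp
    then obtain x where "w = T x" by blast
    then show ?thesis unfolding T_def by blast
  qed
  \<comment> \<open>The Gauss formula, verified by pairing with the spanning vectors from
    \<open>surj\<close>.\<close>
  have split: "covd g F u (DD v F) y = DD (christ h y u v) F y + II u v *\<^sub>R n" (is "?l = ?r") for u v
  proof (rule gform_eqI[OF Fy])
    fix w
    obtain z c where w: "w = DD z F y + c *\<^sub>R n" using surj by blast
    show "gform g (F y) ?l w = gform g (F y) ?r w"
      unfolding w by (simp add: gform_linear II_def n pullback_christ[OF assms(2), symmetric]
          h_eq[OF assms(2), symmetric] symg[of n "DD _ _ _"])
  qed
  have G: "gform g (F y) (covd g F u (DD v F) y) (covd g F u' (DD v' F) y) =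
      gform h y (christ h y u v) (christ h y u' v') + II u v * II u' v'" for u v u' v'
    unfolding split[of u v] split[of u' v']
    by (simp add: gform_linear n h_eq[OF assms(2), symmetric] symg[of n "DD _ _ _"])
  have c: "covd h (\<lambda>x. x) u (DD v (\<lambda>x. x)) x = christ h x u v" for u v x
    by (simp add: covd_def)
  have e: "DD w (\<lambda>y. gform h y (christ h y u v) z) y =
      DD w (\<lambda>y. gform g (F y) (covd g F u (DD v F) y) (DD z F y)) y" for u v w z
    by (rule DD_cong[OF open_U assms(2) pullback_christ])
  have "gauss_curvature_coord h y * det (h y) = gform h y (curv h y ?a ?b ?b) ?a"
    by (rule gauss_curvature_coord_curv[OF _ assms(2)]) unfold_locales
  also have "\<dots> = DD ?a (\<lambda>y. gform g (F y) (covd g F ?b (DD ?b F) y) (DD ?a F y)) y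
      - gform h y (christ h y ?b ?b) (christ h y ?a ?a)
      - DD ?b (\<lambda>y. gform g (F y) (covd g F ?a (DD ?b F) y) (DD ?a F y)) y
      + gform h y (christ h y ?a ?b) (christ h y ?a ?b)"
    using i.gform_curv[OF assms(2), of ?a ?b] unfolding c e by (simp add: e)
  also have "\<dots> = gauss_num g F n ?a ?b y"
    unfolding gauss_num_def gform_curv[OF assms(2)] G II_def by (simp add: power2_eq_square)
  finally show ?thesis .
qed

text \<open>Second derivatives of \<sigma> contribute only tangential vectors, which
  \<open>n\<close> annihilates. What is left are the curvature term and the determinant of the
  second fundamental form, each scaling with the squared Jacobian determinant.\<close>

lemma gauss_num_change_coords:
  fixes F :: "real^2 \<Rightarrow> real^3" and \<sigma> :: "real^2 \<Rightarrow> real^2"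
  assumes "map_into_metric g S F U" "open T" "smooth_on T \<sigma>" "\<And>t. t \<in> T \<Longrightarrow> \<sigma> t \<in> U" "t \<in> T"
    and n: "\<And>v. gform g (F (\<sigma> t)) (DD v F (\<sigma> t)) n = 0"
    and M: "DD (axis 1 1) \<sigma> t = a *\<^sub>R axis 1 1 + b *\<^sub>R axis 2 1" "DD (axis 2 1) \<sigma> t = c *\<^sub>R axis 1 1 + d *\<^sub>R axis 2 1"
  shows "gauss_num g (\<lambda>t. F (\<sigma> t)) n (axis 1 1) (axis 2 1) t =
    (a * d - b * c)\<^sup>2 * gauss_num g F n (axis 1 1) (axis 2 1) (\<sigma> t)"
proof -
  interpret map_into_metric g S F U by fact
  let ?a = "axis 1 1 :: real^2" and ?b = "axis 2 1 :: real^2"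
  note U = assms(4)[OF assms(5)]
  have D: "DD v (\<lambda>t. F (\<sigma> t)) s = DD (DD v \<sigma> s) F (\<sigma> s)" if "s \<in> T" for v s
    by (rule DD_compose[OF smooth_on_differentiable[OF assms(3) that] F_diff[OF assms(4)[OF that]]])
  define II where "II u v = gform g (F (\<sigma> t)) (covd g F u (DD v F) (\<sigma> t)) n" for u v
  have L: "gform g (F (\<sigma> t)) (covd g (\<lambda>t. F (\<sigma> t)) u (DD v (\<lambda>t. F (\<sigma> t))) t) n = II (DD u \<sigma> t) (DD v \<sigma> t)" for u v
  proof -
    have "DD u (DD v (\<lambda>t. F (\<sigma> t))) t = DD u (\<lambda>t. DD (DD v \<sigma> t) F (\<sigma> t)) t"
      by (rule DD_cong[OF assms(2,5) D])
    then have "covd g (\<lambda>t. F (\<sigma> t)) u (DD v (\<lambda>t. F (\<sigma> t))) t = covd g (\<lambda>t. F (\<sigma> t)) u (\<lambda>t. DD (DD v \<sigma> t) F (\<sigma> t)) t"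
      by (simp only: covd_def D[OF assms(5)])
    also have "\<dots> = covd g F (DD u \<sigma> t) (DD (DD v \<sigma> t) F) (\<sigma> t) + DD (DD u (DD v \<sigma>) t) F (\<sigma> t)"
      by (rule covd_compose[OF assms(2-4) smooth_on_DD[OF assms(2,3)] assms(5)])
    finally show ?thesis by (simp add: II_def gform_add_left n)
  qed
  have II: "II (r *\<^sub>R ?a + s *\<^sub>R ?b) (r' *\<^sub>R ?a + s' *\<^sub>R ?b) =
      r * r' * II ?a ?a + (r * s' + s * r') * II ?a ?b + s * s' * II ?b ?b" for r s r' s'
    unfolding II_def covd_linear_left[OF U] covd_linear_right[OF U] covd_torsion_free[OF U, of ?b ?a]
    by (simp add: gform_linear algebra_simps)
  show ?thesis
    unfolding gauss_num_def D[OF assms(5)] L M II DD_direction_linear[OF F_diff[OF U]]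
      curv_change_frame[OF F_in[OF U]] II_def[symmetric]
    by (simp add: power2_eq_square algebra_simps)
qed

section \<open>Charts\<close>

lemma jacobian_mult:
  fixes F :: "real^'n \<Rightarrow> real^'m"
  assumes "F differentiable (at x)"
  shows "jacobian F (at x) *v v = DD v F x"
  by (rule DD_eqI[symmetric]) (rule jacobian_works[THEN iffD1, OF assms])

lemma cinv_coord: "is_chart c \<Longrightarrow> x \<in> cdom c \<Longrightarrow> cinv c (coord c x) = x"
  unfolding is_chart_def homeomorphism_def by blast

lemma open_coord_image:
  assumes "is_chart c" "open S"
  shows "open (coord c ` (cdom c \<inter> S))"
proof -
  have "openin (top_of_set (coord c ` cdom c)) (coord c ` (cdom c \<inter> S))"
    using homeomorphism_imp_open_map[of "cdom c" "coord c ` cdom c" "coord c" "cinv c" "cdom c \<inter> S"] assms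
    unfolding is_chart_def by (simp add: openin_open_Int)
  then show ?thesis
    using assms(1) openin_open_eq unfolding is_chart_def by blast
qed

lemma continuous_coord: "is_chart c \<Longrightarrow> continuous_on (cdom c) (coord c)"
  unfolding is_chart_def homeomorphism_def by blast

lemma transition_coord: "is_chart c \<Longrightarrow> x \<in> cdom c \<Longrightarrow> transition c d (coord c x) = coord d x"
  by (simp add: transition_def cinv_coord)

lemma local_rep_coord: "is_chart c \<Longrightarrow> x \<in> cdom c \<Longrightarrow> local_rep c d f (coord c x) = coord d (f x)"
  by (simp add: local_rep_def cinv_coord)

text \<open>Membership in the maximal atlas without a base point. It treats uniformly the charts of
  the given atlas, the charts of the normal form and the coordinates of the blow up.\<close>

definition admissible :: "('p::topological_space, 'n::finite) chart set \<Rightarrow> ('p, 'n) chart \<Rightarrow> bool" where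
  "admissible A c \<longleftrightarrow> is_chart c \<and> (\<forall>d\<in>A. smooth_transition c d \<and> smooth_transition d c)"

lemma admissible_atlas: "oriented_atlas A \<Longrightarrow> c \<in> A \<Longrightarrow> admissible A c"
  unfolding oriented_atlas_def admissible_def by blast

lemma admissible_centered: "coords_centered_at A p c \<Longrightarrow> admissible A c"
  unfolding coords_centered_at_def admissible_def by blast

lemma admissible_chart: "admissible A c \<Longrightarrow> is_chart c"
  unfolding admissible_def by blast

lemma atlas_cover: "oriented_atlas A \<Longrightarrow> \<exists>c\<in>A. x \<in> cdom c"
  unfolding oriented_atlas_def by blast

lemma chart_at:
  assumes "oriented_atlas A"
  shows "chart_at A x \<in> A" "x \<in> cdom (chart_at A x)"
  using someI_ex[of "\<lambda>c. c \<in> A \<and> x \<in> cdom c"] atlas_cover[OF assms] unfolding chart_at_def by blast+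

text \<open>Admissible charts are only assumed compatible with \<open>A\<close>; near each point the
  transition between two of them factors through a chart of \<open>A\<close>.\<close>

lemma smooth_transition_admissible:
  assumes A: "oriented_atlas A" and c: "admissible A c" and c': "admissible A c'"
  shows "smooth_on (coord c ` (cdom c \<inter> cdom c')) (transition c c')"
proof (rule smooth_on_local)
  fix z assume "z \<in> coord c ` (cdom c \<inter> cdom c')"
  then obtain x where x: "x \<in> cdom c" "x \<in> cdom c'" "z = coord c x" by blast
  obtain d where d: "d \<in> A" "x \<in> cdom d" using atlas_cover[OF A] by blast
  have ch: "is_chart c" "is_chart c'" "is_chart d"
    using c c' admissible_chart admissible_atlas[OF A d(1)] by blast+
  then have o: "open (cdom c')" "open (cdom d)" by (auto simp: is_chart_def)
  let ?T = "coord c ` (cdom c \<inter> (cdom c' \<inter> cdom d))"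
  have T: "open ?T" by (intro open_coord_image ch open_Int o)
  have 1: "smooth_on ?T (transition c d)"
    using c d(1) unfolding admissible_def smooth_transition_def
    by (blast intro: smooth_on_subset)
  have 2: "smooth_on (coord d ` (cdom d \<inter> cdom c')) (transition d c')"
    using c' d(1) unfolding admissible_def smooth_transition_def by blast
  have "smooth_on ?T (\<lambda>z. transition d c' (transition c d z))"
    by (rule smooth_on_compose[OF T 1 2]) (auto simp: transition_coord ch)
  then have "smooth_on ?T (transition c c')"
    by (rule smooth_on_cong[OF T, rotated]) (auto simp: transition_coord ch)
  then show "\<exists>T. open T \<and> z \<in> T \<and> smooth_on T (transition c c')"
    using T x d by blast
qed

lemma transition_diff:
  assumes "oriented_atlas A" "admissible A c" "admissible A c'" "x \<in> cdom c" "x \<in> cdom c'"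
  shows "transition c c' differentiable (at (coord c x))"
  using smooth_on_differentiable[OF smooth_transition_admissible[OF assms(1-3)]] assms(4,5) by blast

lemma transition_inverse:
  assumes "oriented_atlas A" "admissible A c" "admissible A c'" "x \<in> cdom c" "x \<in> cdom c'"
  shows "DD (DD v (transition c c') (coord c x)) (transition c' c) (coord c' x) = v"
proof -
  have ch: "is_chart c" "is_chart c'" using assms admissible_chart by blast+
  let ?T = "coord c ` (cdom c \<inter> cdom c')"
  have T: "open ?T" using open_coord_image ch by (metis is_chart_def)
  have "DD v (\<lambda>z. transition c' c (transition c c' z)) (coord c x) = DD v (\<lambda>z. z) (coord c x)"
    by (rule DD_cong[OF T]) (use assms in \<open>auto simp: transition_coord ch\<close>)
  moreover have "DD v (\<lambda>z. transition c' c (transition c c' z)) (coord c x) =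
      DD (DD v (transition c c') (coord c x)) (transition c' c) (transition c c' (coord c x))"
    by (rule DD_compose)
      (use transition_diff[OF assms] transition_diff[OF assms(1,3,2,5,4)] in \<open>simp_all add: transition_coord ch assms\<close>)
  ultimately show ?thesis by (simp add: transition_coord ch assms)
qed

section \<open>Smooth maps, regular points and metrics in charts\<close>

locale manifold_map =
  fixes A :: "('p::{t2_space,second_countable_topology}, 'n::finite) chart set"
    and B :: "('q::{t2_space,second_countable_topology}, 'k::finite) chart set"
    and g :: "('q, 'k) metric_family" and f :: "'p \<Rightarrow> 'q"
  assumes A: "oriented_atlas A" and B: "oriented_atlas B" and g: "riemannian_metric B g"
    and f: "smooth_map A B f"
begin

lemma charts: "admissible A c \<Longrightarrow> is_chart c" "admissible B d \<Longrightarrow> is_chart d" "d \<in> B \<Longrightarrow> is_chart d" "c \<in> A \<Longrightarrow> is_chart c"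
  using admissible_chart admissible_atlas A B by blast+

lemma open_f_vimage: "open W \<Longrightarrow> open (f -` W)"
  using f open_vimage unfolding smooth_map_def by blast

lemma open_cdom: "d \<in> B \<Longrightarrow> open (cdom d)" "admissible A c \<Longrightarrow> open (cdom c)"
  using charts unfolding is_chart_def by blast+

lemma open_rep_dom: "admissible A c \<Longrightarrow> d \<in> B \<Longrightarrow> open (coord c ` (cdom c \<inter> f -` cdom d))"
  by (intro open_coord_image charts open_f_vimage open_cdom) auto

text \<open>\<open>smooth_map\<close> speaks of atlas charts only; a chart \<open>a\<close> of
  \<open>A\<close> is interposed on the source side. The target chart stays in \<open>B\<close>,
  where the metric has components.\<close>

lemma smooth_local_rep:
  assumes c: "admissible A c" and d: "d \<in> B"
  shows "smooth_on (coord c ` (cdom c \<inter> f -` cdom d)) (local_rep c d f)"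
proof (rule smooth_on_local)
  fix z assume "z \<in> coord c ` (cdom c \<inter> f -` cdom d)"
  then obtain x where x: "x \<in> cdom c" "f x \<in> cdom d" "z = coord c x" by blast
  obtain a where a: "a \<in> A" "x \<in> cdom a" using atlas_cover[OF A] by blast
  note ad = admissible_atlas[OF A a(1)]
  let ?T = "coord c ` (cdom c \<inter> (cdom a \<inter> f -` cdom d))"
  have T: "open ?T" by (intro open_coord_image charts(1)[OF c] open_Int open_cdom(2)[OF ad] open_f_vimage open_cdom(1)[OF d])
  have 1: "smooth_on ?T (transition c a)"
    by (rule smooth_on_subset[OF smooth_transition_admissible[OF A c ad]]) blast
  have 2: "smooth_on (coord a ` (cdom a \<inter> f -` cdom d)) (local_rep a d f)"
    using f a(1) d unfolding smooth_map_def by blast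
  have "smooth_on ?T (\<lambda>z. local_rep a d f (transition c a z))"
    by (rule smooth_on_compose[OF T 1 2]) (auto simp: transition_coord charts(1)[OF c])
  then have "smooth_on ?T (local_rep c d f)"
    by (rule smooth_on_cong[OF T, rotated])
      (auto simp: transition_coord local_rep_coord charts(1)[OF c] charts(1)[OF ad])
  then show "\<exists>T. open T \<and> z \<in> T \<and> smooth_on T (local_rep c d f)"
    using T x a by blast
qed

lemma local_rep_diff:
  assumes "admissible A c" "d \<in> B" "x \<in> cdom c" "f x \<in> cdom d"
  shows "local_rep c d f differentiable (at (coord c x))"
  using smooth_on_differentiable[OF smooth_local_rep[OF assms(1,2)]] assms(3,4) by blast

lemma differential_mult:
  assumes "admissible A c" "d \<in> B" "x \<in> cdom c" "f x \<in> cdom d"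
  shows "differential c d f x *v v = DD v (local_rep c d f) (coord c x)"
  unfolding differential_def by (rule jacobian_mult[OF local_rep_diff[OF assms]])

lemma DD_local_rep_source:
  assumes "admissible A c" "admissible A c'" "d \<in> B" "x \<in> cdom c" "x \<in> cdom c'" "f x \<in> cdom d"
  shows "DD v (local_rep c d f) (coord c x) = DD (DD v (transition c c') (coord c x)) (local_rep c' d f) (coord c' x)"
proof -
  let ?T = "coord c ` (cdom c \<inter> cdom c')"
  have T: "open ?T" by (intro open_coord_image charts(1)[OF assms(1)] open_cdom assms)
  have "DD v (local_rep c d f) (coord c x) = DD v (\<lambda>z. local_rep c' d f (transition c c' z)) (coord c x)"
    by (rule DD_cong[OF T]) (use assms in \<open>auto simp: local_rep_coord transition_coord charts\<close>)
  also have "\<dots> = DD (DD v (transition c c') (coord c x)) (local_rep c' d f) (transition c c' (coord c x))"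
    by (rule DD_compose[OF transition_diff[OF A assms(1,2,4,5)]])
      (simp add: transition_coord[OF charts(1)[OF assms(1)] assms(4)] local_rep_diff[OF assms(2,3,5,6)])
  finally show ?thesis
    by (simp add: transition_coord[OF charts(1)[OF assms(1)] assms(4)])
qed

lemma DD_local_rep_target:
  assumes "admissible A c" "d \<in> B" "e \<in> B" "x \<in> cdom c" "f x \<in> cdom d" "f x \<in> cdom e"
  shows "DD v (local_rep c e f) (coord c x) = DD (DD v (local_rep c d f) (coord c x)) (transition d e) (coord d (f x))"
proof -
  let ?T = "coord c ` (cdom c \<inter> f -` (cdom d))"
  have T: "open ?T" by (rule open_rep_dom[OF assms(1,2)])
  have "DD v (local_rep c e f) (coord c x) = DD v (\<lambda>z. transition d e (local_rep c d f z)) (coord c x)"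
    by (rule DD_cong[OF T]) (use assms in \<open>auto simp: local_rep_coord transition_coord charts\<close>)
  also have "\<dots> = DD (DD v (local_rep c d f) (coord c x)) (transition d e) (local_rep c d f (coord c x))"
    by (rule DD_compose[OF local_rep_diff[OF assms(1,2,4,5)]])
      (simp add: local_rep_coord[OF charts(1)[OF assms(1)] assms(4)] transition_diff[OF B admissible_atlas[OF B] admissible_atlas[OF B]] assms)
  finally show ?thesis
    by (simp add: local_rep_coord[OF charts(1)[OF assms(1)] assms(4)])
qed

lemma regular_transfer:
  assumes "admissible A c" "d \<in> B" "x \<in> cdom c" "f x \<in> cdom d"
    and "admissible A c'" "e \<in> B" "x \<in> cdom c'" "f x \<in> cdom e"
    and "inj (\<lambda>v. DD v (local_rep c d f) (coord c x))"
  shows "inj (\<lambda>v. DD v (local_rep c' e f) (coord c' x))"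
proof (rule injI)
  fix v w assume eq: "DD v (local_rep c' e f) (coord c' x) = DD w (local_rep c' e f) (coord c' x)"
  have target: "DD u (local_rep c' d f) (coord c' x) =
      DD (DD u (local_rep c' e f) (coord c' x)) (transition e d) (coord e (f x))" for u
    by (rule DD_local_rep_target[OF assms(5,6,2,7,8,4)])
  have "DD v (local_rep c' d f) (coord c' x) = DD w (local_rep c' d f) (coord c' x)"
    unfolding target eq ..
  then have "DD v (transition c' c) (coord c' x) = DD w (transition c' c) (coord c' x)"
    unfolding DD_local_rep_source[OF assms(5,1,2,7,3,4)] by (rule injD[OF assms(9)])
  then show "v = w"
    using transition_inverse[OF A assms(5,1,7,3)] by metis
qed

text \<open>The definition quantifies over all pairs of atlas charts. As transition maps have
  injective differentials, one pair decides, even with a source chart from the maximal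
  atlas.\<close>

lemma regular_points_iff:
  assumes "admissible A c" "d \<in> B" "x \<in> cdom c" "f x \<in> cdom d"
  shows "x \<in> regular_points A B f \<longleftrightarrow> inj (\<lambda>v. DD v (local_rep c d f) (coord c x))"
proof
  assume r: "x \<in> regular_points A B f"
  obtain a where a: "a \<in> A" "x \<in> cdom a" using atlas_cover[OF A] by blast
  have "inj (\<lambda>v. differential a d f x *v v)"
    using r a assms(2,4) unfolding regular_points_def by blast
  then have "inj (\<lambda>v. DD v (local_rep a d f) (coord a x))"
    unfolding differential_mult[OF admissible_atlas[OF A a(1)] assms(2) a(2) assms(4)] .
  then show "inj (\<lambda>v. DD v (local_rep c d f) (coord c x))"
    by (rule regular_transfer[OF admissible_atlas[OF A a(1)] assms(2) a(2) assms(4) assms])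
next
  assume i: "inj (\<lambda>v. DD v (local_rep c d f) (coord c x))"
  show "x \<in> regular_points A B f"
    unfolding regular_points_def
  proof (intro CollectI ballI impI)
    fix a e assume a: "a \<in> A" "x \<in> cdom a" and e: "e \<in> B" "f x \<in> cdom e"
    show "inj (\<lambda>v. differential a e f x *v v)"
      unfolding differential_mult[OF admissible_atlas[OF A a(1)] e(1) a(2) e(2)]
      by (rule regular_transfer[OF assms admissible_atlas[OF A a(1)] e(1) a(2) e(2) i])
  qed
qed

lemma coord_metric_g: "d \<in> B \<Longrightarrow> coord_metric (g d) (coord d ` cdom d)"
  using g charts(3) unfolding riemannian_metric_def is_chart_def coord_metric_def by blast

lemma gform_transition:
  assumes "d \<in> B" "e \<in> B" "y \<in> cdom d" "y \<in> cdom e"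
  shows "gform (g d) (coord d y) v w =
    gform (g e) (coord e y) (DD v (transition d e) (coord d y)) (DD w (transition d e) (coord d y))"
proof -
  let ?J = "transition_jacobian d e y"
  have J: "?J *v v = DD v (transition d e) (coord d y)" for v
    unfolding transition_jacobian_def
    by (intro jacobian_mult transition_diff[OF B] admissible_atlas[OF B] assms)
  have "g d (coord d y) = transpose ?J ** g e (coord e y) ** ?J"
    using g assms unfolding riemannian_metric_def by blast
  then have "gform (g d) (coord d y) v w = v \<bullet> (transpose ?J *v (g e (coord e y) *v (?J *v w)))"
    by (simp add: gform_def matrix_vector_mul_assoc matrix_mul_assoc)
  also have "\<dots> = (?J *v v) \<bullet> (g e (coord e y) *v (?J *v w))"
    by (metis dot_lmul_matrix vector_transpose_matrix)
  finally show ?thesis unfolding J gform_def .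
qed

text \<open>The transformation law of the metric, read as the statement that a transition map is an
  isometry; results on induced metrics thereby apply to changes of target chart.\<close>

lemma pullback_map_transition:
  assumes "d \<in> B" "e \<in> B"
  shows "pullback_map (g e) (coord e ` cdom e) (transition d e) (coord d ` (cdom d \<inter> cdom e)) (g d)"
proof -
  interpret e: coord_metric "g e" "coord e ` cdom e" by (rule coord_metric_g[OF assms(2)])
  interpret d: coord_metric "g d" "coord d ` cdom d" by (rule coord_metric_g[OF assms(1)])
  have o: "open (coord d ` (cdom d \<inter> cdom e))"
    by (intro open_coord_image charts assms open_cdom)
  show ?thesis
  proof unfold_locales
    show "smooth_on (coord d ` (cdom d \<inter> cdom e)) (transition d e)"
      by (intro smooth_transition_admissible[OF B] admissible_atlas[OF B] assms)
    show "smooth_on (coord d ` (cdom d \<inter> cdom e)) (g d)"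
      by (rule smooth_on_subset[OF d.smooth_g]) blast
    fix y assume y: "y \<in> coord d ` (cdom d \<inter> cdom e)"
    then obtain x where x: "x \<in> cdom d" "x \<in> cdom e" "y = coord d x" by blast
    show "transition d e y \<in> coord e ` cdom e"
      using x by (simp add: transition_coord charts assms)
    show "transpose (g d y) = g d y" using y d.transpose_g by blast
    show "v \<bullet> (g d y *v v) > 0" if "v \<noteq> 0" for v using y d.g_pos that by blast
    show "gform (g d) y v w = gform (g e) (transition d e y) (DD v (transition d e) y) (DD w (transition d e) y)" for v w
      unfolding x(3) transition_coord[OF charts(3)[OF assms(1)] x(1)]
      by (rule gform_transition[OF assms x(1,2)])
  qed (rule o)
qed

text \<open>The target chart inside \<open>pullback_metric\<close> is picked by choice; the
  transformation law of \<open>g\<close> lets any chart \<open>d\<close> around \<open>f x\<close>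
  replace it.\<close>

lemma gform_pullback_metric:
  assumes "admissible A c" "d \<in> B" "x \<in> cdom c" "f x \<in> cdom d"
  shows "gform (pullback_metric B g f c) (coord c x) v w =
    gform (g d) (coord d (f x)) (DD v (local_rep c d f) (coord c x)) (DD w (local_rep c d f) (coord c x))"
proof -
  let ?e = "chart_at B (f x)"
  note e = chart_at[OF B, of "f x"]
  let ?J = "differential c ?e f x"
  have "pullback_metric B g f c (coord c x) = transpose ?J ** g ?e (coord ?e (f x)) ** ?J"
    unfolding pullback_metric_def Let_def cinv_coord[OF charts(1)[OF assms(1)] assms(3)] ..
  then have "gform (pullback_metric B g f c) (coord c x) v w = v \<bullet> (transpose ?J *v (g ?e (coord ?e (f x)) *v (?J *v w)))"
    by (simp add: gform_def matrix_vector_mul_assoc matrix_mul_assoc)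
  also have "\<dots> = (?J *v v) \<bullet> (g ?e (coord ?e (f x)) *v (?J *v w))"
    by (metis dot_lmul_matrix vector_transpose_matrix)
  finally have *: "gform (pullback_metric B g f c) (coord c x) v w =
      gform (g ?e) (coord ?e (f x)) (DD v (local_rep c ?e f) (coord c x)) (DD w (local_rep c ?e f) (coord c x))"
    unfolding differential_mult[OF assms(1) e(1) assms(3) e(2)] gform_def .
  show ?thesis
    unfolding * DD_local_rep_target[OF assms(1,2) e(1) assms(3,4) e(2)]
    by (rule gform_transition[OF assms(2) e(1) assms(4) e(2), symmetric])
qed

lemma matrix_gform: "M $ i $ j = axis i 1 \<bullet> (M *v axis j 1)" for M :: "real^'a^'b"
  by (simp add: matrix_vector_mult_basis column_def inner_axis')

text \<open>Regularity enters only through positivity: an injective differential pulls a positive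
  definite form back to a positive definite one.\<close>

lemma pullback_map_metric:
  assumes "admissible A c" "d \<in> B" "open W" "W \<subseteq> coord c ` (cdom c \<inter> f -` cdom d \<inter> regular_points A B f)"
  shows "pullback_map (g d) (coord d ` cdom d) (local_rep c d f) W (pullback_metric B g f c)"
proof -
  interpret d: coord_metric "g d" "coord d ` cdom d" by (rule coord_metric_g[OF assms(2)])
  interpret map_into_metric "g d" "coord d ` cdom d" "local_rep c d f" W
  proof unfold_locales
    show "smooth_on W (local_rep c d f)"
      by (rule smooth_on_subset[OF smooth_local_rep[OF assms(1,2)]]) (use assms(4) in blast)
    show "local_rep c d f y \<in> coord d ` cdom d" if "y \<in> W" for y
      using that assms(4) charts(1)[OF assms(1)] by (force simp: local_rep_coord)
  qed (rule assms)
  let ?h = "pullback_metric B g f c"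
  have h: "gform ?h y v w = gform (g d) (local_rep c d f y) (DD v (local_rep c d f) y) (DD w (local_rep c d f) y)"
    if y: "y \<in> W" for y v w
  proof -
    obtain x where x: "x \<in> cdom c" "f x \<in> cdom d" "y = coord c x" using y assms(4) by blast
    show ?thesis
      unfolding x(3) local_rep_coord[OF charts(1)[OF assms(1)] x(1)]
      by (rule gform_pullback_metric[OF assms(1,2) x(1,2)])
  qed
  have m: "?h y $ i $ j = gform ?h y (axis i 1) (axis j 1)" for y i j
    unfolding gform_def by (rule matrix_gform)
  show ?thesis
  proof unfold_locales
    show "smooth_on W ?h"
    proof (rule smooth_on_row[OF assms(3)])
      fix i j
      show "smooth_on W (\<lambda>y. ?h y $ i $ j)"
        by (rule smooth_on_cong[OF assms(3) _ smooth_gform[OF smooth_on_DD[OF open_U smooth_F] smooth_on_DD[OF open_U smooth_F]]])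
          (simp add: m h)
    qed
    fix y assume y: "y \<in> W"
    show "transpose (?h y) = ?h y"
      by (simp add: vec_eq_iff transpose_def m h[OF y] d.gform_sym[OF F_in[OF y]])
    show "v \<bullet> (?h y *v v) > 0" if "v \<noteq> 0" for v
    proof -
      obtain x where x: "x \<in> cdom c" "f x \<in> cdom d" "y = coord c x" "x \<in> regular_points A B f" using y assms(4) by blast
      have "inj (\<lambda>v. DD v (local_rep c d f) y)"
        using x regular_points_iff[OF assms(1,2) x(1,2)] by simp
      then have "DD v (local_rep c d f) y \<noteq> DD 0 (local_rep c d f) y"
        using that by (metis injD)
      then have "DD v (local_rep c d f) y \<noteq> 0" using DD_zero[OF F_diff[OF y]] by simp
      then show ?thesis
        using d.gform_pos[OF F_in[OF y]] h[OF y] unfolding gform_def[of ?h] by simp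
    qed
    show "gform ?h y v w = gform (g d) (local_rep c d f y) (DD v (local_rep c d f) y) (DD w (local_rep c d f) y)" for v w
      by (rule h[OF y])
  qed (rule open_U)
qed

end

section \<open>The Gauss equation on the manifold\<close>

lemma gauss_num_cong:
  assumes "open W" "y \<in> W" "\<And>z. z \<in> W \<Longrightarrow> F z = G z"
  shows "gauss_num g F n a b y = gauss_num g G n a b y"
proof -
  have D: "DD v F z = DD v G z" if "z \<in> W" for v z
    by (rule DD_cong[OF assms(1) that assms(3)])
  have D2: "DD u (DD v F) y = DD u (DD v G) y" for u v
    by (rule DD_cong[OF assms(1,2) D])
  have c: "covd g F u (DD v F) y = covd g G u (DD v G) y" for u v
    unfolding covd_def D2 D[OF assms(2)] assms(3)[OF assms(2)] ..
  show ?thesis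
    unfolding gauss_num_def c D[OF assms(2)] assms(3)[OF assms(2)] ..
qed

definition gram :: "(real^'n \<Rightarrow> real^'n^'n) \<Rightarrow> real^'n \<Rightarrow> real^'n::finite \<Rightarrow> real^'n \<Rightarrow> real" where
  "gram g x v w = gform g x v v * gform g x w w - (gform g x v w)\<^sup>2"

lemma (in coord_metric) gram_pos:
  assumes "x \<in> S" "\<And>a b. a *\<^sub>R v + b *\<^sub>R w = 0 \<Longrightarrow> a = 0 \<and> b = 0"
  shows "gram g x v w > 0"
proof -
  \<comment> \<open>The part of \<open>v\<close> orthogonal to \<open>w\<close>, cleared of its
    denominator; its squared length is the Gram determinant times the squared length of
    \<open>w\<close>.\<close>
  let ?u = "gform g x w w *\<^sub>R v + (- gform g x v w) *\<^sub>R w"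
  have "w \<noteq> 0" using assms(2)[of 0 1] by auto
  then have w: "gform g x w w > 0" by (rule gform_pos[OF assms(1)])
  have "?u \<noteq> 0"
  proof
    assume "?u = 0"
    from assms(2)[OF this] w show False by simp
  qed
  then have "gform g x ?u ?u > 0" by (rule gform_pos[OF assms(1)])
  also have "gform g x ?u ?u = gform g x w w * gram g x v w"
    unfolding gram_def gform_linear gform_sym[OF assms(1), of w v] by (simp add: power2_eq_square algebra_simps)
  finally show ?thesis using w by (simp add: zero_less_mult_iff)
qed

lemma (in coord_metric) gram_change_frame:
  assumes "x \<in> S"
  shows "gram g x (a *\<^sub>R v + b *\<^sub>R w) (c *\<^sub>R v + d *\<^sub>R w) = (a * d - b * c)\<^sup>2 * gram g x v w"
  unfolding gram_def gform_linear gform_sym[OF assms, of w v] by (simp add: power2_eq_square algebra_simps)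

lemma gram_det:
  fixes h :: "real^2 \<Rightarrow> real^2^2"
  shows "transpose (h z) = h z \<Longrightarrow> det (h z) = gram h z (axis 1 1) (axis 2 1)"
proof -
  assume t: "transpose (h z) = h z"
  have "h z $ 2 $ 1 = transpose (h z) $ 1 $ 2" by (simp add: transpose_def)
  then have s: "h z $ 2 $ 1 = h z $ 1 $ 2" unfolding t .
  show ?thesis
    unfolding det_2 gram_def gform_def
    by (simp add: matrix_vector_mult_basis column_def inner_axis' s power2_eq_square)
qed

text \<open>The curvature is defined in the picked chart \<open>c1\<close>; this form moves it to
  any admissible chart \<open>c\<close>. It is a product identity, so that later the Gram
  determinant can be factored before dividing.\<close>

lemma gauss_curvature_local:
  fixes A :: "('p::{t2_space,second_countable_topology}, 2) chart set"
    and B :: "('q::{t2_space,second_countable_topology}, 3) chart set"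
  assumes "manifold_map A B g f" and c: "admissible A c" and d: "d \<in> B"
    and R: "open R" "R \<subseteq> cdom c \<inter> f -` cdom d \<inter> regular_points A B f" "x \<in> R"
    and n: "gform (g d) (coord d (f x)) n n = 1"
      "\<And>v. gform (g d) (coord d (f x)) (DD v (local_rep c d f) (coord c x)) n = 0"
  shows "gauss_curvature A (pullback_metric B g f) x *
      gram (g d) (coord d (f x)) (DD (axis 1 1) (local_rep c d f) (coord c x)) (DD (axis 2 1) (local_rep c d f) (coord c x)) =
    gauss_num (g d) (local_rep c d f) n (axis 1 1) (axis 2 1) (coord c x)"
proof -
  interpret manifold_map A B g f by fact
  interpret gd: coord_metric "g d" "coord d ` cdom d" by (rule coord_metric_g[OF d])
  let ?a = "axis 1 1 :: real^2" and ?b = "axis 2 1 :: real^2"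
  define c1 where "c1 = chart_at A x"
  have c1: "admissible A c1" "x \<in> cdom c1"
    using chart_at[OF A, of x] admissible_atlas[OF A] unfolding c1_def by blast+
  have ch: "is_chart c1" "is_chart c" using charts c1 c by blast+
  have x: "x \<in> cdom c" "f x \<in> cdom d" using R by auto
  define F where "F = local_rep c d f"
  define F1 where "F1 = local_rep c1 d f"
  define \<sigma> where "\<sigma> = transition c1 c"
  define h where "h = pullback_metric B g f c1"
  define z where "z = coord c1 x"
  define W where "W = coord c1 ` (cdom c1 \<inter> R)"
  have oW: "open W" unfolding W_def by (rule open_coord_image[OF ch(1) R(1)])
  have zW: "z \<in> W" unfolding W_def z_def using c1(2) R(3) by blast
  have pm: "pullback_map (g d) (coord d ` cdom d) F1 W h"
    unfolding F1_def h_def by (rule pullback_map_metric[OF c1(1) d oW]) (use R(2) in \<open>unfold W_def, blast\<close>)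
  then interpret pm: pullback_map "g d" "coord d ` cdom d" F1 W h .
  have \<sigma>z: "\<sigma> z = coord c x" unfolding \<sigma>_def z_def by (rule transition_coord[OF ch(1) c1(2)])
  have F1z: "F1 z = coord d (f x)" unfolding F1_def z_def by (rule local_rep_coord[OF ch(1) c1(2)])
  have Fx: "F (coord c x) = coord d (f x)" unfolding F_def by (rule local_rep_coord[OF ch(2) x(1)])
  have DF1: "DD v F1 z = DD (DD v \<sigma> z) F (coord c x)" for v
    unfolding F1_def F_def \<sigma>_def z_def by (rule DD_local_rep_source[OF c1(1) c d c1(2) x])
  define a where "a = DD ?a \<sigma> z $ 1"
  define b where "b = DD ?a \<sigma> z $ 2"
  define c' where "c' = DD ?b \<sigma> z $ 1"
  define d' where "d' = DD ?b \<sigma> z $ 2"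
  have M: "DD ?a \<sigma> z = a *\<^sub>R ?a + b *\<^sub>R ?b" "DD ?b \<sigma> z = c' *\<^sub>R ?a + d' *\<^sub>R ?b"
    unfolding a_def b_def c'_def d'_def by (rule axis_expand_2)+
  have Fd: "F differentiable (at (coord c x))"
    unfolding F_def by (rule local_rep_diff[OF c d x])
  have D1: "DD ?a F1 z = a *\<^sub>R DD ?a F (coord c x) + b *\<^sub>R DD ?b F (coord c x)"
    "DD ?b F1 z = c' *\<^sub>R DD ?a F (coord c x) + d' *\<^sub>R DD ?b F (coord c x)"
    unfolding DF1 M DD_direction_linear[OF Fd] by auto
  have "gauss_curvature_coord h z * det (h z) = gauss_num (g d) F1 n ?a ?b z"
    by (rule gauss_equation[OF pm zW]) (simp_all add: F1z DF1 n F_def)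
  also have "gauss_num (g d) F1 n ?a ?b z = gauss_num (g d) (\<lambda>t. F (\<sigma> t)) n ?a ?b z"
  proof (rule gauss_num_cong[OF oW zW])
    fix y assume "y \<in> W"
    then obtain x' where x': "x' \<in> cdom c1" "x' \<in> R" "y = coord c1 x'" unfolding W_def by blast
    then have "x' \<in> cdom c" using R(2) by blast
    then show "F1 y = F (\<sigma> y)"
      unfolding x'(3) F1_def F_def \<sigma>_def
      by (simp only: local_rep_coord[OF ch(1) x'(1)] transition_coord[OF ch(1) x'(1)] local_rep_coord[OF ch(2)])
  qed
  also have "\<dots> = (a * d' - b * c')\<^sup>2 * gauss_num (g d) F n ?a ?b (\<sigma> z)"
  proof (rule gauss_num_change_coords[where U = "coord c ` (cdom c \<inter> f -` cdom d)" and S = "coord d ` cdom d", OF _ oW _ _ zW _ M])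
    show "map_into_metric (g d) (coord d ` cdom d) F (coord c ` (cdom c \<inter> f -` cdom d))"
    proof unfold_locales
      show "open (coord c ` (cdom c \<inter> f -` cdom d))" by (rule open_rep_dom[OF c d])
      show "smooth_on (coord c ` (cdom c \<inter> f -` cdom d)) F" unfolding F_def by (rule smooth_local_rep[OF c d])
      show "F y \<in> coord d ` cdom d" if "y \<in> coord c ` (cdom c \<inter> f -` cdom d)" for y
        using that unfolding F_def by (auto simp: local_rep_coord[OF ch(2)])
    qed
    show "smooth_on W \<sigma>" unfolding \<sigma>_def
      by (rule smooth_on_subset[OF smooth_transition_admissible[OF A c1(1) c]]) (use R(2) in \<open>unfold W_def, blast\<close>)
    show "\<sigma> t \<in> coord c ` (cdom c \<inter> f -` cdom d)" if "t \<in> W" for t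
      using that R(2) unfolding W_def \<sigma>_def by (auto simp: transition_coord[OF ch(1)])
    show "gform (g d) (F (\<sigma> z)) (DD v F (\<sigma> z)) n = 0" for v
      unfolding \<sigma>z Fx using n(2) unfolding F_def .
  qed
  finally have 1: "gauss_curvature_coord h z * det (h z) = (a * d' - b * c')\<^sup>2 * gauss_num (g d) F n ?a ?b (coord c x)"
    unfolding \<sigma>z .
  have "det (h z) = gram h z ?a ?b"
    by (rule gram_det) (rule pm.h.transpose_g[OF zW])
  also have "\<dots> = gram (g d) (coord d (f x)) (DD ?a F1 z) (DD ?b F1 z)"
    unfolding gram_def pm.h_eq[OF zW] F1z ..
  also have "\<dots> = (a * d' - b * c')\<^sup>2 * gram (g d) (coord d (f x)) (DD ?a F (coord c x)) (DD ?b F (coord c x))"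
    unfolding D1 by (rule gd.gram_change_frame) (use x in blast)
  finally have 2: "det (h z) = (a * d' - b * c')\<^sup>2 * gram (g d) (coord d (f x)) (DD ?a F (coord c x)) (DD ?b F (coord c x))" .
  have K: "gauss_curvature A (pullback_metric B g f) x = gauss_curvature_coord h z"
    unfolding gauss_curvature_def h_def z_def c1_def Let_def ..
  \<comment> \<open>The determinant of the induced metric in \<open>c1\<close> contains this factor
    and is nonzero at a regular point, so the factor cancels from both sides.\<close>
  have nz: "(a * d' - b * c')\<^sup>2 \<noteq> 0" using pm.h.det_g[OF zW] 2 by auto
  have "(a * d' - b * c')\<^sup>2 * (gauss_curvature_coord h z * gram (g d) (coord d (f x)) (DD ?a F (coord c x)) (DD ?b F (coord c x)))
      = (a * d' - b * c')\<^sup>2 * gauss_num (g d) F n ?a ?b (coord c x)"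
    using 1 unfolding 2 by (simp only: mult.left_commute)
  then show ?thesis
    unfolding K F_def[symmetric] mult_left_cancel[OF nz] .
qed

section \<open>Cuspidal edges\<close>

lemma DD_scaleR_fun:
  fixes s :: "'a::euclidean_space \<Rightarrow> real"
  assumes "s differentiable (at z)" "H differentiable (at z)"
  shows "DD v (\<lambda>z. s z *\<^sub>R H z) z = s z *\<^sub>R DD v H z + DD v s z *\<^sub>R H z"
  by (rule bounded_bilinear.DD_bilinear[OF bounded_bilinear_scaleR assms])

lemma DD_mult_fun:
  fixes s t :: "'a::euclidean_space \<Rightarrow> real"
  assumes "s differentiable (at z)" "t differentiable (at z)"
  shows "DD v (\<lambda>z. s z * t z) z = s z * DD v t z + DD v s z * t z"
  by (rule bounded_bilinear.DD_bilinear[OF bounded_bilinear_mult assms])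

lemma DD_vec_nth: "DD v (\<lambda>z. z $ i) z = v $ i"
  using DD_bounded_linear[OF bounded_linear_vec_nth, of "\<lambda>z. z"] by simp

lemma vec_nth_diff: "(\<lambda>z. z $ i) differentiable (at z)"
  using bounded_linear_imp_differentiable bounded_linear_vec_nth by blast

text \<open>The direction of differentiation and the arguments of \<open>christ\<close> all depend
  on \<open>y\<close>. Expanding each in a basis leaves derivatives of fixed functions composed with
  \<open>F\<close>.\<close>

lemma (in map_into_metric) smooth_curv:
  assumes X: "smooth_on U X" and Y: "smooth_on U Y" and Z: "smooth_on U Z"
  shows "smooth_on U (\<lambda>y. curv g (F y) (X y) (Y y) (Z y))"
proof -
  have e: "smooth_on U (\<lambda>y. DD (V y) (\<lambda>x. christ g x a b) (F y))" if "smooth_on U V" for V a b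
  proof (rule smooth_on_cong[OF open_U])
    show "(\<Sum>i\<in>Basis. (V y \<bullet> i) *\<^sub>R DD i (\<lambda>x. christ g x a b) (F y)) = DD (V y) (\<lambda>x. christ g x a b) (F y)"
      if "y \<in> U" for y
      by (rule DD_basis_sum[symmetric]) (rule smooth_on_differentiable[OF smooth_christ F_in[OF that]])
    show "smooth_on U (\<lambda>y. \<Sum>i\<in>Basis. (V y \<bullet> i) *\<^sub>R DD i (\<lambda>x. christ g x a b) (F y))"
      by (intro smooth_on_sum smooth_on_scaleR open_U smooth_on_bounded_linear[OF bounded_linear_inner_left] that)
        (rule smooth_on_compose[OF open_U smooth_F smooth_on_DD[OF open_S smooth_christ] F_in])
  qed
  have D: "smooth_on U (\<lambda>y. DD (V y) (\<lambda>x. christ g x (P y) (Q y)) (F y))"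
    if V: "smooth_on U V" and P: "smooth_on U P" and Q: "smooth_on U Q" for V P Q
  proof (rule smooth_on_cong[OF open_U])
    show "(\<Sum>i\<in>UNIV. \<Sum>j\<in>UNIV. (P y $ i * Q y $ j) *\<^sub>R DD (V y) (\<lambda>x. christ g x (axis i 1) (axis j 1)) (F y))
      = DD (V y) (\<lambda>x. christ g x (P y) (Q y)) (F y)" if y: "y \<in> U" for y
    proof -
      have "((\<lambda>x. christ g x (P y) (Q y)) has_derivative (\<lambda>b. \<Sum>i\<in>UNIV. \<Sum>j\<in>UNIV.
        (P y $ i * Q y $ j) *\<^sub>R DD b (\<lambda>x. christ g x (axis i 1) (axis j 1)) (F y))) (at (F y))"
        unfolding christ_expand[of g _ "P _"]
        by (intro has_derivative_sum has_derivative_scaleR_right DD_works smooth_on_differentiable[OF smooth_christ F_in[OF y]])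
      then show ?thesis
        by (rule DD_eqI[symmetric])
    qed
    show "smooth_on U (\<lambda>y. \<Sum>i\<in>UNIV. \<Sum>j\<in>UNIV. (P y $ i * Q y $ j) *\<^sub>R DD (V y) (\<lambda>x. christ g x (axis i 1) (axis j 1)) (F y))"
      by (intro smooth_on_sum smooth_on_scaleR open_U smooth_on_mult smooth_on_vec_nth P Q e V)
  qed
  show ?thesis
    unfolding curv_def
    by (intro smooth_on_diff smooth_on_add open_U D smooth_christ_map X Y Z)
qed

text \<open>In the coordinates of the normal form of a cuspidal edge, the derivative in the second variable is
  \<open>v H\<close>; working with \<open>H\<close> in its place keeps all expressions smooth across \<open>v = 0\<close>.\<close>

locale cuspidal_frame = map_into_metric g S F U
  for g :: "real^3 \<Rightarrow> real^3^3" and S and F :: "real^2 \<Rightarrow> real^3" and U +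
  fixes H N :: "real^2 \<Rightarrow> real^3"
  assumes smooth_H: "smooth_on U H" and smooth_N: "smooth_on U N"
    and DF2: "z \<in> U \<Longrightarrow> DD (axis 2 1) F z = z $ 2 *\<^sub>R H z"
    and independent: "z \<in> U \<Longrightarrow> a *\<^sub>R DD (axis 1 1) F z + b *\<^sub>R H z = 0 \<Longrightarrow> a = 0 \<and> b = 0"
    and unit: "z \<in> U \<Longrightarrow> gform g (F z) (N z) (N z) = 1"
    and normal: "z \<in> U \<Longrightarrow> gform g (F z) (DD v F z) (N z) = 0"
begin

abbreviation "X1 \<equiv> DD (axis 1 1) F"

text \<open>\<open>Phi\<close> is the curvature times the second coordinate, \<open>kap\<close> extends the limiting normal curvature
  off the singular curve; on it they differ by a nowhere vanishing factor.\<close>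

definition L where "L z = gform g (F z) (covd g F (axis 1 1) X1 z) (N z)"
definition nn where "nn z = gform g (F z) (covd g F (axis 2 1) H z) (N z)"
text \<open>The part of the Gauss numerator that acquires the square of the second coordinate when
  \<open>H\<close> replaces the second derivative direction: ambient curvature and mixed
  term.\<close>

definition rest where "rest z = gform g (F z) (curv g (F z) (X1 z) (H z) (H z)) (X1 z)
  - (gform g (F z) (covd g F (axis 1 1) H z) (N z))\<^sup>2"
definition lam where "lam z = gram g (F z) (X1 z) (H z)"
definition Phi where "Phi z = (L z * nn z + z $ 2 * rest z) / lam z"
definition kap where "kap z = L z / gform g (F z) (X1 z) (X1 z)"

lemma smooth_X1: "smooth_on U X1"
  by (rule smooth_on_DD[OF open_U smooth_F])

lemma lam_pos: "z \<in> U \<Longrightarrow> lam z > 0"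
  unfolding lam_def by (rule gram_pos[OF F_in independent])

lemma X1_pos: "z \<in> U \<Longrightarrow> gform g (F z) (X1 z) (X1 z) > 0"
  by (rule gform_pos[OF F_in]) (use independent[of z 1 0] in auto)

lemma smooth_L: "smooth_on U L"
  unfolding L_def by (intro smooth_gform smooth_covd smooth_X1 smooth_N)

lemma smooth_nn: "smooth_on U nn"
  unfolding nn_def by (intro smooth_gform smooth_covd smooth_H smooth_N)

lemma smooth_rest: "smooth_on U rest"
  unfolding rest_def
  by (intro smooth_on_diff smooth_on_power smooth_gform smooth_covd smooth_curv smooth_X1 smooth_H smooth_N open_U)

lemma smooth_E: "smooth_on U (\<lambda>z. gform g (F z) (X1 z) (X1 z))"
  by (intro smooth_gform smooth_X1)

lemma smooth_lam: "smooth_on U lam"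
  unfolding lam_def gram_def
  by (intro smooth_on_diff smooth_on_power smooth_on_mult smooth_gform smooth_X1 smooth_H open_U)

lemma smooth_Phi: "smooth_on U Phi"
  unfolding Phi_def
  by (intro smooth_on_divide smooth_on_add smooth_on_mult smooth_L smooth_nn smooth_rest smooth_lam open_U
      smooth_on_vec_nth smooth_on_id) (use lam_pos in force)

lemma smooth_kap: "smooth_on U kap"
  unfolding kap_def
  by (intro smooth_on_divide smooth_L smooth_E open_U) (use X1_pos in force)

text \<open>Orthogonality to the second partial derivative says that the second coordinate times
  this product is zero. Off the edge one divides, on the edge one differentiates that identity
  across it.\<close>

lemma normal_H:
  assumes "z \<in> U"
  shows "gform g (F z) (H z) (N z) = 0"
proof -
  let ?q = "\<lambda>z. gform g (F z) (H z) (N z)"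
  have s: "smooth_on U ?q" by (intro smooth_gform smooth_H smooth_N)
  have 0: "z $ 2 * ?q z = 0" if "z \<in> U" for z
    using normal[OF that, of "axis 2 1"] unfolding DF2[OF that] gform_scaleR_left .
  show ?thesis
  proof (cases "z $ 2 = 0")
    case True
    have "DD (axis 2 1) (\<lambda>z. z $ 2 * ?q z) z = DD (axis 2 1) (\<lambda>z. 0) z"
      by (rule DD_cong[OF open_U assms 0])
    then show ?thesis
      unfolding DD_mult_fun[OF vec_nth_diff smooth_on_differentiable[OF s assms]] DD_vec_nth
      using True by simp
  qed (use 0[OF assms] in simp)
qed

text \<open>Differentiating the second coordinate times \<open>H\<close> leaves, besides the
  expected multiple, a copy of \<open>H\<close> itself, which is tangential by
  \<open>normal_H\<close>. Hence each normal component involving the second direction gains one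
  factor of the second coordinate: one in the diagonal product, two in the squared mixed term, two
  in the curvature term.\<close>

lemma gauss_num_edge:
  assumes "z \<in> U"
  shows "gauss_num g F (N z) (axis 1 1) (axis 2 1) z = z $ 2 * (L z * nn z + z $ 2 * rest z)"
proof -
  let ?b = "axis 2 1 :: real^2"
  have Hd: "H differentiable (at z)" by (rule smooth_on_differentiable[OF smooth_H assms])
  have D: "DD v (DD ?b F) z = z $ 2 *\<^sub>R DD v H z + v $ 2 *\<^sub>R H z" for v
  proof -
    have "DD v (DD ?b F) z = DD v (\<lambda>z. z $ 2 *\<^sub>R H z) z"
      by (rule DD_cong[OF open_U assms DF2])
    then show ?thesis unfolding DD_scaleR_fun[OF vec_nth_diff Hd] DD_vec_nth .
  qed
  have c: "covd g F v (DD ?b F) z = z $ 2 *\<^sub>R covd g F v H z + v $ 2 *\<^sub>R H z" for v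
    unfolding covd_def D DF2[OF assms] christ_linear by (simp add: algebra_simps)
  have r: "curv g (F z) (X1 z) (z $ 2 *\<^sub>R H z) (z $ 2 *\<^sub>R H z) = (z $ 2 * z $ 2) *\<^sub>R curv g (F z) (X1 z) (H z) (H z)"
    using curv_linear_middle[OF F_in[OF assms], of "X1 z" "z $ 2" "H z" 0 0 "z $ 2 *\<^sub>R H z"]
      curv_linear_right[OF F_in[OF assms], of "X1 z" "H z" "z $ 2" "H z" 0 0] by simp
  have v: "(axis 1 1 :: real^2) $ 2 = 0" "(axis 2 1 :: real^2) $ 2 = 1" by (simp_all add: axis_def)
  show ?thesis
    unfolding gauss_num_def c DF2[OF assms] r v gform_linear normal_H[OF assms] rest_def L_def[symmetric] nn_def
    by (simp add: power2_eq_square algebra_simps)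
qed

lemma gram_edge:
  assumes "z \<in> U"
  shows "gram g (F z) (X1 z) (DD (axis 2 1) F z) = (z $ 2)\<^sup>2 * lam z"
  unfolding DF2[OF assms] gram_def gform_linear lam_def by (simp add: power2_eq_square algebra_simps)

lemma regular_iff:
  assumes "z \<in> U"
  shows "inj (\<lambda>v. DD v F z) \<longleftrightarrow> z $ 2 \<noteq> 0"
proof
  assume i: "inj (\<lambda>v. DD v F z)"
  show "z $ 2 \<noteq> 0"
  proof
    assume "z $ 2 = 0"
    then have "DD (axis 2 1) F z = DD 0 F z"
      using DF2[OF assms] DD_zero[OF F_diff[OF assms]] by simp
    then have "axis 2 1 = (0 :: real^2)" by (rule injD[OF i])
    then show False by (simp add: axis_eq_0_iff)
  qed
next
  assume z: "z $ 2 \<noteq> 0"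
  have l: "linear (\<lambda>v. DD v F z)" by (rule linear_frechet_derivative[OF F_diff[OF assms]])
  show "inj (\<lambda>v. DD v F z)"
  proof (rule linear_injective_0[OF l, THEN iffD2], intro allI impI)
    fix v assume v: "DD v F z = 0"
    have "DD v F z = v $ 1 *\<^sub>R X1 z + (v $ 2 * z $ 2) *\<^sub>R H z"
      using DD_direction_linear[OF F_diff[OF assms], of "v $ 1" "axis 1 1" "v $ 2" "axis 2 1"]
      unfolding axis_expand_2[symmetric] DF2[OF assms] by simp
    then have "v $ 1 = 0 \<and> v $ 2 * z $ 2 = 0" using independent[OF assms] v by metis
    then show "v = 0" using z by (simp add: vec_eq_iff forall_2)
  qed
qed

end

text \<open>On the edge the assumption is the nonvanishing of the cuspidal curvature: there
  \<open>H\<close> and twice its derivative are the second and third derivatives of \<open>F\<close>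
  across the edge. It sits in a second locale because its verification for a cusp uses
  \<open>normal_H\<close>.\<close>

locale cuspidal_rep = cuspidal_frame +
  assumes edge: "z \<in> U \<Longrightarrow> z $ 2 = 0 \<Longrightarrow> gform g (F z) (DD (axis 2 1) H z) (N z) \<noteq> 0"
begin

text \<open>On the edge \<open>F\<close> is stationary in the second direction, so the Christoffel
  term of \<open>covd\<close> drops and the assumption \<open>edge\<close> applies.\<close>

lemma nn_edge: "z \<in> U \<Longrightarrow> z $ 2 = 0 \<Longrightarrow> nn z \<noteq> 0"
proof -
  assume z: "z \<in> U" "z $ 2 = 0"
  have "christ g (F z) 0 w = 0" for w using christ_scaleR_left[of g "F z" 0 0 w] by simp
  then show "nn z \<noteq> 0"
    using edge[OF z] unfolding nn_def covd_def DF2[OF z(1)] z(2) by simp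
qed

lemma Phi_edge_zero:
  assumes "z \<in> U" "z $ 2 = 0"
  shows "Phi z = 0 \<longleftrightarrow> kap z = 0"
  using nn_edge[OF assms] lam_pos[OF assms(1)] X1_pos[OF assms(1)] assms(2) by (simp add: Phi_def kap_def)

text \<open>Along the edge \<open>Phi\<close> is \<open>kap\<close> times a nonvanishing factor; at
  a zero of \<open>kap\<close> the derivative of that factor does not contribute.\<close>

lemma DD_Phi_edge_zero:
  assumes z: "z \<in> U" "z $ 2 = 0" "kap z = 0"
  shows "DD (axis 1 1) Phi z = 0 \<longleftrightarrow> DD (axis 1 1) kap z = 0"
proof -
  let ?a = "axis 1 1 :: real^2"
  \<comment> \<open>The nonvanishing factor, extended smoothly off the edge so that the product rule
    applies; the error is a multiple of the second coordinate and has no derivative along the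
    edge.\<close>
  define M where "M z = gform g (F z) (X1 z) (X1 z) * nn z / lam z" for z
  have sM: "smooth_on U M"
    unfolding M_def by (intro smooth_on_divide smooth_on_mult smooth_E smooth_nn smooth_lam open_U) (use lam_pos in force)
  have sR: "smooth_on U (\<lambda>z. rest z / lam z)"
    by (intro smooth_on_divide smooth_rest smooth_lam open_U) (use lam_pos in force)
  have d: "kap differentiable (at z)" "M differentiable (at z)" "(\<lambda>z. rest z / lam z) differentiable (at z)"
    "(\<lambda>z. kap z * M z) differentiable (at z)" "(\<lambda>z. z $ 2 * (rest z / lam z)) differentiable (at z)"
    by (rule smooth_on_differentiable[OF _ z(1)], intro smooth_kap sM sR smooth_on_mult open_U smooth_on_vec_nth smooth_on_id)+
  have e: "Phi y = kap y * M y + y $ 2 * (rest y / lam y)" if "y \<in> U" for y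
    using X1_pos[OF that] lam_pos[OF that] by (simp add: Phi_def kap_def M_def field_simps)
  have "DD ?a Phi z = DD ?a (\<lambda>y. kap y * M y + y $ 2 * (rest y / lam y)) z"
    by (rule DD_cong[OF open_U z(1) e])
  also have "\<dots> = kap z * DD ?a M z + DD ?a kap z * M z
      + (z $ 2 * DD ?a (\<lambda>z. rest z / lam z) z + ?a $ 2 * (rest z / lam z))"
    unfolding DD_add[OF d(4,5)] DD_mult_fun[OF d(1,2)] DD_mult_fun[OF vec_nth_diff d(3)] DD_vec_nth ..
  also have "\<dots> = DD ?a kap z * M z"
    using z by (simp add: axis_def)
  finally show ?thesis
    using nn_edge[OF z(1,2)] lam_pos[OF z(1)] X1_pos[OF z(1)] by (simp add: M_def)
qed

text \<open>The tangential part of the acceleration of a curve in the singular set drops out.\<close>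

lemma normal_acceleration:
  fixes \<sigma> :: "real \<Rightarrow> real^2"
  assumes "open T" "smooth_on T \<sigma>" "\<And>t. t \<in> T \<Longrightarrow> \<sigma> t \<in> U" "t \<in> T" "\<And>t. t \<in> T \<Longrightarrow> \<sigma> t $ 2 = 0"
  shows "gform g (F (\<sigma> t)) (covd g (\<lambda>t. F (\<sigma> t)) 1 (DD 1 (\<lambda>t. F (\<sigma> t))) t) (N (\<sigma> t)) =
      (DD 1 \<sigma> t $ 1)\<^sup>2 * L (\<sigma> t)"
    and "DD 1 (\<lambda>t. F (\<sigma> t)) t = DD 1 \<sigma> t $ 1 *\<^sub>R X1 (\<sigma> t)"
proof -
  note \<sigma>t = assms(3)[OF assms(4)]
  have D: "DD 1 (\<lambda>t. F (\<sigma> t)) t = DD (DD 1 \<sigma> t) F (\<sigma> t)" if "t \<in> T" for t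
    by (rule DD_compose[OF smooth_on_differentiable[OF assms(2) that] F_diff[OF assms(3)[OF that]]])
  have \<sigma>2: "DD 1 \<sigma> t = DD 1 \<sigma> t $ 1 *\<^sub>R axis 1 1 + 0 *\<^sub>R axis 2 1"
  proof -
    have "DD 1 \<sigma> t $ 2 = DD 1 (\<lambda>t. \<sigma> t $ 2) t"
      by (rule DD_bounded_linear[symmetric, OF bounded_linear_vec_nth smooth_on_differentiable[OF assms(2,4)]])
    also have "\<dots> = DD 1 (\<lambda>t. 0) t" by (rule DD_cong[OF assms(1,4,5)])
    finally show ?thesis using axis_expand_2[of "DD 1 \<sigma> t"] by simp
  qed
  show "DD 1 (\<lambda>t. F (\<sigma> t)) t = DD 1 \<sigma> t $ 1 *\<^sub>R X1 (\<sigma> t)"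
    unfolding D[OF assms(4)]
    using DD_direction_linear[OF F_diff[OF \<sigma>t], of "DD 1 \<sigma> t $ 1" "axis 1 1" 0 "axis 2 1", folded \<sigma>2] by simp
  have "DD 1 (DD 1 (\<lambda>t. F (\<sigma> t))) t = DD 1 (\<lambda>t. DD (DD 1 \<sigma> t) F (\<sigma> t)) t"
    by (rule DD_cong[OF assms(1,4) D])
  then have "covd g (\<lambda>t. F (\<sigma> t)) 1 (DD 1 (\<lambda>t. F (\<sigma> t))) t = covd g (\<lambda>t. F (\<sigma> t)) 1 (\<lambda>t. DD (DD 1 \<sigma> t) F (\<sigma> t)) t"
    by (simp only: covd_def D[OF assms(4)])
  also have "\<dots> = covd g F (DD 1 \<sigma> t) (DD (DD 1 \<sigma> t) F) (\<sigma> t) + DD (DD 1 (DD 1 \<sigma>) t) F (\<sigma> t)"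
    by (rule covd_compose[OF assms(1-3) smooth_on_DD[OF assms(1,2)] assms(4)])
  also have "covd g F (DD 1 \<sigma> t) (DD (DD 1 \<sigma> t) F) (\<sigma> t) = (DD 1 \<sigma> t $ 1)\<^sup>2 *\<^sub>R covd g F (axis 1 1) X1 (\<sigma> t)"
    using covd_linear_left[OF \<sigma>t, of "DD 1 \<sigma> t $ 1" "axis 1 1" 0 "axis 2 1" "DD 1 \<sigma> t", folded \<sigma>2]
      covd_linear_right[OF \<sigma>t, of "axis 1 1" "DD 1 \<sigma> t $ 1" "axis 1 1" 0 "axis 2 1", folded \<sigma>2]
    by (simp add: power2_eq_square)
  finally show "gform g (F (\<sigma> t)) (covd g (\<lambda>t. F (\<sigma> t)) 1 (DD 1 (\<lambda>t. F (\<sigma> t))) t) (N (\<sigma> t)) =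
      (DD 1 \<sigma> t $ 1)\<^sup>2 * L (\<sigma> t)"
    by (simp add: gform_linear normal[OF \<sigma>t] L_def)
qed

end

section \<open>The cuspidal normal form in charts\<close>

definition cusp :: "real^2 \<Rightarrow> real^3" where
  "cusp z = vector [z $ 1, (z $ 2)\<^sup>2, (z $ 2) ^ 3]"

lemma smooth_cusp: "open S \<Longrightarrow> smooth_on S cusp"
proof (rule smooth_on_vec)
  fix i :: 3
  assume S: "open S"
  have "smooth_on S (\<lambda>z. cusp z $ 1)" "smooth_on S (\<lambda>z. cusp z $ 2)" "smooth_on S (\<lambda>z. cusp z $ 3)"
    unfolding cusp_def vector_3 by (intro smooth_on_power smooth_on_vec_nth smooth_on_id S)+
  then show "smooth_on S (\<lambda>z. cusp z $ i)"
    using exhaust_3[of i] by auto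
qed

text \<open>Grouped so that the factor \<open>z $ 2\<close> of the second column is visible; the
  vector it multiplies becomes \<open>H\<close> after pushing forward.\<close>

lemma DD_cusp: "DD v cusp z = v $ 1 *\<^sub>R axis 1 1 + (v $ 2 * z $ 2) *\<^sub>R (2 *\<^sub>R axis 2 1 + (3 * z $ 2) *\<^sub>R axis 3 1)"
proof (rule vec_eq_iff[THEN iffD2], rule allI)
  fix i :: 3
  have "DD v cusp z $ i = DD v (\<lambda>z. cusp z $ i) z"
    by (rule DD_bounded_linear[OF bounded_linear_vec_nth, symmetric])
      (rule smooth_on_differentiable[OF smooth_cusp[OF open_UNIV]], simp)
  also have "\<dots> = (v $ 1 *\<^sub>R axis 1 1 + (v $ 2 * z $ 2) *\<^sub>R (2 *\<^sub>R axis 2 1 + (3 * z $ 2) *\<^sub>R axis 3 1) :: real^3) $ i"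
  proof -
    have 1: "DD v (\<lambda>z::real^2. z $ 1) z = v $ 1" by (rule DD_vec_nth)
    have 2: "DD v (\<lambda>z::real^2. (z $ 2)\<^sup>2) z = 2 * z $ 2 * v $ 2"
      by (rule DD_eqI) (auto intro!: derivative_eq_intros bounded_linear.has_derivative[OF bounded_linear_vec_nth])
    have 3: "DD v (\<lambda>z::real^2. (z $ 2) ^ 3) z = 3 * (z $ 2)\<^sup>2 * v $ 2"
      by (rule DD_eqI) (auto intro!: derivative_eq_intros bounded_linear.has_derivative[OF bounded_linear_vec_nth])
    show ?thesis
      using exhaust_3[of i] 1 2 3
      by (auto simp: cusp_def vector_3 axis_def power2_eq_square)
  qed
  finally show "DD v cusp z $ i = (v $ 1 *\<^sub>R axis 1 1 + (v $ 2 * z $ 2) *\<^sub>R (2 *\<^sub>R axis 2 1 + (3 * z $ 2) *\<^sub>R axis 3 1)) $ i" .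
qed

text \<open>The chart \<open>d0\<close> of the normal form need not lie in \<open>B\<close> and then
  carries no metric components; the atlas chart \<open>d\<close> around \<open>f p\<close> supplies
  them.\<close>

locale edge_charts = manifold_map A B g f
  for A :: "('p::{t2_space,second_countable_topology}, 2) chart set"
    and B :: "('q::{t2_space,second_countable_topology}, 3) chart set"
    and g :: "('q, 3) metric_family" and f :: "'p \<Rightarrow> 'q" +
  fixes p :: 'p and V :: "'p set" and \<nu> :: "'p \<Rightarrow> ('q, 3) chart \<Rightarrow> real^3"
    and c0 :: "('p, 2) chart" and d0 d :: "('q, 3) chart"
  assumes c0: "coords_centered_at A p c0" and d0: "coords_centered_at B (f p) d0"
    and f_cdom: "f ` cdom c0 \<subseteq> cdom d0"
    and f_cusp: "x \<in> cdom c0 \<Longrightarrow> coord d0 (f x) = vector [coord c0 x $ 1, (coord c0 x $ 2)\<^sup>2, (coord c0 x $ 2) ^ 3]"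
    and V: "open V" "p \<in> V" and \<nu>: "unit_normal_on A B g f V \<nu>"
    and d: "d \<in> B" "f p \<in> cdom d"
begin

definition D where "D = cdom c0 \<inter> (V \<inter> f -` cdom d)"
definition U where "U = coord c0 ` D"
definition F where "F = local_rep c0 d f"
definition \<tau> where "\<tau> = transition d0 d"
text \<open>The second column of the differential of the cusp divided by \<open>z $ 2\<close>,
  carried to the chart \<open>d\<close> by the differential of \<tau>.\<close>

definition H where "H z = DD (2 *\<^sub>R axis 2 1 + (3 * z $ 2) *\<^sub>R axis 3 1) \<tau> (cusp z)"
definition N where "N z = \<nu> (cinv c0 z) d"

lemma adm: "admissible A c0" "admissible B d0" "admissible B d"
  using admissible_centered c0 d0 admissible_atlas[OF B d(1)] by blast+

lemma ch: "is_chart c0" "is_chart d0" "is_chart d"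
  using adm charts by blast+

lemma p_D: "p \<in> D"
  using c0 V d unfolding D_def coords_centered_at_def by blast

lemma open_D: "open D"
  unfolding D_def by (intro open_Int open_cdom adm V open_f_vimage d)

lemma D_subset: "D \<subseteq> cdom c0" "D \<subseteq> V" "f ` D \<subseteq> cdom d"
  unfolding D_def by auto

lemma open_U: "open U"
  unfolding U_def D_def by (intro open_coord_image ch open_Int V open_f_vimage open_cdom d)

lemma U_E:
  assumes "z \<in> U"
  obtains x where "x \<in> cdom c0" "x \<in> V" "f x \<in> cdom d" "f x \<in> cdom d0" "z = coord c0 x" "cinv c0 z = x"
proof -
  obtain x where "x \<in> D" "z = coord c0 x" using assms unfolding U_def by blast
  then show thesis
    using that[of x] f_cdom cinv_coord[OF ch(1)] unfolding D_def by blast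
qed

lemma cusp_in: "z \<in> U \<Longrightarrow> cusp z \<in> coord d0 ` (cdom d0 \<inter> cdom d)"
proof -
  assume "z \<in> U"
  then obtain x where x: "x \<in> cdom c0" "f x \<in> cdom d" "f x \<in> cdom d0" "z = coord c0 x" by (rule U_E)
  have "cusp z = coord d0 (f x)" unfolding cusp_def x(4) f_cusp[OF x(1)] ..
  then show ?thesis using x by blast
qed

lemma F_cusp: "z \<in> U \<Longrightarrow> F z = \<tau> (cusp z)"
proof -
  assume "z \<in> U"
  then obtain x where x: "x \<in> cdom c0" "f x \<in> cdom d" "f x \<in> cdom d0" "z = coord c0 x" by (rule U_E)
  have "cusp z = coord d0 (f x)" unfolding cusp_def x(4) f_cusp[OF x(1)] ..
  then show ?thesis
    unfolding F_def \<tau>_def x(4) by (simp add: local_rep_coord ch x transition_coord)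
qed

lemma smooth_F: "smooth_on U F"
  unfolding F_def by (rule smooth_on_subset[OF smooth_local_rep[OF adm(1) d(1)]]) (auto simp: U_def D_def)

lemma smooth_\<tau>: "smooth_on (coord d0 ` (cdom d0 \<inter> cdom d)) \<tau>"
  unfolding \<tau>_def by (rule smooth_transition_admissible[OF B adm(2,3)])

lemma open_\<tau>: "open (coord d0 ` (cdom d0 \<inter> cdom d))"
  by (intro open_coord_image ch open_cdom d)

lemma \<tau>_diff: "z \<in> U \<Longrightarrow> \<tau> differentiable (at (cusp z))"
  by (rule smooth_on_differentiable[OF smooth_\<tau> cusp_in])

lemma \<tau>_inj:
  assumes "z \<in> U" "DD u \<tau> (cusp z) = 0"
  shows "u = 0"
proof -
  obtain y where y: "y \<in> cdom d0" "y \<in> cdom d" "cusp z = coord d0 y" using cusp_in[OF assms(1)] by blast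
  have i: "DD (DD v \<tau> (cusp z)) (transition d d0) (coord d y) = v" for v
    unfolding \<tau>_def y(3) by (rule transition_inverse[OF B adm(2,3) y(1,2)])
  have "DD 0 \<tau> (cusp z) = 0" by (rule DD_zero[OF \<tau>_diff[OF assms(1)]])
  then show ?thesis using i[of u] i[of 0] assms(2) by simp
qed

lemma DF:
  assumes "z \<in> U"
  shows "DD v F z = v $ 1 *\<^sub>R DD (axis 1 1) \<tau> (cusp z) + (v $ 2 * z $ 2) *\<^sub>R H z"
proof -
  have "DD v F z = DD v (\<lambda>z. \<tau> (cusp z)) z"
    by (rule DD_cong[OF open_U assms F_cusp])
  also have "\<dots> = DD (DD v cusp z) \<tau> (cusp z)"
    by (rule DD_compose[where F = cusp and G = \<tau>, OF _ \<tau>_diff[OF assms]]) (rule smooth_on_differentiable[OF smooth_cusp[OF open_U] assms])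
  finally show ?thesis
    unfolding DD_cusp DD_direction_linear[OF \<tau>_diff[OF assms], of "v $ 1" "axis 1 1"] H_def .
qed

lemma DF1: "z \<in> U \<Longrightarrow> DD (axis 1 1) F z = DD (axis 1 1) \<tau> (cusp z)"
  by (simp add: DF axis_def)

text \<open>\<open>unit_normal_on\<close> is phrased with charts of \<open>A\<close>; a chart
  \<open>a\<close> around \<open>x\<close> transfers orthogonality to \<open>c0\<close>, since the
  differentials differ by that of a transition map.\<close>

lemma normal_x:
  assumes "x \<in> D"
  shows "gform (g d) (coord d (f x)) (\<nu> x d) (\<nu> x d) = 1"
    and "gform (g d) (coord d (f x)) (DD v F (coord c0 x)) (\<nu> x d) = 0"
proof -
  interpret gd: coord_metric "g d" "coord d ` cdom d" by (rule coord_metric_g[OF d(1)])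
  have x: "x \<in> cdom c0" "x \<in> V" "f x \<in> cdom d" using assms unfolding D_def by auto
  obtain a where a: "a \<in> A" "x \<in> cdom a" using atlas_cover[OF A] by blast
  note ad = admissible_atlas[OF A a(1)]
  have n: "inner_at g d (f x) (\<nu> x d) (\<nu> x d) = 1"
    "inner_at g d (f x) (\<nu> x d) (differential a d f x *v u) = 0" for u
    using \<nu> x a d unfolding unit_normal_on_def by blast+
  show "gform (g d) (coord d (f x)) (\<nu> x d) (\<nu> x d) = 1"
    using n(1) unfolding inner_at_def gform_def .
  have "gform (g d) (coord d (f x)) (\<nu> x d) (DD v F (coord c0 x)) = 0"
    using n(2)[of "DD v (transition c0 a) (coord c0 x)"]
    unfolding inner_at_def gform_def differential_mult[OF ad d(1) a(2) x(3)] F_def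
      DD_local_rep_source[OF adm(1) ad d(1) x(1) a(2) x(3)] .
  then show "gform (g d) (coord d (f x)) (DD v F (coord c0 x)) (\<nu> x d) = 0"
    using gd.gform_sym[of "coord d (f x)"] x(3) by auto
qed

lemma F_coord: "x \<in> D \<Longrightarrow> F (coord c0 x) = coord d (f x)"
  unfolding F_def D_def by (simp add: local_rep_coord ch)

lemma N_coord: "x \<in> D \<Longrightarrow> N (coord c0 x) = \<nu> x d"
  unfolding N_def D_def by (simp add: cinv_coord ch)

lemma smooth_N: "smooth_on U N"
proof (rule smooth_on_local)
  fix z assume "z \<in> U"
  then obtain x where x: "x \<in> D" "z = coord c0 x" unfolding U_def by blast
  obtain a where a: "a \<in> A" "x \<in> cdom a" using atlas_cover[OF A] by blast
  note ad = admissible_atlas[OF A a(1)]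
  let ?T = "coord c0 ` (cdom c0 \<inter> (D \<inter> cdom a))"
  have T: "open ?T" by (intro open_coord_image ch open_Int open_D open_cdom(2)[OF ad])
  have 1: "smooth_on ?T (transition c0 a)"
    by (rule smooth_on_subset[OF smooth_transition_admissible[OF A adm(1) ad]]) blast
  have 2: "smooth_on (coord a ` (cdom a \<inter> V \<inter> f -` cdom d)) (\<lambda>z. \<nu> (cinv a z) d)"
    using \<nu> a(1) d(1) unfolding unit_normal_on_def smooth_field_along_def by blast
  have "smooth_on ?T (\<lambda>z. \<nu> (cinv a (transition c0 a z)) d)"
    by (rule smooth_on_compose[OF T 1 2]) (auto simp: transition_coord ch D_def)
  then have "smooth_on ?T N"
    by (rule smooth_on_cong[OF T, rotated])
      (auto simp: transition_coord ch N_def cinv_coord charts(4)[OF a(1)])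
  then show "\<exists>T. open T \<and> z \<in> T \<and> smooth_on T N"
    using T x a D_subset(1) by blast
qed

sublocale cuspidal_frame "g d" "coord d ` cdom d" F U H N
proof -
  interpret gd: coord_metric "g d" "coord d ` cdom d" by (rule coord_metric_g[OF d(1)])
  show "cuspidal_frame (g d) (coord d ` cdom d) F U H N"
  proof unfold_locales
    show "open U" by (rule open_U)
    show "smooth_on U F" by (rule smooth_F)
    show "smooth_on U N" by (rule smooth_N)
    show "smooth_on U H"
    proof -
      have "smooth_on U (\<lambda>z. DD e \<tau> (cusp z))" for e
        by (rule smooth_on_compose[OF open_U smooth_cusp[OF open_U] smooth_on_DD[OF open_\<tau> smooth_\<tau>] cusp_in])
      then have "smooth_on U (\<lambda>z. 2 *\<^sub>R DD (axis 2 1) \<tau> (cusp z) + (3 * z $ 2) *\<^sub>R DD (axis 3 1) \<tau> (cusp z))"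
        by (intro smooth_on_add smooth_on_scaleR smooth_on_mult smooth_on_const smooth_on_vec_nth smooth_on_id open_U)
      then show ?thesis
        by (rule smooth_on_cong[OF open_U, rotated])
          (simp only: H_def DD_direction_linear[OF \<tau>_diff])
    qed
    fix z assume z: "z \<in> U"
    then obtain x where x: "x \<in> D" "z = coord c0 x" unfolding U_def by blast
    show "F z \<in> coord d ` cdom d" unfolding x(2) F_coord[OF x(1)] using x(1) by (auto simp: D_def)
    show "DD (axis 2 1) F z = z $ 2 *\<^sub>R H z" using DF[OF z, of "axis 2 1"] by (simp add: axis_def)
    show "gform (g d) (F z) (N z) (N z) = 1"
      unfolding x(2) F_coord[OF x(1)] N_coord[OF x(1)] by (rule normal_x(1)[OF x(1)])
    show "gform (g d) (F z) (DD v F z) (N z) = 0" for v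
      unfolding x(2) F_coord[OF x(1)] N_coord[OF x(1)] by (rule normal_x(2)[OF x(1)])
    fix a b :: real
    assume "a *\<^sub>R DD (axis 1 1) F z + b *\<^sub>R H z = 0"
    then have "DD (a *\<^sub>R axis 1 1 + b *\<^sub>R (2 *\<^sub>R axis 2 1 + (3 * z $ 2) *\<^sub>R axis 3 1)) \<tau> (cusp z) = 0"
      unfolding DF1[OF z] H_def DD_direction_linear[OF \<tau>_diff[OF z], of a "axis 1 1"] .
    then have "a *\<^sub>R axis 1 1 + b *\<^sub>R (2 *\<^sub>R axis 2 1 + (3 * z $ 2) *\<^sub>R axis 3 1) = (0 :: real^3)"
      by (rule \<tau>_inj[OF z])
    then show "a = 0 \<and> b = 0"
      by (simp add: vec_eq_iff forall_3 axis_def)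
  qed
qed

text \<open>On the edge the first partial derivative, \<open>H\<close> and the derivative of
  \<open>H\<close> are the images under the invertible differential of \<tau> of multiples of the
  three coordinate vectors. The first two are orthogonal to \<open>N\<close>; were the third so too,
  the unit vector \<open>N\<close> would be orthogonal to the whole space.\<close>

sublocale cuspidal_rep "g d" "coord d ` cdom d" F U H N
proof unfold_locales
  fix z assume z: "z \<in> U" "z $ 2 = 0"
  let ?w = "\<lambda>z::real^2. 2 *\<^sub>R axis 2 1 + (3 * z $ 2) *\<^sub>R axis 3 1 :: real^3"
  have sw: "smooth_on U ?w"
    by (intro smooth_on_add smooth_on_scaleR smooth_on_mult smooth_on_const smooth_on_vec_nth smooth_on_id open_U)
  have "(?w has_derivative (\<lambda>v. (3 * v $ 2) *\<^sub>R axis 3 1)) (at z)"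
    by (auto intro!: derivative_eq_intros bounded_linear.has_derivative[OF bounded_linear_vec_nth])
  then have "DD (axis 2 1) ?w z = (3 * (axis 2 1 :: real^2) $ 2) *\<^sub>R axis 3 1"
    by (rule DD_eqI)
  moreover have "(axis 2 1 :: real^2) $ 2 = 1" by (simp add: axis_def)
  ultimately have Dw: "DD (axis 2 1) ?w z = 3 *\<^sub>R axis 3 1" by simp
  \<comment> \<open>The cusp map is stationary across the edge, so the second derivative of \<tau>
    does not enter the derivative of \<open>H\<close>.\<close>
  have Dc: "DD (axis 2 1) cusp z = 0"
    unfolding DD_cusp using z(2) by (simp add: axis_def)
  have "DD (axis 2 1) H z = DD (DD (axis 2 1) cusp z) (DD (?w z) \<tau>) (cusp z) + DD (DD (axis 2 1) ?w z) \<tau> (cusp z)"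
    unfolding H_def
    by (rule DD_DD_field[OF open_\<tau> smooth_\<tau> open_U smooth_cusp[OF open_U] cusp_in sw z(1)])
  also have "DD (DD (axis 2 1) cusp z) (DD (?w z) \<tau>) (cusp z) = 0"
    unfolding Dc by (rule DD_zero) (rule smooth_on_differentiable[OF smooth_on_DD[OF open_\<tau> smooth_\<tau>] cusp_in[OF z(1)]])
  finally have DH: "DD (axis 2 1) H z = DD (3 *\<^sub>R axis 3 1) \<tau> (cusp z)" unfolding Dw by simp
  note lin = DD_direction_linear[OF \<tau>_diff[OF z(1)]] DD_scaleR[OF \<tau>_diff[OF z(1)]]
  show "gform (g d) (F z) (DD (axis 2 1) H z) (N z) \<noteq> 0"
  proof
    assume "gform (g d) (F z) (DD (axis 2 1) H z) (N z) = 0"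
    then have 3: "gform (g d) (F z) (DD (axis 3 1) \<tau> (cusp z)) (N z) = 0"
      unfolding DH lin gform_linear by simp
    have 1: "gform (g d) (F z) (DD (axis 1 1) \<tau> (cusp z)) (N z) = 0"
      using normal[OF z(1), of "axis 1 1"] unfolding DF1[OF z(1)] .
    have 2: "gform (g d) (F z) (DD (axis 2 1) \<tau> (cusp z)) (N z) = 0"
      using normal_H[OF z(1)] unfolding H_def lin gform_linear by (simp add: z(2))
    have l: "linear (\<lambda>u. DD u \<tau> (cusp z))" by (rule linear_frechet_derivative[OF \<tau>_diff[OF z(1)]])
    have "inj (\<lambda>u. DD u \<tau> (cusp z))"
      by (rule linear_injective_0[OF l, THEN iffD2]) (use \<tau>_inj[OF z(1)] in blast)
    then have "surj (\<lambda>u. DD u \<tau> (cusp z))" using linear_injective_imp_surjective[OF l] by simp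
    then obtain u where u: "N z = DD u \<tau> (cusp z)" by blast
    have u3: "1 *\<^sub>R (u $ 1 *\<^sub>R axis 1 1 + u $ 2 *\<^sub>R axis 2 1) + u $ 3 *\<^sub>R axis 3 1 = u"
      by (simp add: vec_eq_iff forall_3 axis_def)
    have "DD (1 *\<^sub>R (u $ 1 *\<^sub>R axis 1 1 + u $ 2 *\<^sub>R axis 2 1) + u $ 3 *\<^sub>R axis 3 1) \<tau> (cusp z) =
        1 *\<^sub>R (u $ 1 *\<^sub>R DD (axis 1 1) \<tau> (cusp z) + u $ 2 *\<^sub>R DD (axis 2 1) \<tau> (cusp z)) + u $ 3 *\<^sub>R DD (axis 3 1) \<tau> (cusp z)"
      by (simp only: lin)
    then have "DD u \<tau> (cusp z) = u $ 1 *\<^sub>R DD (axis 1 1) \<tau> (cusp z) + u $ 2 *\<^sub>R DD (axis 2 1) \<tau> (cusp z) + u $ 3 *\<^sub>R DD (axis 3 1) \<tau> (cusp z)"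
      unfolding u3 by simp
    then have "gform (g d) (F z) (N z) (N z) = gform (g d) (F z) (u $ 1 *\<^sub>R DD (axis 1 1) \<tau> (cusp z) + u $ 2 *\<^sub>R DD (axis 2 1) \<tau> (cusp z) + u $ 3 *\<^sub>R DD (axis 3 1) \<tau> (cusp z)) (N z)"
      using u by simp
    also have "\<dots> = 0" unfolding gform_linear 1 2 3 by simp
    finally show False using unit[OF z(1)] by simp
  qed
qed

lemma regular_D:
  assumes "x \<in> D"
  shows "x \<in> regular_points A B f \<longleftrightarrow> coord c0 x $ 2 \<noteq> 0"
proof -
  have x: "x \<in> cdom c0" "f x \<in> cdom d" "coord c0 x \<in> U" using assms unfolding D_def U_def by auto
  show ?thesis
    unfolding regular_points_iff[OF adm(1) d(1) x(1,2)] F_def[symmetric] by (rule regular_iff[OF x(3)])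
qed

text \<open>The Gram determinant carries the square of the second coordinate and the Gauss numerator
  only its first power, so one factor remains in the denominator.\<close>

lemma gauss_curvature_D:
  assumes "x \<in> D" "coord c0 x $ 2 \<noteq> 0"
  shows "gauss_curvature A (pullback_metric B g f) x = Phi (coord c0 x) / coord c0 x $ 2"
proof -
  define R where "R = D \<inter> {x. x \<in> cdom c0 \<and> coord c0 x $ 2 \<noteq> 0}"
  have zU: "coord c0 x \<in> U" using assms unfolding U_def by blast
  have "open (cdom c0 \<inter> coord c0 -` {z. z $ 2 \<noteq> 0})"
    by (rule continuous_open_preimage[OF continuous_coord[OF ch(1)] open_cdom(2)[OF adm(1)]])
      (intro open_Collect_neq continuous_intros)
  moreover have "R = D \<inter> (cdom c0 \<inter> coord c0 -` {z. z $ 2 \<noteq> 0})" unfolding R_def by auto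
  ultimately have oR: "open R" using open_D by (simp only: open_Int)
  have sR: "R \<subseteq> cdom c0 \<inter> f -` cdom d \<inter> regular_points A B f"
    using regular_D unfolding R_def D_def by blast
  have xR: "x \<in> R" using assms D_subset unfolding R_def by blast
  let ?K = "gauss_curvature A (pullback_metric B g f) x"
  let ?z = "coord c0 x"
  have "?K * gram (g d) (coord d (f x)) (DD (axis 1 1) (local_rep c0 d f) ?z) (DD (axis 2 1) (local_rep c0 d f) ?z) =
      gauss_num (g d) (local_rep c0 d f) (\<nu> x d) (axis 1 1) (axis 2 1) ?z"
    by (rule gauss_curvature_local[OF manifold_map_axioms adm(1) d(1) oR sR xR])
      (use normal_x[OF assms(1)] in \<open>simp_all add: F_def\<close>)
  then have "?K * gram (g d) (F ?z) (DD (axis 1 1) F ?z) (DD (axis 2 1) F ?z) = gauss_num (g d) F (N ?z) (axis 1 1) (axis 2 1) ?z"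
    unfolding N_coord[OF assms(1)] F_coord[OF assms(1)] F_def[symmetric] .
  then have "?K * ((?z $ 2)\<^sup>2 * lam ?z) = ?z $ 2 * (L ?z * nn ?z + ?z $ 2 * rest ?z)"
    unfolding gram_edge[OF zU] gauss_num_edge[OF zU] .
  then have "?z $ 2 * (?K * (?z $ 2 * lam ?z)) = ?z $ 2 * (L ?z * nn ?z + ?z $ 2 * rest ?z)"
    by (simp only: power2_eq_square mult_ac)
  then have "?K * (?z $ 2 * lam ?z) = L ?z * nn ?z + ?z $ 2 * rest ?z"
    unfolding mult_left_cancel[OF assms(2)] .
  moreover have "?z $ 2 * lam ?z \<noteq> 0" using assms(2) lam_pos[OF zU] by simp
  ultimately have "?K = (L ?z * nn ?z + ?z $ 2 * rest ?z) / (?z $ 2 * lam ?z)"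
    by (rule nonzero_eq_divide_eq[THEN iffD2, rotated])
  then show ?thesis unfolding Phi_def by (simp add: mult.commute)
qed

end

section \<open>Curves and arclength\<close>

lemma velocity_DD: "\<sigma> differentiable (at t) \<Longrightarrow> velocity \<sigma> t = DD 1 \<sigma> t"
  by (simp add: velocity_def frechet_derivative_eq_vector_derivative)

lemma covariant_acceleration_covd:
  assumes "open T" "smooth_on T \<sigma>" "t \<in> T"
  shows "covariant_acceleration h \<sigma> t = covd h \<sigma> 1 (DD 1 \<sigma>) t"
proof -
  have v: "velocity \<sigma> s = DD 1 \<sigma> s" if "s \<in> T" for s
    by (rule velocity_DD[OF smooth_on_differentiable[OF assms(2) that]])
  have "smooth_on T (velocity \<sigma>)"
    by (rule smooth_on_cong[OF assms(1) v[symmetric] smooth_on_DD[OF assms(1,2)]])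
  then have "velocity (velocity \<sigma>) t = DD 1 (velocity \<sigma>) t"
    by (rule velocity_DD[OF smooth_on_differentiable[OF _ assms(3)]])
  also have "\<dots> = DD 1 (DD 1 \<sigma>) t" by (rule DD_cong[OF assms(1,3) v])
  finally have 2: "velocity (velocity \<sigma>) t = DD 1 (DD 1 \<sigma>) t" .
  show ?thesis unfolding covariant_acceleration_def covd_def christ_def 2 v[OF assms(3)] ..
qed

context manifold_map
begin

definition smooth_curve :: "real set \<Rightarrow> (real \<Rightarrow> 'q) \<Rightarrow> bool" where
  "smooth_curve T \<beta> \<longleftrightarrow> open T \<and> continuous_on T \<beta> \<and> (\<forall>e\<in>B. smooth_on (T \<inter> \<beta> -` cdom e) (coord e \<circ> \<beta>))"

lemma smooth_curve_open:
  assumes "smooth_curve T \<beta>" "e \<in> B"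
  shows "open (T \<inter> \<beta> -` cdom e)"
  by (rule continuous_open_preimage) (use assms open_cdom(1) in \<open>auto simp: smooth_curve_def\<close>)

lemma smooth_curve_smooth:
  "smooth_curve T \<beta> \<Longrightarrow> e \<in> B \<Longrightarrow> smooth_on (T \<inter> \<beta> -` cdom e) (\<lambda>t. coord e (\<beta> t))"
  unfolding smooth_curve_def o_def by blast

lemma smooth_curve_transition:
  assumes "smooth_curve T \<beta>" "d \<in> B" "e \<in> B" "t \<in> T" "\<beta> t \<in> cdom d" "\<beta> t \<in> cdom e"
  shows "DD 1 (\<lambda>t. coord e (\<beta> t)) t = DD (DD 1 (\<lambda>t. coord d (\<beta> t)) t) (transition d e) (coord d (\<beta> t))"
proof -
  let ?T = "(T \<inter> \<beta> -` cdom d) \<inter> (T \<inter> \<beta> -` cdom e)"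
  have T: "open ?T" using smooth_curve_open assms by blast
  have "DD 1 (\<lambda>t. coord e (\<beta> t)) t = DD 1 (\<lambda>t. transition d e (coord d (\<beta> t))) t"
    by (rule DD_cong[OF T]) (use assms in \<open>auto simp: transition_coord charts\<close>)
  also have "\<dots> = DD (DD 1 (\<lambda>t. coord d (\<beta> t)) t) (transition d e) (coord d (\<beta> t))"
    by (rule DD_compose[where F = "\<lambda>t. coord d (\<beta> t)"])
      (use assms smooth_on_differentiable[OF smooth_curve_smooth[OF assms(1,2)]]
        transition_diff[OF B admissible_atlas[OF B assms(2)] admissible_atlas[OF B assms(3)] assms(5,6)] in auto)
  finally show ?thesis .
qed

end

text \<open>The chart in \<open>curve_speed\<close> is picked anew at every parameter, so already
  continuity of the speed rests on its independence of the chart.\<close>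

lemma curve_speed_chart:
  fixes B :: "('q::{t2_space,second_countable_topology}, 3) chart set"
  assumes "manifold_map A B g f" and \<beta>: "manifold_map.smooth_curve B T \<beta>" and d: "d \<in> B" and t: "t \<in> T" "\<beta> t \<in> cdom d"
  shows "curve_speed B g \<beta> t =
    sqrt (gform (g d) (coord d (\<beta> t)) (DD 1 (\<lambda>t. coord d (\<beta> t)) t) (DD 1 (\<lambda>t. coord d (\<beta> t)) t))"
proof -
  interpret manifold_map A B g f by fact
  let ?e = "chart_at B (\<beta> t)"
  note e = chart_at[OF B, of "\<beta> t"]
  have "(\<lambda>t. coord ?e (\<beta> t)) differentiable (at t)"
    by (rule smooth_on_differentiable[OF smooth_curve_smooth[OF \<beta> e(1)]]) (use t e in auto)
  then have "velocity (coord ?e \<circ> \<beta>) t = DD 1 (\<lambda>t. coord ?e (\<beta> t)) t"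
    unfolding o_def by (rule velocity_DD)
  then have "curve_speed B g \<beta> t = sqrt (gform (g ?e) (coord ?e (\<beta> t)) (DD 1 (\<lambda>t. coord ?e (\<beta> t)) t) (DD 1 (\<lambda>t. coord ?e (\<beta> t)) t))"
    unfolding curve_speed_def Let_def inner_at_def gform_def by simp
  also have "\<dots> = sqrt (gform (g d) (coord d (\<beta> t)) (DD 1 (\<lambda>t. coord d (\<beta> t)) t) (DD 1 (\<lambda>t. coord d (\<beta> t)) t))"
    unfolding smooth_curve_transition[OF \<beta> d e(1) t e(2)] gform_transition[OF d e(1) t(2) e(2), symmetric] ..
  finally show ?thesis .
qed

lemma curve_speed_continuous:
  fixes B :: "('q::{t2_space,second_countable_topology}, 3) chart set"
  assumes "manifold_map A B g f" and \<beta>: "manifold_map.smooth_curve B T \<beta>"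
  shows "continuous_on T (curve_speed B g \<beta>)"
proof -
  interpret manifold_map A B g f by fact
  have T: "open T" using \<beta> unfolding smooth_curve_def by blast
  show ?thesis
  proof (intro continuous_at_imp_continuous_on ballI)
    fix t assume t: "t \<in> T"
    obtain d where d: "d \<in> B" "\<beta> t \<in> cdom d" using atlas_cover[OF B] by blast
    let ?T = "T \<inter> \<beta> -` cdom d"
    have oT: "open ?T" by (rule smooth_curve_open[OF \<beta> d(1)])
    interpret coord_metric "g d" "coord d ` cdom d" by (rule coord_metric_g[OF d(1)])
    interpret map_into_metric "g d" "coord d ` cdom d" "\<lambda>t. coord d (\<beta> t)" ?T
      by unfold_locales (use oT smooth_curve_smooth[OF \<beta> d(1)] in auto)
    have s: "smooth_on ?T (DD 1 (\<lambda>t. coord d (\<beta> t)))"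
      by (rule smooth_on_DD[OF oT smooth_curve_smooth[OF \<beta> d(1)]])
    have "continuous_on ?T (\<lambda>t. sqrt (gform (g d) (coord d (\<beta> t)) (DD 1 (\<lambda>t. coord d (\<beta> t)) t) (DD 1 (\<lambda>t. coord d (\<beta> t)) t)))"
      by (intro continuous_on_real_sqrt smooth_on_continuous smooth_gform s)
    then have "continuous_on ?T (curve_speed B g \<beta>)"
      by (rule continuous_on_eq) (use curve_speed_chart[OF assms d(1)] in auto)
    then show "isCont (curve_speed B g \<beta>) t"
      using oT t d(2) by (simp add: continuous_on_eq_continuous_at)
  qed
qed

text \<open>Covariant acceleration and normal vector both transform by the differential of the
  transition map, which is an isometry for the two component matrices.\<close>

lemma normal_acceleration_chart:
  fixes B :: "('q::{t2_space,second_countable_topology}, 3) chart set"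
  assumes "manifold_map A B g f" and \<beta>: "manifold_map.smooth_curve B T \<beta>" and de: "d \<in> B" "e \<in> B"
    and t: "t \<in> T" "\<beta> t \<in> cdom d" "\<beta> t \<in> cdom e"
  shows "inner_at g e (\<beta> t) (covariant_acceleration (g e) (coord e \<circ> \<beta>) t) (transition_jacobian d e (\<beta> t) *v n) =
    gform (g d) (coord d (\<beta> t)) (covd (g d) (\<lambda>t. coord d (\<beta> t)) 1 (DD 1 (\<lambda>t. coord d (\<beta> t))) t) n"
proof -
  interpret manifold_map A B g f by fact
  let ?\<tau> = "transition d e" and ?\<sigma> = "\<lambda>t. coord d (\<beta> t)"
  interpret p: pullback_map "g e" "coord e ` cdom e" ?\<tau> "coord d ` (cdom d \<inter> cdom e)" "g d"
    by (rule pullback_map_transition[OF de])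
  let ?T = "(T \<inter> \<beta> -` cdom d) \<inter> (T \<inter> \<beta> -` cdom e)"
  have oT: "open ?T" using smooth_curve_open[OF \<beta>] de by blast
  have tT: "t \<in> ?T" using t by auto
  have s\<sigma>: "smooth_on ?T ?\<sigma>" by (rule smooth_on_subset[OF smooth_curve_smooth[OF \<beta> de(1)]]) blast
  have se: "smooth_on ?T (coord e \<circ> \<beta>)"
    unfolding o_def by (rule smooth_on_subset[OF smooth_curve_smooth[OF \<beta> de(2)]]) blast
  have eq: "(coord e \<circ> \<beta>) s = ?\<tau> (?\<sigma> s)" if "s \<in> ?T" for s
    using that by (simp add: transition_coord charts de)
  have D1: "DD 1 (coord e \<circ> \<beta>) s = DD (DD 1 ?\<sigma> s) ?\<tau> (?\<sigma> s)" if "s \<in> ?T" for s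
    unfolding o_def by (rule smooth_curve_transition[OF \<beta> de]) (use that in auto)
  have D2: "DD 1 (DD 1 (coord e \<circ> \<beta>)) t = DD 1 (\<lambda>s. DD (DD 1 ?\<sigma> s) ?\<tau> (?\<sigma> s)) t"
    by (rule DD_cong[OF oT tT D1])
  have D1': "DD 1 (coord e \<circ> \<beta>) t = DD 1 (\<lambda>s. ?\<tau> (?\<sigma> s)) t"
    by (rule DD_cong[OF oT tT eq])
  have J: "transition_jacobian d e (\<beta> t) *v n = DD n ?\<tau> (?\<sigma> t)"
    unfolding transition_jacobian_def
    by (intro jacobian_mult transition_diff[OF B] admissible_atlas[OF B] de t)
  have "covariant_acceleration (g e) (coord e \<circ> \<beta>) t = covd (g e) (coord e \<circ> \<beta>) 1 (DD 1 (coord e \<circ> \<beta>)) t"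
    by (rule covariant_acceleration_covd[OF oT se tT])
  also have "\<dots> = covd (g e) (\<lambda>s. ?\<tau> (?\<sigma> s)) 1 (\<lambda>s. DD (DD 1 ?\<sigma> s) ?\<tau> (?\<sigma> s)) t"
    unfolding covd_def D2 D1[OF tT, symmetric] D1'[symmetric] eq[OF tT, symmetric] ..
  finally have "inner_at g e (\<beta> t) (covariant_acceleration (g e) (coord e \<circ> \<beta>) t) (transition_jacobian d e (\<beta> t) *v n) =
      gform (g e) (?\<tau> (?\<sigma> t)) (covd (g e) (\<lambda>s. ?\<tau> (?\<sigma> s)) 1 (\<lambda>s. DD (DD 1 ?\<sigma> s) ?\<tau> (?\<sigma> s)) t) (DD n ?\<tau> (?\<sigma> t))"
    unfolding J inner_at_def gform_def[symmetric] using eq[OF tT] by simp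
  also have "\<dots> = gform (g d) (?\<sigma> t) (covd (g d) ?\<sigma> 1 (DD 1 ?\<sigma>) t) n"
    by (rule p.gform_covd_pullback[OF oT s\<sigma> _ smooth_on_DD[OF oT s\<sigma>] tT]) auto
  finally show ?thesis .
qed

text \<open>Outside a neighbourhood of \<open>0\<close> the speed may vanish, but arclength is still monotone, so
  that its inverse function is determined near \<open>0\<close>.\<close>

lemma arclength_inverse:
  assumes \<epsilon>: "0 < \<epsilon>" and cont: "continuous_on {-\<epsilon><..<\<epsilon>} (curve_speed B g \<beta>)"
    and nonneg: "\<And>t. t \<in> {-\<epsilon><..<\<epsilon>} \<Longrightarrow> curve_speed B g \<beta> t \<ge> 0" and pos: "curve_speed B g \<beta> 0 > 0"
  shows "(inv_into {-\<epsilon><..<\<epsilon>} (arclength B g \<beta>) has_real_derivative inverse (curve_speed B g \<beta> 0)) (at 0)"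
    and "inv_into {-\<epsilon><..<\<epsilon>} (arclength B g \<beta>) 0 = 0"
proof -
  define I where "I = {-\<epsilon><..<\<epsilon>}"
  let ?v = "curve_speed B g \<beta>" and ?s = "arclength B g \<beta>"
  let ?\<phi> = "inv_into I ?s"
  have D: "(?s has_real_derivative ?v t) (at t)" if t: "t \<in> I" for t
  proof -
    have "\<bar>t\<bar> < \<epsilon>" using t unfolding I_def by auto
    then obtain r where r: "\<bar>t\<bar> < r" "r < \<epsilon>" using dense by blast
    then have r0: "0 < r" by linarith
    have c: "continuous_on {-r..r} ?v" by (rule continuous_on_subset[OF cont]) (use r in auto)
    have int: "?v integrable_on {a..b}" if "-r \<le> a" "b \<le> r" for a b
      by (rule integrable_continuous_interval[OF continuous_on_subset[OF c]]) (use that in auto)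
    \<comment> \<open>A single antiderivative based at \<open>-r\<close> unifies the two cases of
      \<open>arclength\<close>, which is thereby differentiable at \<open>0\<close> too.\<close>
    define G where "G t = integral {-r..t} ?v - integral {-r..0} ?v" for t
    have eq: "?s u = G u" if u: "u \<in> {-r<..<r}" for u
    proof (cases "0 \<le> u")
      case True
      have "integral {-r..0} ?v + integral {0..u} ?v = integral {-r..u} ?v"
        by (rule Henstock_Kurzweil_Integration.integral_combine) (use True u r0 int in auto)
      then show ?thesis using True unfolding arclength_def G_def by simp
    next
      case False
      have "integral {-r..u} ?v + integral {u..0} ?v = integral {-r..0} ?v"
        by (rule Henstock_Kurzweil_Integration.integral_combine) (use False u r0 int in auto)
      then show ?thesis using False unfolding arclength_def G_def by simp
    qed
    have "((\<lambda>u. integral {-r..u} ?v) has_real_derivative ?v t) (at t within {-r..r})"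
      by (rule integral_has_real_derivative[OF c]) (use r in auto)
    then have "((\<lambda>u. integral {-r..u} ?v) has_real_derivative ?v t) (at t)"
      using r by (subst (asm) at_within_Icc_at) auto
    then have "((\<lambda>u. integral {-r..u} ?v - integral {-r..0} ?v) has_real_derivative ?v t - 0) (at t)"
      by (intro DERIV_diff DERIV_const)
    then have "(G has_real_derivative ?v t) (at t)"
      by (simp add: G_def[abs_def])
    then show ?thesis
      by (rule has_field_derivative_transform_within_open[of _ _ _ "{-r<..<r}"]) (use r eq in auto)
  qed
  have mono: "?s a \<le> ?s b" if "a \<in> I" "b \<in> I" "a \<le> b" for a b
  proof (rule DERIV_nonneg_imp_nondecreasing[OF that(3)])
    fix x assume "a \<le> x" "x \<le> b"
    then have "x \<in> I" using that unfolding I_def by auto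
    then show "\<exists>y. (?s has_real_derivative y) (at x) \<and> 0 \<le> y"
      using D nonneg unfolding I_def by blast
  qed
  have 0: "0 \<in> I" "?s 0 = 0" using \<epsilon> by (auto simp: I_def arclength_def)
  obtain \<delta> where \<delta>: "\<delta> > 0" "\<delta> < \<epsilon>" "\<And>t. \<bar>t\<bar> \<le> \<delta> \<Longrightarrow> ?v t > 0"
  proof -
    have "isCont ?v 0" using cont 0(1) unfolding I_def[symmetric]
      by (simp add: continuous_on_eq_continuous_at I_def)
    then obtain d where d: "d > 0" "\<And>t. dist t 0 < d \<Longrightarrow> dist (?v t) (?v 0) < ?v 0"
      unfolding continuous_at_eps_delta using pos by blast
    show thesis
    proof (rule that[of "min (d / 2) (\<epsilon> / 2)"])
      fix t assume "\<bar>t\<bar> \<le> min (d / 2) (\<epsilon> / 2)"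
      then have "dist t 0 < d" using d(1) by (simp add: dist_real_def)
      then have "dist (?v t) (?v 0) < ?v 0" by (rule d(2))
      then show "?v t > 0" unfolding dist_real_def by linarith
    qed (use d(1) \<epsilon> in auto)
  qed
  have strict: "?s a < ?s b" if "-\<delta> \<le> a" "a < b" "b \<le> \<delta>" for a b
  proof (rule DERIV_pos_imp_increasing[OF that(2)])
    fix x assume "a \<le> x" "x \<le> b"
    then have "x \<in> I" "\<bar>x\<bar> \<le> \<delta>" using that \<delta>(2) unfolding I_def by auto
    then show "\<exists>y. (?s has_real_derivative y) (at x) \<and> 0 < y"
      using D \<delta>(3) by blast
  qed
  \<comment> \<open>\<open>inv_into\<close> picks some preimage in all of \<open>I\<close>.
    Monotonicity on \<open>I\<close> and strictness near \<open>0\<close> confine every preimage of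
    such a \<open>y\<close> to the interval of radius \<open>e\<close>, whichever one is
    picked.\<close>
  have inv: "?s (?\<phi> y) = y \<and> \<bar>?\<phi> y\<bar> < e" if e: "0 < e" "e \<le> \<delta>" and y: "?s (-e) < y" "y < ?s e" for e y
  proof -
    have "\<exists>x\<ge>-e. x \<le> e \<and> ?s x = y"
    proof (rule IVT)
      show "\<forall>x. -e \<le> x \<and> x \<le> e \<longrightarrow> isCont ?s x"
      proof (intro allI impI)
        fix x assume "-e \<le> x \<and> x \<le> e"
        then have "x \<in> I" using e \<delta>(2) unfolding I_def by auto
        then show "isCont ?s x" by (rule DERIV_isCont[OF D])
      qed
    qed (use e y in auto)
    then obtain x where x: "-e \<le> x" "x \<le> e" "?s x = y" by blast
    have "y \<in> ?s ` I" using x e \<delta>(2) by (intro image_eqI[of _ _ x]) (auto simp: I_def)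
    then have 1: "?s (?\<phi> y) = y" "?\<phi> y \<in> I" by (auto intro: f_inv_into_f inv_into_into)
    have "\<not> ?\<phi> y \<ge> e" using mono[of e "?\<phi> y"] 1 y e \<delta>(2) by (auto simp: I_def)
    moreover have "\<not> ?\<phi> y \<le> -e" using mono[of "?\<phi> y" "-e"] 1 y e \<delta>(2) by (auto simp: I_def)
    ultimately show ?thesis using 1 by auto
  qed
  have s\<delta>: "?s (-e) < 0" "0 < ?s e" if "0 < e" "e \<le> \<delta>" for e
    using strict[of "-e" 0] strict[of 0 e] that 0(2) by auto
  have \<phi>0: "?\<phi> 0 = 0"
  proof (rule ccontr)
    assume n: "?\<phi> 0 \<noteq> 0"
    let ?e = "min \<delta> \<bar>?\<phi> 0\<bar>"
    have "?e > 0" "?e \<le> \<delta>" using n \<delta>(1) by auto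
    then have "\<bar>?\<phi> 0\<bar> < ?e" using inv[of ?e 0] s\<delta>[of ?e] by blast
    then show False by simp
  qed
  then show "inv_into {-\<epsilon><..<\<epsilon>} ?s 0 = 0" unfolding I_def .
  have "isCont ?\<phi> 0"
    unfolding continuous_at_eps_delta
  proof (intro allI impI)
    fix e :: real assume "e > 0"
    let ?e = "min \<delta> e"
    have e: "?e > 0" "?e \<le> \<delta>" using \<open>e > 0\<close> \<delta>(1) by auto
    have "dist (?\<phi> y) (?\<phi> 0) < e" if "dist y 0 < min (- ?s (- ?e)) (?s ?e)" for y
    proof -
      have "?s (- ?e) < y" "y < ?s ?e" using that by (auto simp: dist_real_def)
      then have "\<bar>?\<phi> y\<bar> < ?e" using inv[OF e] by blast
      then show ?thesis by (simp add: \<phi>0 dist_real_def)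
    qed
    moreover have "min (- ?s (- ?e)) (?s ?e) > 0" using s\<delta>[OF e] by simp
    ultimately show "\<exists>d>0. \<forall>x'. dist x' 0 < d \<longrightarrow> dist (?\<phi> x') (?\<phi> 0) < e" by blast
  qed
  then have "(?\<phi> has_real_derivative inverse (?v 0)) (at 0)"
    by (intro DERIV_inverse_function[where f = ?s and a = "?s (-\<delta>)" and b = "?s \<delta>"])
      (use D[OF 0(1)] \<phi>0 pos s\<delta>[of \<delta>] inv[of \<delta>] \<delta>(1) in auto)
  then show "(inv_into {-\<epsilon><..<\<epsilon>} ?s has_real_derivative inverse (?v 0)) (at 0)" unfolding I_def .
qed

locale edge_curve = edge_charts +
  fixes \<epsilon> :: real and \<gamma> :: "real \<Rightarrow> 'a"
  assumes \<gamma>: "singular_curve A B f p \<epsilon> \<gamma>"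
begin

definition \<sigma> where "\<sigma> t = coord c0 (\<gamma> t)"
definition T where "T = {-\<epsilon><..<\<epsilon>} \<inter> \<gamma> -` D"

lemma \<epsilon>: "0 < \<epsilon>" and \<gamma>0: "\<gamma> 0 = p" and \<gamma>_cont: "continuous_on {-\<epsilon><..<\<epsilon>} \<gamma>"
  using \<gamma> unfolding singular_curve_def by auto

lemma \<gamma>_singular: "t \<in> {-\<epsilon><..<\<epsilon>} \<Longrightarrow> \<gamma> t \<notin> regular_points A B f"
  using \<gamma> unfolding singular_curve_def singular_points_def by blast

lemma open_T: "open T"
  unfolding T_def by (rule continuous_open_preimage[OF \<gamma>_cont _ open_D]) simp

lemma T0: "0 \<in> T"
  using \<epsilon> p_D unfolding T_def by (simp add: \<gamma>0)

lemma \<gamma>_chart: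
  assumes "a \<in> A"
  shows "open ({-\<epsilon><..<\<epsilon>} \<inter> \<gamma> -` cdom a)" "smooth_on ({-\<epsilon><..<\<epsilon>} \<inter> \<gamma> -` cdom a) (\<lambda>t. coord a (\<gamma> t))"
    "t \<in> {-\<epsilon><..<\<epsilon>} \<Longrightarrow> \<gamma> t \<in> cdom a \<Longrightarrow> DD 1 (\<lambda>t. coord a (\<gamma> t)) t \<noteq> 0"
proof -
  show "open ({-\<epsilon><..<\<epsilon>} \<inter> \<gamma> -` cdom a)"
    by (rule continuous_open_preimage[OF \<gamma>_cont]) (use assms open_cdom(2)[OF admissible_atlas[OF A]] in auto)
  have "{t \<in> {-\<epsilon><..<\<epsilon>}. \<gamma> t \<in> cdom a} = {-\<epsilon><..<\<epsilon>} \<inter> \<gamma> -` cdom a" by auto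
  then show s: "smooth_on ({-\<epsilon><..<\<epsilon>} \<inter> \<gamma> -` cdom a) (\<lambda>t. coord a (\<gamma> t))"
    using \<gamma> assms unfolding singular_curve_def o_def by metis
  assume t: "t \<in> {-\<epsilon><..<\<epsilon>}" "\<gamma> t \<in> cdom a"
  have "velocity (\<lambda>t. coord a (\<gamma> t)) t \<noteq> 0"
    using \<gamma> assms t unfolding singular_curve_def o_def by blast
  then show "DD 1 (\<lambda>t. coord a (\<gamma> t)) t \<noteq> 0"
    using velocity_DD[OF smooth_on_differentiable[OF s, of t]] t by auto
qed

text \<open>\<open>singular_curve\<close> gives smoothness and nonzero velocity in charts of
  \<open>A\<close>; the transition to \<open>c0\<close> preserves both, its differential being
  invertible.\<close>

lemma smooth_\<sigma>: "smooth_on T \<sigma>" and D\<sigma>: "t \<in> T \<Longrightarrow> DD 1 \<sigma> t \<noteq> 0"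
proof -
  have *: "\<exists>T'. open T' \<and> t \<in> T' \<and> smooth_on T' \<sigma> \<and> DD 1 \<sigma> t \<noteq> 0" if t: "t \<in> T" for t
  proof -
    obtain a where a: "a \<in> A" "\<gamma> t \<in> cdom a" using atlas_cover[OF A] by blast
    note ad = admissible_atlas[OF A a(1)]
    let ?T = "T \<inter> ({-\<epsilon><..<\<epsilon>} \<inter> \<gamma> -` cdom a)"
    have o: "open ?T" by (intro open_Int open_T \<gamma>_chart a)
    have tT: "t \<in> ?T" using t a(2) unfolding T_def by auto
    have sa: "smooth_on ?T (\<lambda>t. coord a (\<gamma> t))" by (rule smooth_on_subset[OF \<gamma>_chart(2)[OF a(1)]]) blast
    have eq: "\<sigma> s = transition a c0 (coord a (\<gamma> s))" if "s \<in> ?T" for s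
      using that unfolding \<sigma>_def by (simp add: transition_coord charts a)
    have st: "smooth_on (coord a ` (cdom a \<inter> cdom c0)) (transition a c0)"
      by (rule smooth_transition_admissible[OF A ad adm(1)])
    have in': "coord a (\<gamma> s) \<in> coord a ` (cdom a \<inter> cdom c0)" if "s \<in> ?T" for s
      using that D_subset(1) unfolding T_def by blast
    have "smooth_on ?T (\<lambda>s. transition a c0 (coord a (\<gamma> s)))"
      by (rule smooth_on_compose[OF o sa st in'])
    then have s: "smooth_on ?T \<sigma>" by (rule smooth_on_cong[OF o, rotated]) (rule eq[symmetric])
    have "DD 1 \<sigma> t = DD 1 (\<lambda>s. transition a c0 (coord a (\<gamma> s))) t" by (rule DD_cong[OF o tT eq])
    also have "\<dots> = DD (DD 1 (\<lambda>s. coord a (\<gamma> s)) t) (transition a c0) (coord a (\<gamma> t))"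
      by (rule DD_compose[where F = "\<lambda>s. coord a (\<gamma> s)", OF smooth_on_differentiable[OF sa tT] smooth_on_differentiable[OF st in'[OF tT]]])
    finally have D1: "DD 1 \<sigma> t = DD (DD 1 (\<lambda>s. coord a (\<gamma> s)) t) (transition a c0) (coord a (\<gamma> t))" .
    have c: "\<gamma> t \<in> cdom c0" using t D_subset(1) unfolding T_def by blast
    have "DD 1 \<sigma> t \<noteq> 0"
    proof
      assume z: "DD 1 \<sigma> t = 0"
      have "DD 0 (transition c0 a) (coord c0 (\<gamma> t)) = DD 1 (\<lambda>s. coord a (\<gamma> s)) t"
        using transition_inverse[OF A ad adm(1) a(2) c, of "DD 1 (\<lambda>s. coord a (\<gamma> s)) t"] unfolding D1[symmetric] z .
      then have "DD 1 (\<lambda>s. coord a (\<gamma> s)) t = 0"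
        using DD_zero[OF transition_diff[OF A adm(1) ad c a(2)]] by simp
      then show False using \<gamma>_chart(3)[OF a(1)] t a(2) unfolding T_def by blast
    qed
    then show ?thesis using o tT s by blast
  qed
  show "smooth_on T \<sigma>" by (rule smooth_on_local) (use * in blast)
  show "DD 1 \<sigma> t \<noteq> 0" if "t \<in> T" using *[OF that] by blast
qed

lemma \<sigma>_U: "t \<in> T \<Longrightarrow> \<sigma> t \<in> U"
  unfolding T_def \<sigma>_def U_def by blast

lemma \<sigma>2: "t \<in> T \<Longrightarrow> \<sigma> t $ 2 = 0"
  using regular_D \<gamma>_singular unfolding T_def \<sigma>_def by blast

lemma D\<sigma>1: "t \<in> T \<Longrightarrow> DD 1 \<sigma> t $ 1 \<noteq> 0" "t \<in> T \<Longrightarrow> DD 1 \<sigma> t $ 2 = 0"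
proof -
  assume t: "t \<in> T"
  have "DD 1 \<sigma> t $ 2 = DD 1 (\<lambda>t. \<sigma> t $ 2) t"
    by (rule DD_bounded_linear[symmetric, OF bounded_linear_vec_nth smooth_on_differentiable[OF smooth_\<sigma> t]])
  also have "\<dots> = DD 1 (\<lambda>t. 0) t" by (rule DD_cong[OF open_T t \<sigma>2])
  finally show 2: "DD 1 \<sigma> t $ 2 = 0" by simp
  then show "DD 1 \<sigma> t $ 1 \<noteq> 0" using D\<sigma>[OF t] by (auto simp: vec_eq_iff forall_2)
qed

lemma smooth_curve_f\<gamma>: "smooth_curve {-\<epsilon><..<\<epsilon>} (f \<circ> \<gamma>)"
  unfolding smooth_curve_def
proof (intro conjI ballI)
  have fc: "continuous_on X f" for X
    using f continuous_on_subset unfolding smooth_map_def by blast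
  show c: "continuous_on {-\<epsilon><..<\<epsilon>} (f \<circ> \<gamma>)" by (rule continuous_on_compose[OF \<gamma>_cont fc])
  fix e assume e: "e \<in> B"
  have oe: "open ({-\<epsilon><..<\<epsilon>} \<inter> (f \<circ> \<gamma>) -` cdom e)"
    by (rule continuous_open_preimage[OF c]) (use open_cdom(1)[OF e] in auto)
  show "smooth_on ({-\<epsilon><..<\<epsilon>} \<inter> (f \<circ> \<gamma>) -` cdom e) (coord e \<circ> (f \<circ> \<gamma>))"
  proof (rule smooth_on_local)
    fix t assume t: "t \<in> {-\<epsilon><..<\<epsilon>} \<inter> (f \<circ> \<gamma>) -` cdom e"
    obtain a where a: "a \<in> A" "\<gamma> t \<in> cdom a" using atlas_cover[OF A] by blast
    let ?T = "({-\<epsilon><..<\<epsilon>} \<inter> (f \<circ> \<gamma>) -` cdom e) \<inter> ({-\<epsilon><..<\<epsilon>} \<inter> \<gamma> -` cdom a)"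
    have o: "open ?T" by (intro open_Int[OF oe] \<gamma>_chart a)
    have sa: "smooth_on ?T (\<lambda>t. coord a (\<gamma> t))" by (rule smooth_on_subset[OF \<gamma>_chart(2)[OF a(1)]]) blast
    have "smooth_on ?T (\<lambda>s. local_rep a e f (coord a (\<gamma> s)))"
      by (rule smooth_on_compose[OF o sa smooth_local_rep[OF admissible_atlas[OF A a(1)] e]]) auto
    then have "smooth_on ?T (coord e \<circ> (f \<circ> \<gamma>))"
      by (rule smooth_on_cong[OF o, rotated]) (simp add: local_rep_coord charts a)
    then show "\<exists>T. open T \<and> t \<in> T \<and> smooth_on T (coord e \<circ> (f \<circ> \<gamma>))" using o t a by blast
  qed
qed simp

lemma f\<gamma>_T:
  assumes "t \<in> T"
  shows "t \<in> {-\<epsilon><..<\<epsilon>}" "f (\<gamma> t) \<in> cdom d" "\<gamma> t \<in> D"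
  using assms D_subset unfolding T_def by auto

lemma f\<gamma>_F: "t \<in> T \<Longrightarrow> coord d (f (\<gamma> t)) = F (\<sigma> t)"
  using F_coord f\<gamma>_T(3) unfolding \<sigma>_def by simp

lemma speed_T:
  assumes "t \<in> T"
  shows "curve_speed B g (f \<circ> \<gamma>) t = sqrt ((DD 1 \<sigma> t $ 1)\<^sup>2 * gform (g d) (F (\<sigma> t)) (X1 (\<sigma> t)) (X1 (\<sigma> t)))"
proof -
  have "DD 1 (\<lambda>t. coord d ((f \<circ> \<gamma>) t)) t = DD 1 (\<lambda>t. F (\<sigma> t)) t"
    by (rule DD_cong[OF open_T assms]) (simp add: f\<gamma>_F)
  also have "\<dots> = DD 1 \<sigma> t $ 1 *\<^sub>R X1 (\<sigma> t)"
    by (rule normal_acceleration(2)[OF open_T smooth_\<sigma> \<sigma>_U assms \<sigma>2])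
  finally show ?thesis
    using curve_speed_chart[OF manifold_map_axioms smooth_curve_f\<gamma> d(1) f\<gamma>_T(1)[OF assms]] f\<gamma>_T(2)[OF assms]
    by (simp add: f\<gamma>_F[OF assms] gform_linear power2_eq_square mult.assoc)
qed

text \<open>The normal acceleration and the squared speed share the squared parameter velocity,
  which is nonzero and cancels; the value is thus independent of the parametrization.\<close>

lemma limiting_normal_curvature_T:
  assumes "t \<in> T"
  shows "limiting_normal_curvature B g f \<nu> \<gamma> t = kap (\<sigma> t)"
proof -
  let ?\<beta> = "f \<circ> \<gamma>"
  let ?e = "chart_at B (?\<beta> t)"
  note e = chart_at[OF B, of "?\<beta> t"]
  note t = f\<gamma>_T[OF assms]
  have "\<nu> (\<gamma> t) ?e = transition_jacobian d ?e (?\<beta> t) *v \<nu> (\<gamma> t) d"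
    using \<nu> t e d(1) D_subset(2) unfolding unit_normal_on_def smooth_field_along_def by auto
  moreover have t\<beta>: "?\<beta> t \<in> cdom d" using t(2) by simp
  ultimately have "inner_at g ?e (?\<beta> t) (covariant_acceleration (g ?e) (coord ?e \<circ> ?\<beta>) t) (\<nu> (\<gamma> t) ?e) =
      gform (g d) (coord d (?\<beta> t)) (covd (g d) (\<lambda>t. coord d (?\<beta> t)) 1 (DD 1 (\<lambda>t. coord d (?\<beta> t))) t) (\<nu> (\<gamma> t) d)"
    by (simp only: normal_acceleration_chart[OF manifold_map_axioms smooth_curve_f\<gamma> d(1) e(1) t(1) t\<beta> e(2)])
  also have "\<dots> = gform (g d) (F (\<sigma> t)) (covd (g d) (\<lambda>t. F (\<sigma> t)) 1 (DD 1 (\<lambda>t. F (\<sigma> t))) t) (N (\<sigma> t))"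
  proof -
    have D1: "DD 1 (\<lambda>t. coord d (?\<beta> t)) s = DD 1 (\<lambda>t. F (\<sigma> t)) s" if "s \<in> T" for s
      by (rule DD_cong[OF open_T that]) (simp add: f\<gamma>_F)
    have D2: "DD 1 (DD 1 (\<lambda>t. coord d (?\<beta> t))) t = DD 1 (DD 1 (\<lambda>t. F (\<sigma> t))) t"
      by (rule DD_cong[OF open_T assms D1])
    show ?thesis
      unfolding covd_def D2 D1[OF assms] using N_coord[OF t(3)] f\<gamma>_F[OF assms] by (simp add: \<sigma>_def)
  qed
  also have "\<dots> = (DD 1 \<sigma> t $ 1)\<^sup>2 * L (\<sigma> t)"
    by (rule normal_acceleration(1)[OF open_T smooth_\<sigma> \<sigma>_U assms \<sigma>2])
  finally have 1: "limiting_normal_curvature B g f \<nu> \<gamma> t = (DD 1 \<sigma> t $ 1)\<^sup>2 * L (\<sigma> t) / (curve_speed B g ?\<beta> t)\<^sup>2"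
    unfolding limiting_normal_curvature_def Let_def by simp
  have "(curve_speed B g ?\<beta> t)\<^sup>2 = (DD 1 \<sigma> t $ 1)\<^sup>2 * gform (g d) (F (\<sigma> t)) (X1 (\<sigma> t)) (X1 (\<sigma> t))"
    unfolding speed_T[OF assms] using X1_pos[OF \<sigma>_U[OF assms]] by simp
  then show ?thesis
    unfolding 1 kap_def using D\<sigma>1(1)[OF assms] by simp
qed

text \<open>The velocity of \<sigma> is a nonzero multiple of the first coordinate vector, and the
  inverse of arclength has nonzero derivative at \<open>0\<close>, so reparametrizing does not
  affect vanishing.\<close>

lemma limiting_normal_curvature_deriv_zero:
  "limiting_normal_curvature_deriv B g f \<nu> \<epsilon> \<gamma> = 0 \<longleftrightarrow> DD (axis 1 1) kap 0 = 0"
proof -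
  let ?\<phi> = "inv_into {-\<epsilon><..<\<epsilon>} (arclength B g (f \<circ> \<gamma>))" and ?v = "curve_speed B g (f \<circ> \<gamma>)"
  let ?k = "limiting_normal_curvature B g f \<nu> \<gamma>"
  have \<sigma>0: "\<sigma> 0 = 0" using c0 unfolding \<sigma>_def \<gamma>0 coords_centered_at_def by blast
  have v0: "?v 0 > 0"
    unfolding speed_T[OF T0] using D\<sigma>1(1)[OF T0] X1_pos[OF \<sigma>_U[OF T0]] by simp
  have nn: "?v t \<ge> 0" if t: "t \<in> {-\<epsilon><..<\<epsilon>}" for t
  proof -
    obtain e where e: "e \<in> B" "(f \<circ> \<gamma>) t \<in> cdom e" using atlas_cover[OF B] by blast
    interpret ge: coord_metric "g e" "coord e ` cdom e" by (rule coord_metric_g[OF e(1)])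
    let ?w = "DD 1 (\<lambda>t. coord e ((f \<circ> \<gamma>) t)) t"
    have "gform (g e) (coord e ((f \<circ> \<gamma>) t)) ?w ?w \<ge> 0"
      by (cases "?w = 0") (use ge.gform_pos[of "coord e ((f \<circ> \<gamma>) t)" ?w] e in \<open>auto simp: gform_def\<close>)
    then show ?thesis
      unfolding curve_speed_chart[OF manifold_map_axioms smooth_curve_f\<gamma> e(1) t e(2)] by simp
  qed
  note \<phi> = arclength_inverse[OF \<epsilon> curve_speed_continuous[OF manifold_map_axioms smooth_curve_f\<gamma>] nn v0]
  have kd: "kap differentiable (at (\<sigma> 0))" by (rule smooth_on_differentiable[OF smooth_kap \<sigma>_U[OF T0]])
  have \<sigma>d: "\<sigma> differentiable (at 0)" by (rule smooth_on_differentiable[OF smooth_\<sigma> T0])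
  let ?D = "DD 1 \<sigma> 0 $ 1 * DD (axis 1 1) kap 0"
  have D1: "DD 1 \<sigma> 0 = DD 1 \<sigma> 0 $ 1 *\<^sub>R axis 1 1"
    using axis_expand_2[of "DD 1 \<sigma> 0"] D\<sigma>1(2)[OF T0] by simp
  have "((\<lambda>t. kap (\<sigma> t)) has_derivative (\<lambda>h. DD (DD h \<sigma> 0) kap (\<sigma> 0))) (at 0)"
    by (rule has_derivative_compose[OF DD_works[OF \<sigma>d] DD_works[OF kd]])
  moreover have "DD (DD h \<sigma> 0) kap (\<sigma> 0) = h * ?D" for h
  proof -
    have "DD h \<sigma> 0 = h *\<^sub>R DD 1 \<sigma> 0" using DD_scaleR[OF \<sigma>d, of h 1] by simp
    also have "\<dots> = h *\<^sub>R (DD 1 \<sigma> 0 $ 1 *\<^sub>R axis 1 1)" by (rule arg_cong[OF D1])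
    finally have "DD h \<sigma> 0 = (h * DD 1 \<sigma> 0 $ 1) *\<^sub>R axis 1 1" by (simp only: scaleR_scaleR)
    then have "DD (DD h \<sigma> 0) kap (\<sigma> 0) = (h * DD 1 \<sigma> 0 $ 1) *\<^sub>R DD (axis 1 1) kap (\<sigma> 0)"
      by (simp only: DD_scaleR[OF kd])
    then show ?thesis by (simp add: \<sigma>0)
  qed
  ultimately have "((\<lambda>t. kap (\<sigma> t)) has_real_derivative ?D) (at 0)"
    by (simp add: has_field_derivative_def mult_commute_abs)
  then have "(?k has_real_derivative ?D) (at 0)"
    by (rule has_field_derivative_transform_within_open[OF _ open_T T0]) (simp add: limiting_normal_curvature_T)
  then have "((\<lambda>s. ?k (?\<phi> s)) has_real_derivative ?D * inverse (?v 0)) (at 0)"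
    using DERIV_chain2[of ?k ?D ?\<phi> 0 "inverse (?v 0)" UNIV] \<phi> by simp
  then have "limiting_normal_curvature_deriv B g f \<nu> \<epsilon> \<gamma> = ?D * inverse (?v 0)"
    unfolding limiting_normal_curvature_deriv_def by (rule DERIV_imp_deriv)
  then show ?thesis using v0 D\<sigma>1(1)[OF T0] by simp
qed

lemma limiting_normal_curvature_zero: "limiting_normal_curvature B g f \<nu> \<gamma> 0 = kap 0"
  using limiting_normal_curvature_T[OF T0] c0 unfolding \<sigma>_def \<gamma>0 coords_centered_at_def by simp

end

section \<open>Hadamard's lemma and division in polar coordinates\<close>

text \<open>Differentiating under the integral releases one factor \<open>t\<close>. The power
  \<open>t ^ m\<close> is included so that the family of such integrals is closed under
  differentiation.\<close>

lemma has_derivative_ray_integral: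
  fixes q :: "'a::euclidean_space \<Rightarrow> real"
  assumes q: "smooth_on (ball 0 \<delta>) q" and x: "x \<in> ball 0 \<delta>"
  shows "((\<lambda>x. integral {0..1} (\<lambda>t. t ^ m * q (t *\<^sub>R x))) has_derivative
    (\<lambda>b. integral {0..1} (\<lambda>t. t ^ Suc m * DD b q (t *\<^sub>R x)))) (at x)"
proof -
  let ?B = "ball 0 \<delta> :: 'a set"
  have inB: "t *\<^sub>R x \<in> ?B" if "x \<in> ?B" "t \<in> {0..1}" for t x
  proof -
    have "\<bar>t\<bar> * norm x \<le> 1 * norm x" by (rule mult_right_mono) (use that in auto)
    then show ?thesis using that by simp
  qed
  have qd: "q differentiable (at (t *\<^sub>R x))" if "x \<in> ?B" "t \<in> {0..1}" for t x
    by (rule smooth_on_differentiable[OF q inB[OF that]])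
  \<comment> \<open>The derivative of the integrand is packaged as a bounded linear map, since
    \<open>leibniz_rule\<close> integrates such maps.\<close>
  define fx where "fx x t = Blinfun (\<lambda>b. t ^ m * DD (t *\<^sub>R b) q (t *\<^sub>R x))" for x t
  have bl: "bounded_linear (\<lambda>b. t ^ m * DD (t *\<^sub>R b) q (t *\<^sub>R x))" if "x \<in> ?B" "t \<in> {0..1}" for x t
  proof -
    have "bounded_linear (\<lambda>b. DD b q (t *\<^sub>R x))"
      using DD_works[OF qd[OF that]] has_derivative_bounded_linear by blast
    then show ?thesis
      by (intro bounded_linear_const_mult bounded_linear_compose[OF _ bounded_linear_scaleR_right])
  qed
  have fx: "blinfun_apply (fx x t) b = t ^ m * DD (t *\<^sub>R b) q (t *\<^sub>R x)" if "x \<in> ?B" "t \<in> {0..1}" for x t b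
    unfolding fx_def bounded_linear_Blinfun_apply[OF bl[OF that]] ..
  have fx': "blinfun_apply (fx x t) b = t ^ Suc m * DD b q (t *\<^sub>R x)" if "x \<in> ?B" "t \<in> {0..1}" for x t b
    unfolding fx[OF that] DD_scaleR[OF qd[OF that]] by simp
  have cont_ray: "continuous_on (?B \<times> {0..1}) (\<lambda>p. snd p ^ k * h (snd p *\<^sub>R fst p))"
    if "smooth_on ?B h" for h :: "'a \<Rightarrow> real" and k
    by (intro continuous_intros continuous_on_compose2[OF smooth_on_continuous[OF that]]) (use inB in auto)
  have "((\<lambda>x. integral (cbox 0 1) (\<lambda>t. t ^ m * q (t *\<^sub>R x))) has_derivative
      blinfun_apply (integral (cbox 0 1) (fx x))) (at x within ?B)"
  proof (rule leibniz_rule)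
    fix y :: 'a and t :: real assume y: "y \<in> ?B" and t: "t \<in> cbox 0 1"
    then have t': "t \<in> {0..1}" by simp
    have "((\<lambda>y. q (t *\<^sub>R y)) has_derivative (\<lambda>b. DD (t *\<^sub>R b) q (t *\<^sub>R y))) (at y)"
      by (rule has_derivative_compose[where f = "\<lambda>y. t *\<^sub>R y", OF _ DD_works[OF qd[OF y t']]])
        (auto intro!: derivative_eq_intros)
    then have "((\<lambda>y. t ^ m * q (t *\<^sub>R y)) has_derivative (\<lambda>b. t ^ m * DD (t *\<^sub>R b) q (t *\<^sub>R y))) (at y)"
      by (rule has_derivative_mult_right)
    then show "((\<lambda>y. t ^ m * q (t *\<^sub>R y)) has_derivative blinfun_apply (fx y t)) (at y within ?B)"
      unfolding fx_def bounded_linear_Blinfun_apply[OF bl[OF y t']] by (rule has_derivative_at_withinI)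
  next
    fix y assume y: "y \<in> ?B"
    have "continuous_on {0..1} (\<lambda>t. t ^ m * q (t *\<^sub>R y))"
      by (intro continuous_intros continuous_on_compose2[OF smooth_on_continuous[OF q]]) (use inB[OF y] in auto)
    then show "(\<lambda>t. t ^ m * q (t *\<^sub>R y)) integrable_on cbox 0 1"
      by (simp add: integrable_continuous_interval)
  next
    show "continuous_on (?B \<times> cbox 0 1) (\<lambda>(x, t). fx x t)"
    proof (rule continuous_on_blinfun_componentwise)
      fix b :: 'a
      have "continuous_on (?B \<times> {0..1}) (\<lambda>p. snd p ^ Suc m * DD b q (snd p *\<^sub>R fst p))"
        by (rule cont_ray[OF smooth_on_DD[OF open_ball q]])
      then show "continuous_on (?B \<times> cbox 0 1) (\<lambda>p. blinfun_apply (case p of (x, t) \<Rightarrow> fx x t) b)"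
        unfolding box_real by (rule continuous_on_eq) (auto simp: fx')
    qed
  qed (use x in auto)
  then have "((\<lambda>x. integral {0..1} (\<lambda>t. t ^ m * q (t *\<^sub>R x))) has_derivative
      blinfun_apply (integral (cbox 0 1) (fx x))) (at x)"
    using at_within_open[OF x open_ball] by simp
  moreover have "blinfun_apply (integral (cbox 0 1) (fx x)) = (\<lambda>b. integral {0..1} (\<lambda>t. t ^ Suc m * DD b q (t *\<^sub>R x)))"
  proof
    fix b
    show "blinfun_apply (integral (cbox 0 1) (fx x)) b = integral {0..1} (\<lambda>t. t ^ Suc m * DD b q (t *\<^sub>R x))"
  proof -
    have "continuous_on {0..1} (fx x)"
    proof (rule continuous_on_blinfun_componentwise)
      fix b :: 'a
      have "continuous_on {0..1} (\<lambda>t. t ^ Suc m * DD b q (t *\<^sub>R x))"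
        by (intro continuous_intros continuous_on_compose2[OF smooth_on_continuous[OF smooth_on_DD[OF open_ball q]]])
          (use inB[OF x] in auto)
      then show "continuous_on {0..1} (\<lambda>t. blinfun_apply (fx x t) b)"
        by (rule continuous_on_eq) (simp add: fx'[OF x])
    qed
    then have "fx x integrable_on cbox 0 1" by (simp add: integrable_continuous_interval)
    then have "blinfun_apply (integral (cbox 0 1) (fx x)) b = integral (cbox 0 1) (\<lambda>t. blinfun_apply (fx x t) b)"
      by (rule blinfun_apply_integral)
    also have "\<dots> = integral {0..1} (\<lambda>t. t ^ Suc m * DD b q (t *\<^sub>R x))"
      by (simp only: box_real, rule integral_cong) (rule fx'[OF x])
    finally show ?thesis .
  qed
  qed
  ultimately show ?thesis by simp
qed

lemma Ck_on_ray_integral: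
  fixes q :: "'a::euclidean_space \<Rightarrow> real"
  assumes "smooth_on (ball 0 \<delta>) q"
  shows "Ck_on k (ball 0 \<delta>) (\<lambda>x. integral {0..1} (\<lambda>t. t ^ m * q (t *\<^sub>R x)))"
  using assms
proof (induction k arbitrary: q m)
  case 0
  show ?case unfolding Ck_on.simps
    by (intro continuous_at_imp_continuous_on ballI has_derivative_continuous[OF has_derivative_ray_integral[OF 0]])
next
  case (Suc k)
  have "(\<lambda>x. integral {0..1} (\<lambda>t. t ^ m * q (t *\<^sub>R x))) differentiable (at x)" if "x \<in> ball 0 \<delta>" for x
    using differentiableI[OF has_derivative_ray_integral[OF Suc.prems that]] .
  moreover have "Ck_on k (ball 0 \<delta>) (DD b (\<lambda>x. integral {0..1} (\<lambda>t. t ^ m * q (t *\<^sub>R x))))" for b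
    by (rule Ck_on_cong[OF open_ball _ Suc.IH[OF smooth_on_DD[OF open_ball Suc.prems, of b], of "Suc m"]])
      (rule DD_eqI[symmetric, OF has_derivative_ray_integral[OF Suc.prems]])
  ultimately show ?case by simp
qed

text \<open>By the fundamental theorem of calculus along the segment from the origin,
  \<open>q x\<close> is the integral of the derivative in direction \<open>x\<close>; splitting
  \<open>x\<close> into coordinates gives the coefficients \<open>a\<close>.\<close>

lemma hadamard:
  fixes q :: "'a::euclidean_space \<Rightarrow> real"
  assumes q: "smooth_on (ball 0 \<delta>) q" and "q 0 = 0"
  obtains a where "\<And>b. smooth_on (ball 0 \<delta>) (a b)" "\<And>b. a b 0 = DD b q 0"
    "\<And>x. x \<in> ball 0 \<delta> \<Longrightarrow> q x = (\<Sum>b\<in>Basis. (x \<bullet> b) * a b x)"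
proof
  \<comment> \<open>The factor \<open>t ^ 0\<close> matches the case \<open>m = 0\<close> of the ray
    integrals.\<close>
  define a where "a b x = integral {0..1} (\<lambda>t. t ^ 0 * DD b q (t *\<^sub>R x))" for b x
  show "smooth_on (ball 0 \<delta>) (a b)" for b
    unfolding smooth_on_def a_def using Ck_on_ray_integral[OF smooth_on_DD[OF open_ball q]] by blast
  show "a b 0 = DD b q 0" for b
    unfolding a_def by simp
  fix x :: 'a assume x: "x \<in> ball 0 \<delta>"
  have inB: "t *\<^sub>R x \<in> ball 0 \<delta>" if "t \<in> {0..1}" for t
  proof -
    have "\<bar>t\<bar> * norm x \<le> 1 * norm x" by (rule mult_right_mono) (use that in auto)
    then show ?thesis using x by simp
  qed
  have qd: "q differentiable (at (t *\<^sub>R x))" if "t \<in> {0..1}" for t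
    by (rule smooth_on_differentiable[OF q inB[OF that]])
  have "((\<lambda>t. DD x q (t *\<^sub>R x)) has_integral q (1 *\<^sub>R x) - q (0 *\<^sub>R x)) {0..1}"
  proof (rule fundamental_theorem_of_calculus)
    fix t :: real assume t: "t \<in> {0..1}"
    have "((\<lambda>t. q (t *\<^sub>R x)) has_derivative (\<lambda>h. DD (h *\<^sub>R x) q (t *\<^sub>R x))) (at t within {0..1})"
      by (rule has_derivative_compose[where f = "\<lambda>t. t *\<^sub>R x", OF _ DD_works[OF qd[OF t]]])
        (auto intro!: derivative_eq_intros)
    then show "((\<lambda>t. q (t *\<^sub>R x)) has_vector_derivative DD x q (t *\<^sub>R x)) (at t within {0..1})"
      unfolding has_vector_derivative_def DD_scaleR[OF qd[OF t]] .
  qed simp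
  then have "q x = integral {0..1} (\<lambda>t. DD x q (t *\<^sub>R x))"
    using assms(2) by (simp add: integral_unique)
  also have "\<dots> = integral {0..1} (\<lambda>t. \<Sum>b\<in>Basis. (x \<bullet> b) *\<^sub>R DD b q (t *\<^sub>R x))"
    by (rule integral_cong) (rule DD_basis_sum[OF qd])
  also have "\<dots> = (\<Sum>b\<in>Basis. integral {0..1} (\<lambda>t. (x \<bullet> b) *\<^sub>R DD b q (t *\<^sub>R x)))"
  proof (rule integral_sum[OF finite_Basis])
    fix b :: 'a
    have "continuous_on {0..1} (\<lambda>t. (x \<bullet> b) *\<^sub>R DD b q (t *\<^sub>R x))"
      by (intro continuous_intros continuous_on_compose2[OF smooth_on_continuous[OF smooth_on_DD[OF open_ball q]]])
        (use inB in auto)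
    then show "(\<lambda>t. (x \<bullet> b) *\<^sub>R DD b q (t *\<^sub>R x)) integrable_on {0..1}"
      by (rule integrable_continuous_interval)
  qed
  also have "\<dots> = (\<Sum>b\<in>Basis. (x \<bullet> b) * a b x)"
    unfolding a_def by (simp add: integral_mult_right)
  finally show "q x = (\<Sum>b\<in>Basis. (x \<bullet> b) * a b x)" .
qed

section \<open>Polar coordinates and division by the radius\<close>

definition dir :: "real \<Rightarrow> real^2" where "dir \<theta> = vector [cos \<theta>, sin \<theta>]"

definition polar :: "real \<times> real \<Rightarrow> real^2" where "polar z = fst z *\<^sub>R dir (snd z)"

lemma Ck_on_sin_cos: "Ck_on k UNIV (sin :: real \<Rightarrow> real) \<and> Ck_on k UNIV (cos :: real \<Rightarrow> real)"
proof (induction k)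
  case 0
  show ?case by (auto intro: continuous_intros)
next
  case (Suc k)
  have ds: "(sin has_derivative (\<lambda>h. h * cos x)) (at x)" for x :: real
    by (auto intro!: derivative_eq_intros)
  have dc: "(cos has_derivative (\<lambda>h. h * - sin x)) (at x)" for x :: real
    by (auto intro!: derivative_eq_intros)
  have "DD b (sin :: real \<Rightarrow> real) = (\<lambda>x. b * cos x)" for b by (rule ext) (rule DD_eqI[OF ds])
  moreover have "DD b (cos :: real \<Rightarrow> real) = (\<lambda>x. - b * sin x)" for b using DD_eqI[OF dc] by auto
  moreover have "Ck_on k UNIV (\<lambda>x. b * cos x)" "Ck_on k UNIV (\<lambda>x. - b * sin x)" for b :: real
    by (intro Ck_on_bounded_linear[OF bounded_linear_mult_right open_UNIV] Suc[THEN conjunct1] Suc[THEN conjunct2])+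
  ultimately show ?case
    using differentiableI[OF ds] differentiableI[OF dc] by (simp only: Ck_on.simps) blast
qed

lemma smooth_sin: "smooth_on UNIV (sin :: real \<Rightarrow> real)" and smooth_cos: "smooth_on UNIV (cos :: real \<Rightarrow> real)"
  unfolding smooth_on_def using Ck_on_sin_cos by blast+

lemma smooth_fst: "open S \<Longrightarrow> smooth_on S fst"
  and smooth_snd: "open S \<Longrightarrow> smooth_on S snd"
  using smooth_on_bounded_linear[OF bounded_linear_fst _ smooth_on_id]
    smooth_on_bounded_linear[OF bounded_linear_snd _ smooth_on_id] by blast+

lemma smooth_dir: "open S \<Longrightarrow> smooth_on S (\<lambda>z::real \<times> real. dir (snd z))"
proof (rule smooth_on_vec)
  fix i :: 2
  assume S: "open S"
  have "smooth_on S (\<lambda>z::real \<times> real. cos (snd z))" "smooth_on S (\<lambda>z::real \<times> real. sin (snd z))"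
    by (rule smooth_on_compose[OF S smooth_snd[OF S]], (rule smooth_cos smooth_sin), simp)+
  then show "smooth_on S (\<lambda>z::real \<times> real. dir (snd z) $ i)"
    using exhaust_2[of i] by (auto simp: dir_def)
qed

lemma smooth_polar: "open S \<Longrightarrow> smooth_on S polar"
  unfolding polar_def by (intro smooth_on_scaleR smooth_fst smooth_dir)

lemma norm_dir: "norm (dir \<theta>) = 1"
  by (simp add: norm_vec_def L2_set_def sum_2 dir_def)

lemma norm_polar: "norm (polar z) = \<bar>fst z\<bar>"
  by (simp add: polar_def norm_dir)

lemma polar_zero_iff: "polar z = 0 \<longleftrightarrow> fst z = 0"
  using norm_polar[of z] by (metis abs_eq_0 norm_eq_zero)

text \<open>If \<open>q 0 = 0\<close>, the value prescribed on the exceptional circle is the limit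
  of the quotient along the ray.\<close>

definition polar_quotient :: "(real^2 \<Rightarrow> real) \<Rightarrow> real \<times> real \<Rightarrow> real" where
  "polar_quotient q z = (if fst z = 0 then DD (dir (snd z)) q 0 else q (polar z) / fst z)"

lemma open_polar_vimage: "open Y \<Longrightarrow> open (polar -` Y)"
  using open_vimage[of Y polar] smooth_on_continuous[OF smooth_polar[OF open_UNIV]] by blast

text \<open>Away from radius zero this is a quotient of smooth functions. Near it every coordinate
  in Hadamard's formula is the radius times a trigonometric factor, so the radius divides out
  smoothly.\<close>

lemma smooth_polar_quotient:
  assumes "open Y" "0 \<in> Y" "smooth_on Y q" "q 0 = 0"
  shows "smooth_on (polar -` Y) (polar_quotient q)"
proof (rule smooth_on_local)
  fix z assume z: "z \<in> polar -` Y"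
  show "\<exists>T. open T \<and> z \<in> T \<and> smooth_on T (polar_quotient q)"
  proof (cases "fst z = 0")
    case False
    let ?T = "polar -` Y \<inter> {z. fst z \<noteq> 0}"
    have o: "open ?T" by (intro open_Int open_polar_vimage assms open_Collect_neq continuous_intros)
    have "smooth_on ?T (\<lambda>z. q (polar z) / fst z)"
      by (intro smooth_on_divide smooth_on_compose[OF _ smooth_polar assms(3)] smooth_fst o) auto
    then have "smooth_on ?T (polar_quotient q)"
      by (rule smooth_on_cong[OF o, rotated]) (simp add: polar_quotient_def)
    then show ?thesis using o z False by blast
  next
    case True
    obtain \<delta> where \<delta>: "\<delta> > 0" "ball 0 \<delta> \<subseteq> Y" using assms(1,2) open_contains_ball by blast
    obtain a where a: "\<And>b. smooth_on (ball 0 \<delta>) (a b)" "\<And>b. a b 0 = DD b q 0"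
      "\<And>x. x \<in> ball 0 \<delta> \<Longrightarrow> q x = (\<Sum>b\<in>Basis. (x \<bullet> b) * a b x)"
      using hadamard[OF smooth_on_subset[OF assms(3) \<delta>(2)] assms(4)] by blast
    let ?T = "polar -` ball 0 \<delta>"
    have o: "open ?T" by (intro open_polar_vimage open_ball)
    have "smooth_on ?T (\<lambda>z. \<Sum>b\<in>Basis. (dir (snd z) \<bullet> b) * a b (polar z))"
      by (intro smooth_on_sum smooth_on_mult smooth_on_compose[OF o smooth_polar[OF o] a(1)]
          smooth_on_bounded_linear[OF bounded_linear_inner_left] smooth_dir o) auto
    then have "smooth_on ?T (polar_quotient q)"
    proof (rule smooth_on_cong[OF o, rotated])
      fix y assume y: "y \<in> ?T"
      have qd: "q differentiable (at 0)" by (rule smooth_on_differentiable[OF assms(3,2)])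
      show "(\<Sum>b\<in>Basis. (dir (snd y) \<bullet> b) * a b (polar y)) = polar_quotient q y"
      proof (cases "fst y = 0")
        case True
        then have "polar y = 0" by (simp add: polar_zero_iff)
        then show ?thesis using True by (simp add: polar_quotient_def a(2) DD_basis_sum[OF qd, where b = "dir (snd y)"])
      next
        case False
        have "q (polar y) = fst y * (\<Sum>b\<in>Basis. (dir (snd y) \<bullet> b) * a b (polar y))"
          using a(3)[of "polar y"] y by (simp add: polar_def[of y] sum_distrib_left mult.assoc)
        then show ?thesis using False by (simp add: polar_quotient_def)
      qed
    qed
    moreover have "z \<in> ?T" using True \<delta>(1) by (simp add: norm_polar)
    ultimately show ?thesis using o by blast
  qed
qed

lemma dir_add_int_pi: "dir (t + of_int k * pi) = ((- 1) powi k) *\<^sub>R dir t"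
  by (simp add: dir_def vec_eq_iff forall_2 sin_cos_add_int_pi)

lemma powi_square: "((- 1) powi k) * ((- 1) powi k) = (1 :: real)"
  by (cases "even k") auto

lemma polar_moebius:
  assumes "moebius_rel z w"
  shows "polar z = polar w"
proof -
  obtain k :: int where k: "fst w = (- 1) powi k * fst z" "snd w = snd z + of_int k * pi"
    using assms unfolding moebius_rel_def by blast
  have "polar w = (((- 1) powi k) * ((- 1) powi k)) *\<^sub>R polar z"
    unfolding polar_def k dir_add_int_pi by simp
  then show ?thesis by (simp add: powi_square)
qed

text \<open>The sign \<open>s\<close> depends on the two representatives but not on
  \<open>q\<close>; this common sign is what makes products of two such quotients descend to the
  quotient space.\<close>

lemma polar_quotient_moebius:
  assumes "moebius_rel z w"
  shows "\<exists>s. s * s = 1 \<and> (\<forall>q. q differentiable (at 0) \<longrightarrow> polar_quotient q w = s * polar_quotient q z)"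
proof -
  obtain k :: int where k: "fst w = (- 1) powi k * fst z" "snd w = snd z + of_int k * pi"
    using assms unfolding moebius_rel_def by blast
  define s :: real where "s = (- 1) powi k"
  have s: "s * s = 1" unfolding s_def by (rule powi_square)
  then have "s \<noteq> 0" by auto
  with s have s0: "s \<noteq> 0" "1 / s = s" by (simp_all add: divide_eq_eq)
  have "polar_quotient q w = s * polar_quotient q z" if q: "q differentiable (at 0)" for q
  proof (cases "fst z = 0")
    case True
    then show ?thesis
      unfolding polar_quotient_def k dir_add_int_pi DD_scaleR[OF q] by (simp add: s_def)
  next
    case False
    have "polar_quotient q w = q (polar z) / (s * fst z)"
      unfolding polar_quotient_def polar_moebius[OF assms, symmetric] k(1) s_def[symmetric] using False s0 by simp
    also have "\<dots> = (1 / s) * polar_quotient q z"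
      using False by (simp add: polar_quotient_def)
    finally show ?thesis unfolding s0(2) .
  qed
  then show ?thesis using s by blast
qed

section \<open>Functions on the blow up\<close>

lemma blow_down_proj: "blow_down (proj_moebius z) = polar z"
  by (simp add: blow_down.abs_eq polar_def dir_def case_prod_unfold vec_eq_iff forall_2)

lemma proj_rep: "proj_moebius (rep_moebius q) = q"
  by (rule Quotient3_abs_rep[OF Quotient3_moebius])

lemma moebius_cases: obtains z where "q = proj_moebius z"
  using proj_rep by metis

lemma moebius_rel_refl: "moebius_rel z z"
  using equivp_moebius_rel by (rule equivp_reflp)

text \<open>\<open>rep_moebius\<close> returns an arbitrary representative, so a function defined
  through it is usable only when invariant.\<close>

lemma lift_moebius:
  assumes "\<And>z w. moebius_rel z w \<Longrightarrow> F z = F w"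
  shows "F (rep_moebius (proj_moebius z)) = F z"
  by (rule assms) (rule Quotient3_rep_abs[OF Quotient3_moebius moebius_rel_refl])

text \<open>The half open half circle parametrizes the exceptional fibre, injectively by
  \<open>inj_proj_zero\<close>; finiteness on the fibre becomes finiteness of a set of
  angles.\<close>

lemma proj_zero_representative: "\<exists>\<theta>\<in>{0..<pi}. proj_moebius (0, t) = proj_moebius (0, \<theta>)"
proof -
  define k where "k = \<lfloor>t / pi\<rfloor>"
  define \<theta> where "\<theta> = t + of_int (- k) * pi"
  have "of_int k \<le> t / pi" "t / pi < of_int k + 1" unfolding k_def by linarith+
  then have "of_int k * pi \<le> t" "t < (of_int k + 1) * pi" by (simp_all add: field_simps)
  then have "\<theta> \<in> {0..<pi}" unfolding \<theta>_def by (simp add: algebra_simps)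
  moreover have "moebius_rel (0, t) (0, \<theta>)" unfolding moebius_rel_def \<theta>_def by (intro exI[of _ "- k"]) simp
  ultimately show ?thesis using moebius.abs_eq_iff by blast
qed

lemma inj_proj_zero: "inj_on (\<lambda>\<theta>. proj_moebius (0, \<theta>)) {0..<pi}"
proof (rule inj_onI)
  fix s t assume st: "s \<in> {0..<pi}" "t \<in> {0..<pi}" and "proj_moebius (0, s) = proj_moebius (0, t)"
  then have "moebius_rel (0, s) (0, t)" using moebius.abs_eq_iff by blast
  then obtain k :: int where k: "t = s + of_int k * pi" unfolding moebius_rel_def by auto
  have "0 \<le> s" "s < pi" "0 \<le> s + of_int k * pi" "s + of_int k * pi < pi" using st k by auto
  then have "of_int k * pi < 1 * pi" "- 1 * pi < of_int k * pi" by linarith+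
  then have "of_int k < (1::real)" "- 1 < (of_int k :: real)" by (simp_all only: mult_less_cancel_right_pos pi_gt_zero)
  then have "k = 0" by linarith
  then show "s = t" using k by simp
qed

text \<open>Angles that differ by less than \<pi> give independent directions; the determinant of
  the two directions is the sine of the difference.\<close>

lemma linear_form_two_zeros:
  fixes l :: "real^2 \<Rightarrow> real"
  assumes "linear l" "l (dir s) = 0" "l (dir t) = 0" "s < t" "t < s + pi"
  shows "l e = 0"
proof -
  have l: "l e = e $ 1 * l (axis 1 1) + e $ 2 * l (axis 2 1)" for e
  proof -
    have "e = e $ 1 *\<^sub>R axis 1 1 + e $ 2 *\<^sub>R axis 2 1" by (simp add: vec_eq_iff axis_def forall_2)
    then have "l e = l (e $ 1 *\<^sub>R axis 1 1 + e $ 2 *\<^sub>R axis 2 1)" by (rule arg_cong)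
    then show ?thesis using assms(1) by (simp add: linear_add linear_scale)
  qed
  let ?a = "l (axis 1 1)" and ?b = "l (axis 2 1)"
  have s: "cos s * ?a + sin s * ?b = 0" and t: "cos t * ?a + sin t * ?b = 0"
    using assms(2,3) unfolding l[of "dir _"] by (simp_all add: dir_def)
  have d: "sin (t - s) \<noteq> 0" using sin_gt_zero[of "t - s"] assms(4,5) by simp
  have "sin (t - s) * ?a = sin t * (cos s * ?a + sin s * ?b) - sin s * (cos t * ?a + sin t * ?b)"
    "sin (t - s) * ?b = cos s * (cos t * ?a + sin t * ?b) - cos t * (cos s * ?a + sin s * ?b)"
    by (simp_all add: sin_diff algebra_simps)
  then have "?a = 0" "?b = 0" unfolding s t using d by simp_all
  then show ?thesis unfolding l[of e] by simp
qed

lemma isCont_eq_at_limit: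
  fixes h k :: "real \<Rightarrow> real"
  assumes "isCont h 0" "isCont k 0" "open T" "0 \<in> T" "\<And>r. r \<in> T \<Longrightarrow> r \<noteq> 0 \<Longrightarrow> h r = k r"
  shows "h 0 = k 0"
proof -
  have "eventually (\<lambda>r. h r = k r) (at 0)"
    using assms(3-5) eventually_at_topological by blast
  then have "(k \<longlongrightarrow> h 0) (at 0)"
    using assms(1) tendsto_cong[of h k] unfolding isCont_def by blast
  then show ?thesis using assms(2) LIM_unique unfolding isCont_def by blast
qed

text \<open>The analytic core, detached from geometry: a function of the form \<Psi> / v near
  \<open>p\<close>, where v vanishes at the origin to first order exactly.\<close>

locale quotient_on_blow_up =
  fixes c :: "('p::topological_space, 2) chart" and p :: 'p and W :: "'p set" and Y :: "(real^2) set"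
    and v \<Psi> :: "real^2 \<Rightarrow> real" and \<phi> :: "'p \<Rightarrow> real"
  assumes cinv: "x \<in> cdom c \<Longrightarrow> cinv c (coord c x) = x"
    and p: "p \<in> W" "coord c p = 0" and W: "W \<subseteq> cdom c" "open (coord c ` W)" "coord c ` W \<subseteq> Y"
    and Y: "open Y" and smooth: "smooth_on Y v" "smooth_on Y \<Psi>"
    and v0: "v 0 = 0" and Dv0: "\<exists>e. DD e v 0 \<noteq> 0"
    and \<phi>: "x \<in> W \<Longrightarrow> v (coord c x) \<noteq> 0 \<Longrightarrow> \<phi> x = \<Psi> (coord c x) / v (coord c x)"
begin

definition Reg where "Reg = {x \<in> W. v (coord c x) \<noteq> 0}"

lemma Y0: "0 \<in> Y" "0 \<in> coord c ` W"
  using p W(3) by force+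

lemma diff0: "v differentiable (at 0)" "\<Psi> differentiable (at 0)"
  using smooth_on_differentiable[OF smooth(1) Y0(1)] smooth_on_differentiable[OF smooth(2) Y0(1)] by auto

lemma coord_inj: "x \<in> W \<Longrightarrow> y \<in> W \<Longrightarrow> coord c x = coord c y \<Longrightarrow> x = y"
  using cinv W(1) by (metis subsetD)

abbreviation "s \<equiv> polar_quotient v"
abbreviation "t \<equiv> polar_quotient \<Psi>"

lemma quotients:
  "\<Psi> 0 = 0 \<Longrightarrow> smooth_on (polar -` coord c ` W) t" "smooth_on (polar -` coord c ` W) s"
  by (rule smooth_on_subset[OF smooth_polar_quotient[OF Y Y0(1)]]; use smooth v0 W(3) in auto)+

lemma vimage_preimage: "proj_moebius -` blow_up_preimage c X = polar -` coord c ` X"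
  by (auto simp: blow_up_preimage_def blow_down_proj)

lemma preimage_p: "blow_up_preimage c {p} = (\<lambda>\<theta>. proj_moebius (0, \<theta>)) ` {0..<pi}"
proof
  show "(\<lambda>\<theta>. proj_moebius (0, \<theta>)) ` {0..<pi} \<subseteq> blow_up_preimage c {p}"
    by (auto simp: blow_up_preimage_def blow_down_proj polar_def p)
  show "blow_up_preimage c {p} \<subseteq> (\<lambda>\<theta>. proj_moebius (0, \<theta>)) ` {0..<pi}"
  proof
    fix q assume "q \<in> blow_up_preimage c {p}"
    then have 0: "blow_down q = 0" by (simp add: blow_up_preimage_def p)
    obtain z where z: "q = proj_moebius z" by (rule moebius_cases)
    have "fst z = 0" using 0 unfolding z blow_down_proj polar_zero_iff .
    then have "z = (0, snd z)" by (simp add: prod_eq_iff)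
    then have "q = proj_moebius (0, snd z)" using z by simp
    then show "q \<in> (\<lambda>\<theta>. proj_moebius (0, \<theta>)) ` {0..<pi}"
      using proj_zero_representative[of "snd z"] by auto
  qed
qed

text \<open>Two distinct zeros in the half circle would force the differential of \<open>v\<close>
  to vanish, so there is at most one.\<close>

lemma finite_directions: "finite {\<theta> \<in> {0..<pi}. DD (dir \<theta>) v 0 = 0}"
proof (cases "{\<theta> \<in> {0..<pi}. DD (dir \<theta>) v 0 = 0} = {}")
  case False
  then obtain a where a: "a \<in> {0..<pi}" "DD (dir a) v 0 = 0" by blast
  have lin: "linear (\<lambda>e. DD e v 0)" by (rule linear_frechet_derivative[OF diff0(1)])
  have "b = a" if b: "b \<in> {0..<pi}" "DD (dir b) v 0 = 0" for b
  proof (rule ccontr)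
    assume "b \<noteq> a"
    then have "DD e v 0 = 0" for e
      using linear_form_two_zeros[OF lin a(2) b(2), of e] linear_form_two_zeros[OF lin b(2) a(2), of e] a(1) b(1)
      by (cases "a < b") auto
    then show False using Dv0 by blast
  qed
  then have "{\<theta> \<in> {0..<pi}. DD (dir \<theta>) v 0 = 0} \<subseteq> {a}" by blast
  then show ?thesis using finite_subset by blast
next
  case True
  then show ?thesis by (simp only: finite.emptyI)
qed

text \<open>One pair serves both notions, hence the conjunct about every \<open>k\<close>. Off the
  fibre \<rho> vanishes exactly with \<open>v\<close>, on the fibre exactly in the directions
  annihilated by the differential of \<open>v\<close>.\<close>

lemma rational_pair_exists:
  assumes "\<Psi> 0 = 0"
  shows "\<exists>\<rho> \<psi>. rational_pair c p W Reg \<phi> \<rho> \<psi> \<and>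
    (\<forall>k. (\<forall>e. DD e \<Psi> 0 = k * DD e v 0) \<longrightarrow> (\<forall>q\<in>blow_up_preimage c {p}. \<psi> q = k * \<rho> q))"
proof -
  \<comment> \<open>\<open>s\<close> and \<open>t\<close> change sign under \<open>(r, \<theta>) \<mapsto> (- r, \<theta> + \<pi>)\<close>, so only products of two of them descend.\<close>
  define \<rho> where "\<rho> q = s (rep_moebius q) * s (rep_moebius q)" for q
  define \<psi> where "\<psi> q = s (rep_moebius q) * t (rep_moebius q)" for q
  have inv: "s w * s w = s z * s z" "s w * t w = s z * t z" if zw: "moebius_rel z w" for z w
  proof -
    obtain r where r: "r * r = 1" "\<forall>q. q differentiable (at 0) \<longrightarrow> polar_quotient q w = r * polar_quotient q z"
      using polar_quotient_moebius[OF zw] by blast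
    have "s w = r * s z" "t w = r * t z" using r(2) diff0 by blast+
    then have "s w * s w = (r * r) * (s z * s z)" "s w * t w = (r * r) * (s z * t z)" by simp_all
    then show "s w * s w = s z * s z" "s w * t w = s z * t z" unfolding r(1) by simp_all
  qed
  have \<rho>: "\<rho> (proj_moebius z) = s z * s z" for z
    unfolding \<rho>_def by (rule lift_moebius[where F = "\<lambda>z. s z * s z"]) (rule inv(1)[symmetric])
  have \<psi>: "\<psi> (proj_moebius z) = s z * t z" for z
    unfolding \<psi>_def by (rule lift_moebius[where F = "\<lambda>z. s z * t z"]) (rule inv(2)[symmetric])
  have oW: "open (polar -` coord c ` W)" by (rule open_polar_vimage[OF W(2)])
  have "rational_pair c p W Reg \<phi> \<rho> \<psi>"
    unfolding rational_pair_def
  proof (intro conjI ballI)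
    have "smooth_on (polar -` coord c ` W) (\<lambda>z. s z * s z)" "smooth_on (polar -` coord c ` W) (\<lambda>z. s z * t z)"
      by (intro smooth_on_mult oW quotients assms)+
    then show "smooth_on_moebius (blow_up_preimage c W) \<rho>" "smooth_on_moebius (blow_up_preimage c W) \<psi>"
      unfolding smooth_on_moebius_def vimage_preimage o_def \<rho> \<psi> by auto
    show "blow_up_preimage c (Reg - {p}) = blow_up_preimage c (W - {p}) \<inter> {q. \<rho> q \<noteq> 0}"
    proof (rule set_eqI)
      fix q
      obtain z where z: "q = proj_moebius z" by (rule moebius_cases)
      show "q \<in> blow_up_preimage c (Reg - {p}) \<longleftrightarrow> q \<in> blow_up_preimage c (W - {p}) \<inter> {q. \<rho> q \<noteq> 0}"
      proof (cases "\<exists>x\<in>W - {p}. polar z = coord c x")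
        case True
        then obtain x where x: "x \<in> W" "x \<noteq> p" "polar z = coord c x" by blast
        have "coord c x \<noteq> 0" using coord_inj[OF x(1) p(1)] x(2) p(2) by auto
        then have "fst z \<noteq> 0" using polar_zero_iff[of z] x(3) by simp
        then have "\<rho> q \<noteq> 0 \<longleftrightarrow> v (coord c x) \<noteq> 0"
          unfolding z \<rho> by (simp add: polar_quotient_def x(3))
        moreover have "q \<in> blow_up_preimage c (W - {p})"
          using x by (auto simp: z blow_up_preimage_def blow_down_proj)
        moreover have "q \<in> blow_up_preimage c (Reg - {p}) \<longleftrightarrow> v (coord c x) \<noteq> 0"
        proof
          assume "q \<in> blow_up_preimage c (Reg - {p})"
          then obtain y where "y \<in> Reg" "coord c x = coord c y"
            using x(3) by (auto simp: z blow_up_preimage_def blow_down_proj)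
          then show "v (coord c x) \<noteq> 0" unfolding Reg_def by simp
        next
          assume "v (coord c x) \<noteq> 0"
          then show "q \<in> blow_up_preimage c (Reg - {p})"
            using x by (auto simp: z blow_up_preimage_def blow_down_proj Reg_def)
        qed
        ultimately show ?thesis by blast
      next
        case False
        then show ?thesis by (auto simp: z blow_up_preimage_def blow_down_proj Reg_def)
      qed
    qed
    have "{q. \<rho> q = 0} \<inter> blow_up_preimage c {p} \<subseteq> (\<lambda>\<theta>. proj_moebius (0, \<theta>)) ` {\<theta> \<in> {0..<pi}. DD (dir \<theta>) v 0 = 0}"
      unfolding preimage_p by (auto simp: \<rho> polar_quotient_def)
    then show "finite ({q. \<rho> q = 0} \<inter> blow_up_preimage c {p})"
      using finite_subset finite_imageI[OF finite_directions] by blast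
    fix q assume q: "q \<in> blow_up_preimage c Reg"
    obtain z where z: "q = proj_moebius z" by (rule moebius_cases)
    obtain x where x: "x \<in> W" "v (coord c x) \<noteq> 0" "polar z = coord c x"
      using q by (auto simp: z blow_up_preimage_def blow_down_proj Reg_def)
    have "fst z \<noteq> 0" using polar_zero_iff[of z] x(2,3) v0 by auto
    moreover have "cinv c (blow_down q) = x" unfolding z blow_down_proj x(3) using cinv x(1) W(1) by blast
    ultimately show "\<psi> q = \<rho> q * \<phi> (cinv c (blow_down q))"
      using x(2) by (simp add: \<phi>[OF x(1,2)] z \<rho> \<psi> polar_quotient_def x(3))
  qed
  moreover have "\<forall>q\<in>blow_up_preimage c {p}. \<psi> q = k * \<rho> q" if "\<forall>e. DD e \<Psi> 0 = k * DD e v 0" for k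
    unfolding preimage_p using that by (auto simp: \<rho> \<psi> polar_quotient_def)
  ultimately show ?thesis by blast
qed

context
  fixes \<rho> \<psi> assumes pair: "rational_pair c p W Reg \<phi> \<rho> \<psi>"
begin

text \<open>Directions along which neither \<rho> nor the differential of \<open>v\<close>
  degenerates, so that limits along the ray can be divided out.\<close>

definition good where "good = {\<theta> \<in> {0..<pi}. \<rho> (proj_moebius (0, \<theta>)) \<noteq> 0 \<and> DD (dir \<theta>) v 0 \<noteq> 0}"

text \<open>Condition (b) and \<open>finite_directions\<close> exclude only finitely many angles.
  Later two distinct good angles are needed.\<close>

lemma infinite_good: "infinite good"
proof -
  have "finite ({q. \<rho> q = 0} \<inter> (\<lambda>\<theta>. proj_moebius (0, \<theta>)) ` {0..<pi})"
    using pair unfolding rational_pair_def preimage_p by blast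
  moreover have "(\<lambda>\<theta>. proj_moebius (0, \<theta>)) ` {\<theta> \<in> {0..<pi}. \<rho> (proj_moebius (0, \<theta>)) = 0} \<subseteq>
      {q. \<rho> q = 0} \<inter> (\<lambda>\<theta>. proj_moebius (0, \<theta>)) ` {0..<pi}" by blast
  ultimately have "finite ((\<lambda>\<theta>. proj_moebius (0, \<theta>)) ` {\<theta> \<in> {0..<pi}. \<rho> (proj_moebius (0, \<theta>)) = 0})"
    by (rule rev_finite_subset)
  then have f: "finite {\<theta> \<in> {0..<pi}. \<rho> (proj_moebius (0, \<theta>)) = 0}"
    by (rule finite_imageD) (rule inj_on_subset[OF inj_proj_zero], blast)
  have "{0..<pi} \<subseteq> good \<union> ({\<theta> \<in> {0..<pi}. \<rho> (proj_moebius (0, \<theta>)) = 0} \<union> {\<theta> \<in> {0..<pi}. DD (dir \<theta>) v 0 = 0})"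
    unfolding good_def by blast
  moreover have "infinite {0..<pi}" using infinite_Ico[OF pi_gt_zero] .
  ultimately show ?thesis using f finite_directions finite_subset by blast
qed

text \<open>Two successive limits. As \<open>v\<close> vanishes at the origin and \<rho> does not in
  a good direction, the first gives \<Psi>(0) = 0; this makes \<open>t\<close> continuous at radius
  zero, and the relation divided by the radius can be passed to the limit.\<close>

lemma along_ray:
  assumes \<theta>: "\<theta> \<in> good"
  shows "\<Psi> 0 = 0" and "\<psi> (proj_moebius (0, \<theta>)) * DD (dir \<theta>) v 0 = \<rho> (proj_moebius (0, \<theta>)) * DD (dir \<theta>) \<Psi> 0"
proof -
  let ?z = "\<lambda>r. (r, \<theta>)" and ?X = "polar -` coord c ` W"
  have oX: "open ?X" by (rule open_polar_vimage[OF W(2)])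
  define T where "T = ?z -` ?X"
  have cz: "continuous_on UNIV ?z" by (intro continuous_intros)
  have oT: "open T" unfolding T_def using open_vimage[OF oX cz] .
  have T0: "0 \<in> T" using Y0(2) unfolding T_def by (simp add: polar_def)
  have cont: "isCont (\<lambda>r. h (?z r)) 0" if "smooth_on ?X h" for h :: "real \<times> real \<Rightarrow> real"
  proof -
    have "continuous_on T (\<lambda>r. h (?z r))"
      by (rule continuous_on_compose2[OF smooth_on_continuous[OF that] continuous_on_subset[OF cz]])
        (auto simp: T_def)
    then show ?thesis using continuous_on_eq_continuous_at[OF oT] T0 by blast
  qed
  have R: "isCont (\<lambda>r. \<rho> (proj_moebius (?z r))) 0" "isCont (\<lambda>r. \<psi> (proj_moebius (?z r))) 0"
    using pair cont[of "\<rho> \<circ> proj_moebius"] cont[of "\<psi> \<circ> proj_moebius"]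
    unfolding rational_pair_def smooth_on_moebius_def vimage_preimage by auto
  have s: "isCont (\<lambda>r. s (?z r)) 0" by (rule cont[OF quotients(2)])
  have s0: "s (?z 0) \<noteq> 0" using \<theta> unfolding good_def by (simp add: polar_quotient_def)
  have "continuous_on T (\<lambda>r. s (?z r))"
    by (rule continuous_on_compose2[OF smooth_on_continuous[OF quotients(2)] continuous_on_subset[OF cz]])
      (auto simp: T_def)
  then have "open (T \<inter> (\<lambda>r. s (?z r)) -` (- {0}))" by (rule continuous_open_preimage[OF _ oT]) auto
  \<comment> \<open>Off radius zero \<open>s\<close> is \<open>v\<close> divided by the radius, so
    the punctured ray stays in \<open>Reg\<close>, where condition (c) holds.\<close>
  then obtain T' where T': "open T'" "0 \<in> T'" "\<And>r. r \<in> T' \<Longrightarrow> r \<in> T \<and> s (?z r) \<noteq> 0"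
    using that T0 s0 by (metis (no_types, lifting) Int_iff vimageI2 ComplI singletonD ComplD vimageD singletonI)
  have key: "\<psi> (proj_moebius (?z r)) * v (polar (?z r)) = \<rho> (proj_moebius (?z r)) * \<Psi> (polar (?z r))"
    if r: "r \<in> T'" "r \<noteq> 0" for r
  proof -
    obtain x where x: "x \<in> W" "polar (?z r) = coord c x" using T'(3)[OF r(1)] unfolding T_def by auto
    have v: "v (coord c x) \<noteq> 0" using T'(3)[OF r(1)] r(2) by (simp add: polar_quotient_def x(2))
    have "proj_moebius (?z r) \<in> blow_up_preimage c Reg"
      using x v by (auto simp: blow_up_preimage_def blow_down_proj Reg_def)
    then have "\<psi> (proj_moebius (?z r)) = \<rho> (proj_moebius (?z r)) * \<phi> (cinv c (polar (?z r)))"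
      using pair unfolding rational_pair_def by (metis blow_down_proj)
    also have "cinv c (polar (?z r)) = x" unfolding x(2) using cinv x(1) W(1) by blast
    finally show ?thesis using v unfolding \<phi>[OF x(1) v] x(2) by simp
  qed
  have cq: "isCont (\<lambda>r. q (polar (?z r))) 0" if "smooth_on Y q" for q :: "real^2 \<Rightarrow> real"
    by (rule cont) (rule smooth_on_compose[OF oX smooth_polar[OF oX] that], use W(3) in auto)
  have "\<psi> (proj_moebius (?z 0)) * v (polar (?z 0)) = \<rho> (proj_moebius (?z 0)) * \<Psi> (polar (?z 0))"
    by (rule isCont_eq_at_limit[OF _ _ T'(1,2) key]) (intro isCont_mult R cq smooth)+
  then show \<Psi>0: "\<Psi> 0 = 0" using \<theta> v0 unfolding good_def by (simp add: polar_def)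
  have t: "isCont (\<lambda>r. t (?z r)) 0" by (rule cont[OF quotients(1)[OF \<Psi>0]])
  have key2: "\<psi> (proj_moebius (?z r)) * s (?z r) = \<rho> (proj_moebius (?z r)) * t (?z r)"
    if r: "r \<in> T'" "r \<noteq> 0" for r
    using key[OF r] r(2) by (simp add: polar_quotient_def)
  have "\<psi> (proj_moebius (?z 0)) * s (?z 0) = \<rho> (proj_moebius (?z 0)) * t (?z 0)"
    by (rule isCont_eq_at_limit[OF _ _ T'(1,2) key2]) (intro isCont_mult R s t)+
  then show "\<psi> (proj_moebius (0, \<theta>)) * DD (dir \<theta>) v 0 = \<rho> (proj_moebius (0, \<theta>)) * DD (dir \<theta>) \<Psi> 0"
    by (simp add: polar_quotient_def)
qed

lemma rational_pair_zero: "\<Psi> 0 = 0"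
  using infinite_good along_ray(1) by (metis all_not_in_conv finite.emptyI)

text \<open>In a good direction \<rho> cancels from the limit relation, so the linear form given by
  the difference of the two sides vanishes there; two independent good directions make it
  zero.\<close>

lemma rational_pair_proportional:
  assumes k: "\<forall>q\<in>blow_up_preimage c {p}. \<psi> q = k * \<rho> q"
  shows "DD e \<Psi> 0 = k * DD e v 0"
proof -
  have zero: "DD (dir \<theta>) \<Psi> 0 - k * DD (dir \<theta>) v 0 = 0" if \<theta>: "\<theta> \<in> good" for \<theta>
  proof -
    have "\<psi> (proj_moebius (0, \<theta>)) = k * \<rho> (proj_moebius (0, \<theta>))" "\<rho> (proj_moebius (0, \<theta>)) \<noteq> 0"
      using k \<theta> unfolding preimage_p good_def by blast+
    then show ?thesis using along_ray(2)[OF \<theta>] by simp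
  qed
  have lin: "linear (\<lambda>e. DD e \<Psi> 0 - k * DD e v 0)"
    using linear_compose_sub[OF linear_frechet_derivative[OF diff0(2)]
        linear_compose_scale_right[OF linear_frechet_derivative[OF diff0(1)], of k]] by simp
  obtain a where a: "a \<in> good" using infinite_good by (metis all_not_in_conv finite.emptyI)
  have "infinite (good - {a})" using infinite_good by simp
  then obtain b where b: "b \<in> good" "b \<noteq> a" by (metis all_not_in_conv finite.emptyI DiffD1 DiffD2 singletonI)
  have "DD e \<Psi> 0 - k * DD e v 0 = 0"
    using linear_form_two_zeros[OF lin zero[OF a] zero[OF b(1)], of e]
      linear_form_two_zeros[OF lin zero[OF b(1)] zero[OF a], of e] a b unfolding good_def
    by (cases "a < b") auto
  then show ?thesis by simp
qed

end

end

section \<open>Rational boundedness and continuity of the Gaussian curvature\<close>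

context edge_curve
begin

lemma smooth_Phi_chart:
  assumes "admissible A c"
  shows "smooth_on (coord c ` (cdom c \<inter> D)) (\<lambda>z. Phi (transition c c0 z))"
    and "smooth_on (coord c ` (cdom c \<inter> D)) (\<lambda>z. transition c c0 z $ 2)"
    and "open (coord c ` (cdom c \<inter> D))"
    and "smooth_on (coord c ` (cdom c \<inter> D)) (transition c c0)"
    and "z \<in> coord c ` (cdom c \<inter> D) \<Longrightarrow> transition c c0 z \<in> U"
proof -
  note ch' = charts(1)[OF assms]
  show o: "open (coord c ` (cdom c \<inter> D))" by (rule open_coord_image[OF ch' open_D])
  show w: "smooth_on (coord c ` (cdom c \<inter> D)) (transition c c0)"
    by (rule smooth_on_subset[OF smooth_transition_admissible[OF A assms adm(1)]]) (use D_subset in blast)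
  show wU: "transition c c0 z \<in> U" if "z \<in> coord c ` (cdom c \<inter> D)" for z
    using that unfolding U_def by (auto simp: transition_coord[OF ch'])
  show "smooth_on (coord c ` (cdom c \<inter> D)) (\<lambda>z. Phi (transition c c0 z))"
    by (rule smooth_on_compose[OF o w smooth_Phi wU])
  show "smooth_on (coord c ` (cdom c \<inter> D)) (\<lambda>z. transition c c0 z $ 2)"
    by (rule smooth_on_vec_nth[OF o w])
qed

text \<open>Within \<open>D\<close> the singular points are the zeros of the second coordinate of
  \<open>c0\<close>, and shifting that coordinate slightly reaches a regular point.\<close>

lemma open_dense_regular:
  assumes W: "open W" "W \<subseteq> D"
  shows "open_dense_in W (W \<inter> regular_points A B f)"
  unfolding open_dense_in_def
proof (intro conjI)
  have "open (cdom c0 \<inter> coord c0 -` {z. z $ 2 \<noteq> 0})"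
    by (rule continuous_open_preimage[OF continuous_coord[OF ch(1)] open_cdom(2)[OF adm(1)]])
      (intro open_Collect_neq continuous_intros)
  moreover have "W \<inter> regular_points A B f = W \<inter> (cdom c0 \<inter> coord c0 -` {z. z $ 2 \<noteq> 0})"
    using regular_D W(2) D_subset(1) by blast
  ultimately show "open (W \<inter> regular_points A B f)" using W(1) by (simp only: open_Int)
  show "W \<subseteq> closure (W \<inter> regular_points A B f)"
  proof
    fix x assume x: "x \<in> W"
    show "x \<in> closure (W \<inter> regular_points A B f)"
      unfolding closure_iff_nhds_not_empty
    proof (intro allI impI)
      fix X Q assume Q: "Q \<subseteq> X" "open Q" "x \<in> Q"
      have o: "open (coord c0 ` (cdom c0 \<inter> (W \<inter> Q)))" by (intro open_coord_image ch open_Int W Q)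
      have xc: "x \<in> cdom c0" using x W(2) D_subset(1) by blast
      have "coord c0 x \<in> coord c0 ` (cdom c0 \<inter> (W \<inter> Q))" using x xc Q by blast
      then obtain e where e: "e > 0" "ball (coord c0 x) e \<subseteq> coord c0 ` (cdom c0 \<inter> (W \<inter> Q))"
        using o open_contains_ball by blast
      \<comment> \<open>A shift of \<open>e / 2\<close> leaves the edge; a point already off the
        edge is kept by the shift \<open>0\<close>.\<close>
      obtain t where t: "\<bar>t\<bar> < e" "coord c0 x $ 2 + t \<noteq> 0"
      proof (cases "coord c0 x $ 2 = 0")
        case True
        then show thesis using that[of "e / 2"] e(1) by simp
      next
        case False
        then show thesis using that[of 0] e(1) by simp
      qed
      have "coord c0 x + t *\<^sub>R axis 2 1 \<in> ball (coord c0 x) e"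
        using t(1) by (simp add: dist_norm norm_axis_1)
      then obtain y where y: "y \<in> W" "y \<in> Q" "coord c0 y = coord c0 x + t *\<^sub>R axis 2 1" using e(2) by force
      have "coord c0 y $ 2 \<noteq> 0" unfolding y(3) using t(2) by (simp add: axis_def)
      then have "y \<in> regular_points A B f" using regular_D y(1) W(2) by blast
      then show "(W \<inter> regular_points A B f) \<inter> X \<noteq> {}" using y Q(1) by blast
    qed
  qed
qed blast

lemma smooth_gauss_curvature:
  assumes W: "open W" "W \<subseteq> D"
  shows "smooth_fun_on A (W \<inter> regular_points A B f) (gauss_curvature A (pullback_metric B g f))"
  unfolding smooth_fun_on_def
proof
  fix a assume a: "a \<in> A"
  note ad = admissible_atlas[OF A a]
  let ?X = "coord a ` (cdom a \<inter> (W \<inter> regular_points A B f))"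
  have o: "open ?X"
    by (rule open_coord_image[OF charts(1)[OF ad]]) (use open_dense_regular[OF assms] in \<open>simp add: open_dense_in_def\<close>)
  have sub: "?X \<subseteq> coord a ` (cdom a \<inter> D)" using W(2) by blast
  have nz: "transition a c0 (coord a x) $ 2 \<noteq> 0" if "x \<in> cdom a" "x \<in> W" "x \<in> regular_points A B f" for x
    using that regular_D[of x] W(2) by (auto simp: transition_coord[OF charts(1)[OF ad]])
  have "smooth_on ?X (\<lambda>z. Phi (transition a c0 z) / transition a c0 z $ 2)"
    by (intro smooth_on_divide smooth_on_subset[OF smooth_Phi_chart(1)[OF ad] sub]
        smooth_on_subset[OF smooth_Phi_chart(2)[OF ad] sub] o) (use nz in auto)
  then show "smooth_on ?X (gauss_curvature A (pullback_metric B g f) \<circ> cinv a)"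
  proof (rule smooth_on_cong[OF o, rotated])
    fix z assume "z \<in> ?X"
    then obtain x where x: "x \<in> cdom a" "x \<in> W" "x \<in> regular_points A B f" "z = coord a x" by blast
    have "x \<in> D" "coord c0 x $ 2 \<noteq> 0" using x regular_D W(2) by blast+
    then show "Phi (transition a c0 z) / transition a c0 z $ 2 = (gauss_curvature A (pullback_metric B g f) \<circ> cinv a) z"
      using x(1) by (simp add: x(4) cinv_coord[OF charts(1)[OF ad]] transition_coord[OF charts(1)[OF ad]] gauss_curvature_D)
  qed
qed

text \<open>The blow up coordinates \<open>c\<close> are arbitrary, so \<open>Phi\<close> and the
  second coordinate of \<open>c0\<close> are composed with the transition \<open>w\<close>, a local
  diffeomorphism fixing the origin.\<close>

lemma rational_gauss_curvature:
  assumes c: "coords_centered_at A p c" and W: "open W" "p \<in> W" "W \<subseteq> cdom c \<inter> D"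
  shows "rationally_bounded A c p W (W \<inter> regular_points A B f) (gauss_curvature A (pullback_metric B g f))
      \<longleftrightarrow> limiting_normal_curvature B g f \<nu> \<gamma> 0 = 0"
    and "rationally_continuous A c p W (W \<inter> regular_points A B f) (gauss_curvature A (pullback_metric B g f))
      \<longleftrightarrow> limiting_normal_curvature B g f \<nu> \<gamma> 0 = 0 \<and> limiting_normal_curvature_deriv B g f \<nu> \<epsilon> \<gamma> = 0"
proof -
  let ?K = "gauss_curvature A (pullback_metric B g f)" and ?Y = "coord c ` (cdom c \<inter> D)"
  note ac = admissible_centered[OF c]
  note cc = charts(1)[OF ac]
  define w where "w = transition c c0"
  define v where "v y = w y $ 2" for y
  define \<Psi> where "\<Psi> y = Phi (w y)" for y
  have pc: "p \<in> cdom c" "coord c p = 0" using c unfolding coords_centered_at_def by auto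
  have pc0: "p \<in> cdom c0" "coord c0 p = 0" using c0 unfolding coords_centered_at_def by auto
  have Y0: "0 \<in> ?Y" using pc p_D by (metis IntI imageI)
  have w0: "w 0 = 0" unfolding w_def using transition_coord[OF cc pc(1), of c0] pc pc0 by simp
  have U0: "0 \<in> U" using p_D pc0 unfolding U_def by (metis imageI)
  have wd: "w differentiable (at 0)"
    unfolding w_def by (rule smooth_on_differentiable[OF smooth_Phi_chart(4)[OF ac] Y0])
  have Pd: "Phi differentiable (at 0)" by (rule smooth_on_differentiable[OF smooth_Phi U0])
  have Dv: "DD e v 0 = DD e w 0 $ 2" for e
    unfolding v_def by (rule DD_bounded_linear[OF bounded_linear_vec_nth wd])
  have D\<Psi>: "DD e \<Psi> 0 = DD (DD e w 0) Phi 0" for e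
    unfolding \<Psi>_def using DD_compose[of w 0 Phi e] wd Pd w0 by simp
  have surj: "\<exists>e. DD e w 0 = u" for u
    using transition_inverse[OF A adm(1) ac pc0(1) pc(1), of u] unfolding pc0(2) pc(2) w_def by blast
  have ax: "(axis 2 1 :: real^2) $ 2 = 1" "(axis 1 1 :: real^2) $ 2 = 0" by (simp_all add: axis_def)
  have WD: "W \<subseteq> D" "W \<subseteq> cdom c" using W(3) by auto
  have reg: "x \<in> regular_points A B f \<longleftrightarrow> v (coord c x) \<noteq> 0" if "x \<in> W" for x
  proof -
    have x: "x \<in> D" "x \<in> cdom c" using that WD by auto
    show ?thesis unfolding v_def w_def transition_coord[OF cc x(2)] by (rule regular_D[OF x(1)])
  qed
  interpret Q: quotient_on_blow_up c p W ?Y v \<Psi> ?K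
  proof
    show "cinv c (coord c x) = x" if "x \<in> cdom c" for x by (rule cinv_coord[OF cc that])
    show "open (coord c ` W)"
      using open_coord_image[OF cc W(1)] WD(2) by (simp add: Int_absorb1)
    show "coord c ` W \<subseteq> ?Y" using W(3) by blast
    show "open ?Y" by (rule smooth_Phi_chart(3)[OF ac])
    show "smooth_on ?Y v" unfolding v_def w_def by (rule smooth_Phi_chart(2)[OF ac])
    show "smooth_on ?Y \<Psi>" unfolding \<Psi>_def w_def by (rule smooth_Phi_chart(1)[OF ac])
    show "v 0 = 0" unfolding v_def w0 by simp
    obtain e where "DD e w 0 = axis 2 1" using surj by blast
    then have "DD e v 0 \<noteq> 0" unfolding Dv by (simp add: ax)
    then show "\<exists>e. DD e v 0 \<noteq> 0" by blast
    show "?K x = \<Psi> (coord c x) / v (coord c x)" if "x \<in> W" "v (coord c x) \<noteq> 0" for x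
    proof -
      have x: "x \<in> cdom c" "x \<in> D" using that(1) W(3) by auto
      have e: "w (coord c x) = coord c0 x" unfolding w_def by (rule transition_coord[OF cc x(1)])
      show ?thesis using gauss_curvature_D[OF x(2)] that(2) unfolding \<Psi>_def v_def e by blast
    qed
  qed (use W WD pc in auto)
  have R: "Q.Reg = W \<inter> regular_points A B f"
    unfolding Q.Reg_def using reg by blast
  have zero: "\<Psi> 0 = 0 \<longleftrightarrow> limiting_normal_curvature B g f \<nu> \<gamma> 0 = 0"
    unfolding \<Psi>_def w0 limiting_normal_curvature_zero by (rule Phi_edge_zero[OF U0]) simp
  \<comment> \<open>Both differentials are precomposed with the surjective differential of
    \<open>w\<close>. Testing on a preimage of the first coordinate vector gives one direction; for
    the other, \<open>k\<close> is the derivative of \<open>Phi\<close> across the edge.\<close>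
  have proportional: "(\<exists>k. \<forall>e. DD e \<Psi> 0 = k * DD e v 0) \<longleftrightarrow> DD (axis 1 1) Phi 0 = 0"
  proof
    assume "\<exists>k. \<forall>e. DD e \<Psi> 0 = k * DD e v 0"
    then obtain k where k: "DD e \<Psi> 0 = k * DD e v 0" for e by blast
    obtain e where e: "DD e w 0 = axis 1 1" using surj by blast
    show "DD (axis 1 1) Phi 0 = 0" using k[of e] unfolding D\<Psi> Dv e ax by simp
  next
    assume 0: "DD (axis 1 1) Phi 0 = 0"
    have "DD u Phi 0 = DD (axis 2 1) Phi 0 * u $ 2" for u
      using DD_direction_linear[OF Pd, of "u $ 1" "axis 1 1" "u $ 2" "axis 2 1"]
      unfolding axis_expand_2[symmetric] 0 by simp
    then show "\<exists>k. \<forall>e. DD e \<Psi> 0 = k * DD e v 0" unfolding D\<Psi> Dv by blast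
  qed
  \<comment> \<open>The hypothesis is essential to the comparison: the two derivatives are nonzero
    multiples of each other only where the limiting normal curvature vanishes.\<close>
  have der: "DD (axis 1 1) Phi 0 = 0 \<longleftrightarrow> limiting_normal_curvature_deriv B g f \<nu> \<epsilon> \<gamma> = 0"
    if "limiting_normal_curvature B g f \<nu> \<gamma> 0 = 0"
    unfolding limiting_normal_curvature_deriv_zero
    by (rule DD_Phi_edge_zero[OF U0]) (use that limiting_normal_curvature_zero in auto)
  show "rationally_bounded A c p W (W \<inter> regular_points A B f) ?K
      \<longleftrightarrow> limiting_normal_curvature B g f \<nu> \<gamma> 0 = 0"
    unfolding rationally_bounded_def zero[symmetric] R[symmetric]
    using Q.rational_pair_exists Q.rational_pair_zero open_dense_regular[OF W(1) WD(1)]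
      smooth_gauss_curvature[OF W(1) WD(1)] unfolding R[symmetric] by blast
  have "rationally_continuous A c p W (W \<inter> regular_points A B f) ?K
      \<longleftrightarrow> \<Psi> 0 = 0 \<and> (\<exists>k. \<forall>e. DD e \<Psi> 0 = k * DD e v 0)"
  proof
    assume "rationally_continuous A c p W (W \<inter> regular_points A B f) ?K"
    then obtain \<rho> \<psi> k where r: "rational_pair c p W Q.Reg ?K \<rho> \<psi>" "\<forall>q\<in>blow_up_preimage c {p}. \<psi> q = k * \<rho> q"
      unfolding rationally_continuous_def R by blast
    show "\<Psi> 0 = 0 \<and> (\<exists>k. \<forall>e. DD e \<Psi> 0 = k * DD e v 0)"
      using Q.rational_pair_zero[OF r(1)] Q.rational_pair_proportional[OF r] by blast
  next
    assume a: "\<Psi> 0 = 0 \<and> (\<exists>k. \<forall>e. DD e \<Psi> 0 = k * DD e v 0)"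
    then obtain k where k: "\<forall>e. DD e \<Psi> 0 = k * DD e v 0" by blast
    obtain \<rho> \<psi> where r: "rational_pair c p W Q.Reg ?K \<rho> \<psi>" "\<forall>q\<in>blow_up_preimage c {p}. \<psi> q = k * \<rho> q"
      using Q.rational_pair_exists a k by blast
    show "rationally_continuous A c p W (W \<inter> regular_points A B f) ?K"
      unfolding rationally_continuous_def
      using r open_dense_regular[OF W(1) WD(1)] smooth_gauss_curvature[OF W(1) WD(1)] unfolding R by blast
  qed
  then show "rationally_continuous A c p W (W \<inter> regular_points A B f) ?K
      \<longleftrightarrow> limiting_normal_curvature B g f \<nu> \<gamma> 0 = 0 \<and> limiting_normal_curvature_deriv B g f \<nu> \<epsilon> \<gamma> = 0"
    unfolding proportional zero using der by blast
qed

end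

theorem corollary2p12:
  fixes A :: "('s::{t2_space,second_countable_topology}, 2) chart set"
    and B :: "('m::{t2_space,second_countable_topology}, 3) chart set"
    and g :: "('m, 3) metric_family"
    and f :: "'s \<Rightarrow> 'm" and p :: 's
    and V :: "'s set" and \<nu> :: "'s \<Rightarrow> ('m, 3) chart \<Rightarrow> real^3"
    and \<epsilon> :: real and \<gamma> :: "real \<Rightarrow> 's"
    and c :: "('s, 2) chart"
  assumes "oriented_atlas A"
    and "oriented_atlas B"
    and "riemannian_metric B g"
    and "frontal A B g f"
    and "cuspidal_edge A B f p"
    and "open V" and "p \<in> V" and "unit_normal_on A B g f V \<nu>"
    and "singular_curve A B f p \<epsilon> \<gamma>"
    and "coords_centered_at A p c"
  shows "\<exists>N. open N \<and> p \<in> N \<and> N \<subseteq> cdom c \<and>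
    (\<forall>W. open W \<and> p \<in> W \<and> W \<subseteq> N \<longrightarrow>
      (rationally_bounded A c p W (W \<inter> regular_points A B f)
          (gauss_curvature A (pullback_metric B g f))
        \<longleftrightarrow> limiting_normal_curvature B g f \<nu> \<gamma> 0 = 0) \<and>
      (rationally_continuous A c p W (W \<inter> regular_points A B f)
          (gauss_curvature A (pullback_metric B g f))
        \<longleftrightarrow> limiting_normal_curvature B g f \<nu> \<gamma> 0 = 0 \<and>
            limiting_normal_curvature_deriv B g f \<nu> \<epsilon> \<gamma> = 0))"
proof -
  obtain c0 d0 where e: "coords_centered_at A p c0" "coords_centered_at B (f p) d0" "f ` cdom c0 \<subseteq> cdom d0"
    "\<forall>x\<in>cdom c0. coord d0 (f x) = vector [coord c0 x $ 1, (coord c0 x $ 2)\<^sup>2, (coord c0 x $ 2) ^ 3]"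
    using assms(5) unfolding cuspidal_edge_def by blast
  obtain d where d: "d \<in> B" "f p \<in> cdom d" using atlas_cover[OF assms(2)] by blast
  interpret E: edge_curve A B g f p V \<nu> c0 d0 d \<epsilon> \<gamma>
    by unfold_locales (use assms e d in \<open>auto simp: frontal_def\<close>)
  have "is_chart c" "p \<in> cdom c" using assms(10) unfolding coords_centered_at_def by auto
  then have "open (cdom c \<inter> E.D)" "p \<in> cdom c \<inter> E.D"
    using E.open_D E.p_D unfolding is_chart_def by auto
  \<comment> \<open>The neighbourhood is cut down to \<open>D\<close>, where the normal form, the
    given unit normal and the atlas chart \<open>d\<close> are available simultaneously.\<close>
  then show ?thesis
    using E.rational_gauss_curvature[OF assms(10)] by (intro exI[of _ "cdom c \<inter> E.D"]) blast
qed

end
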